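(* Let $d\ge 2$ and $n\ge 1$ be integers, let $G=G(d,1,n)$, let $c$ be a fixed Coxeter element of $G$, and let $k\ge 1$. For nonnegative integers $r_1,\dots,r_k$ let $a^{(d)}_{r_1,\ldots,r_k}$ be the number of $k$-tuples $(u_1,\dots,u_k)\in G^k$ with $u_1\cdots u_k=c$ and $\dim\operatorname{fix}(u_i)=r_i$ for $i=1,\dots,k$. Then \[ \sum_{r_1,\ldots,r_k\ge 0} a^{(d)}_{r_1,\ldots,r_k}\, x_1^{r_1}\cdots x_k^{r_k} \;=\; |G|^{k-1}\sum_{p_1,\ldots,p_k\ge 0} M^n_{p_1,\ldots,p_k}\,\frac{(x_1-1)^{(d)}_{p_1}}{d^{p_1}p_1!}\cdots\frac{(x_k-1)^{(d)}_{p_k}}{d^{p_k}p_k!}. \]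
   Context: $G(d,1,n)$ is the group of $n\times n$ complex matrices having exactly one nonzero entry in each row and each column, every nonzero entry being a $d$-th root of unity; it is a complex reflection group acting on $\mathbb{C}^n$, and $|G(d,1,n)|=d^n n!$. For $w\in G$, $\operatorname{fix}(w)=\{v\in\mathbb{C}^n: wv=v\}$. An element $w$ of a complex reflection group is regular if it has an eigenvector not lying in the fixed hyperplane of any reflection of the group; if the corresponding eigenvalue is a primitive $m$-th root of unity, $m$ is called a regular integer. The Coxeter number $h$ is the largest regular integer, and a Coxeter element is a regular element of order $h$ (for example, in $G(d,1,n)$ the generalized permutation matrix of the cycle $1\to2\to\cdots\to n\to1$ with one entry replaced by $e^{2\pi i/d}$). For integers $k$, $(x-1)^{(d)}_k:=(x-1)(x-1-d)(x-1-2d)\cdots(x-1-(k-1)d)$ (equal to $1$ for $k=0$). For nonnegative $n$ and integers $p_1,\dots,p_k$, $M^n_{p_1,\ldots,p_k}:=[x_1^{p_1}\cdots x_k^{p_k}]\big((1+x_1)\cdots(1+x_k)-x_1\cdots x_k\big)^n$ (zero if some $p_i<0$); equivalently $M^n_{p_1,\ldots,p_k}=\sum_{t\ge0}(-1)^t\binom{n}{t}\prod_{i=1}^k\binom{n-t}{p_i-t}$. *)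

theory Defs
  imports
    "HOL-Analysis.Analysis"
    "HOL-Algebra.Multiplicative_Group"
    "HOL-Library.Poly_Mapping"
begin

text \<open>Groups of complex $n \times n$ matrices are records over \<open>complex^'n^'n\<close>, where
  $n$ is \<open>CARD('n)\<close>.\<close>

type_synonym 'n cmat_group = "(complex^'n^'n) monoid"

definition Gd1n :: "nat \<Rightarrow> 'n::finite cmat_group" where
  "Gd1n d = \<lparr>carrier = {A. (\<forall>i. \<exists>!j. A $ i $ j \<noteq> 0) \<and> (\<forall>j. \<exists>!i. A $ i $ j \<noteq> 0) \<and>
                        (\<forall>i j. A $ i $ j \<noteq> 0 \<longrightarrow> (A $ i $ j) ^ d = 1)},
             monoid.mult = (**), one = mat 1\<rparr>"

definition fix_space :: "complex^'n^'n \<Rightarrow> (complex^'n) set" where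
  "fix_space w = {v. w *v v = v}"

definition reflections :: "'n::finite cmat_group \<Rightarrow> (complex^'n^'n) set" where
  "reflections G = {t \<in> carrier G. vec.dim (fix_space t) + 1 = CARD('n)}"

definition regular_eigenpair ::
    "'n::finite cmat_group \<Rightarrow> complex^'n^'n \<Rightarrow> complex \<Rightarrow> complex^'n \<Rightarrow> bool" where
  "regular_eigenpair G w l v \<longleftrightarrow>
     v \<noteq> 0 \<and> w *v v = l *s v \<and> (\<forall>t \<in> reflections G. v \<notin> fix_space t)"

definition regular_element :: "'n::finite cmat_group \<Rightarrow> complex^'n^'n \<Rightarrow> bool" where
  "regular_element G w \<longleftrightarrow> w \<in> carrier G \<and> (\<exists>l v. regular_eigenpair G w l v)"

definition primitive_root_of_unity :: "nat \<Rightarrow> complex \<Rightarrow> bool" where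
  "primitive_root_of_unity m z \<longleftrightarrow> m > 0 \<and> z ^ m = 1 \<and> (\<forall>j. 0 < j \<and> j < m \<longrightarrow> z ^ j \<noteq> 1)"

definition regular_integer :: "'n::finite cmat_group \<Rightarrow> nat \<Rightarrow> bool" where
  "regular_integer G m \<longleftrightarrow>
     (\<exists>w \<in> carrier G. \<exists>l v. regular_eigenpair G w l v \<and> primitive_root_of_unity m l)"

definition coxeter_number :: "'n::finite cmat_group \<Rightarrow> nat" where
  "coxeter_number G = (GREATEST m. regular_integer G m)"

definition coxeter_element :: "'n::finite cmat_group \<Rightarrow> complex^'n^'n \<Rightarrow> bool" where
  "coxeter_element G c \<longleftrightarrow> regular_element G c \<and> group.ord G c = coxeter_number G"

text \<open>Tuples $(u_1, \ldots, u_k)$ and $(r_1, \ldots, r_k)$ are lists of length $k$, so position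
  $i$ of a list holds the entry with index $i + 1$.\<close>

definition factorization_count ::
    "'n::finite cmat_group \<Rightarrow> complex^'n^'n \<Rightarrow> nat list \<Rightarrow> nat" where
  "factorization_count G c r =
     card {u. length u = length r \<and> set u \<subseteq> carrier G \<and>
              foldr (monoid.mult G) u (one G) = c \<and>
              (\<forall>i < length r. vec.dim (fix_space (u ! i)) = r ! i)}"

text \<open>Polynomials in the indeterminates $X_0, X_1, \ldots$ over \<open>'a\<close>: finitely supported maps
  from exponent vectors to coefficients, with convolution as multiplication.\<close>

type_synonym 'a multipoly = "(nat \<Rightarrow>\<^sub>0 nat) \<Rightarrow>\<^sub>0 'a"

definition X :: "nat \<Rightarrow> 'a::zero_neq_one multipoly" where
  "X i = Poly_Mapping.single (Poly_Mapping.single i 1) 1"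

definition Cst :: "'a::zero \<Rightarrow> 'a multipoly" where
  "Cst a = Poly_Mapping.single 0 a"

definition M_coeff :: "nat \<Rightarrow> nat list \<Rightarrow> int" where
  "M_coeff n p =
     Poly_Mapping.lookup
       (((\<Prod>i<length p. 1 + X i) - (\<Prod>i<length p. X i)) ^ n)
       (Poly_Mapping.nth p)"

definition falling :: "nat \<Rightarrow> nat \<Rightarrow> 'a::comm_ring_1 \<Rightarrow> 'a" where
  "falling d p x = (\<Prod>j<p. x - 1 - of_nat (j * d))"

text \<open>A sum over an infinite set is $0$ by convention, so sums over all tuples are taken over
  the tuples with nonzero coefficient; these are finitely many.\<close>

lemma finite_factorization_count_support:
  fixes G :: "'n::finite cmat_group"
  shows "finite {r. length r = k \<and> factorization_count G c r \<noteq> 0}"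
proof (rule finite_subset)
  show "finite {r. set r \<subseteq> {..CARD('n)} \<and> length r = k}"
    by (rule finite_lists_length_eq) simp
  show "{r. length r = k \<and> factorization_count G c r \<noteq> 0}
          \<subseteq> {r. set r \<subseteq> {..CARD('n)} \<and> length r = k}"
  proof (intro subsetI CollectI conjI)
    fix r x
    assume r: "r \<in> {r. length r = k \<and> factorization_count G c r \<noteq> 0}"
    then show "length r = k" by simp
    assume "x \<in> set r"
    then obtain i where i: "i < length r" "x = r ! i"
      by (auto simp: in_set_conv_nth)
    from r have "factorization_count G c r \<noteq> 0" by simp
    then obtain u where "\<forall>i < length r. vec.dim (fix_space (u ! i) :: (complex^'n) set) = r ! i"
      unfolding factorization_count_def by (metis (mono_tags, lifting) card_eq_0_iff empty_Collect_eq)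
    with i have "x = vec.dim (fix_space (u ! i) :: (complex^'n) set)" by simp
    then show "x \<in> {..CARD('n)}"
      by (simp add: dim_subset_UNIV_cart_gen)
  qed
qed

lemma finite_M_coeff_support: "finite {p. length p = k \<and> M_coeff n p \<noteq> 0}"
proof (rule finite_subset)
  let ?P = "((\<Prod>i<k. 1 + X i) - (\<Prod>i<k. X i)) ^ n :: int multipoly"
  show "finite ((\<lambda>m. map (Poly_Mapping.lookup m) [0..<k]) ` Poly_Mapping.keys ?P)"
    by simp
  show "{p. length p = k \<and> M_coeff n p \<noteq> 0}
          \<subseteq> (\<lambda>m. map (Poly_Mapping.lookup m) [0..<k]) ` Poly_Mapping.keys ?P"
  proof clarify
    fix p :: "nat list"
    assume "M_coeff n p \<noteq> 0" and k: "k = length p"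
    then have "Poly_Mapping.nth p
        \<in> Poly_Mapping.keys (((\<Prod>i<length p. 1 + X i) - (\<Prod>i<length p. X i)) ^ n :: int multipoly)"
      by (simp add: M_coeff_def in_keys_iff)
    moreover have "p = map (Poly_Mapping.lookup (Poly_Mapping.nth p)) [0..<length p]"
      by (auto intro!: nth_equalityI simp: nth_default_nth)
    ultimately show "p \<in> (\<lambda>m. map (Poly_Mapping.lookup m) [0..<length p]) `
        Poly_Mapping.keys (((\<Prod>i<length p. 1 + X i) - (\<Prod>i<length p. X i)) ^ n :: int multipoly)"
      by blast
  qed
qed

end

theory Submission
  imports Defs "HOL-Combinatorics.Orbits"
begin

text \<open>
  At \<open>x = 1 + d j\<close> the weight \<open>x ^ dim fix u\<close> counts the \<open>u\<close>-fixed vectors all of whose entries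
  lie in a set of \<open>1 + d j\<close> complex numbers that contains \<open>0\<close> and is stable under \<open>d\<close>-th roots of
  unity. Summing over the nonzero entries of \<open>u\<close> turns the weighted factorizations in \<open>G(d,1,n)\<close>
  into the difference of two such sums over \<open>S\<^sub>n\<close>, in which a permutation is weighted by the number
  of colorings that it fixes, with \<open>j + 1\<close> and with \<open>j\<close> colors: a coloring with a zero entry
  makes the product of the nonzero entries equidistributed, and one without zero entries forces it
  to be \<open>1\<close>, which is excluded for a Coxeter element.

  In \<open>S\<^sub>n\<close>, the indicator of the \<open>n\<close>-cycles is an alternating combination of Young symmetrizers of
  hook shape. They are eigenfunctions of convolution with every class function, so the sum over
  \<open>k\<close>-fold products factors into \<open>k\<close> eigenvalues. This gives the generating function at all points
  \<open>x\<^sub>i = 1 + d j\<^sub>i\<close>, and Newton interpolation there yields the coefficients \<open>M\<close>.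
\<close>

section \<open>Newton interpolation\<close>

definition tuples :: "'a set \<Rightarrow> nat \<Rightarrow> 'a list set" where
  "tuples A k = {xs. set xs \<subseteq> A \<and> length xs = k}"

lemma finite_tuples: "finite A \<Longrightarrow> finite (tuples A k)"
  unfolding tuples_def by (rule finite_lists_length_eq)

lemma tuples_0: "tuples A 0 = {[]}"
  by (auto simp: tuples_def)

lemma sum_tuples_Suc: "(\<Sum>xs\<in>tuples A (Suc k). f xs) = (\<Sum>x\<in>A. \<Sum>xs\<in>tuples A k. f (x # xs))"
proof -
  have "bij_betw (\<lambda>(x, xs). x # xs) (A \<times> tuples A k) (tuples A (Suc k))"
    by (rule bij_betwI[where g = "\<lambda>xs. (hd xs, tl xs)"]) (auto simp: tuples_def length_Suc_conv)
  from sum.reindex_bij_betw[OF this, of f] show ?thesis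
    by (simp add: sum.cartesian_product case_prod_unfold)
qed

lemma prod_sum_tuples:
  fixes f :: "nat \<Rightarrow> 'b \<Rightarrow> 'c::comm_semiring_1"
  shows "(\<Prod>i<k. \<Sum>j\<in>B. f i j) = (\<Sum>p\<in>tuples B k. \<Prod>i<k. f i (p ! i))"
proof (induction k arbitrary: f)
  case 0
  show ?case by (simp add: tuples_0)
next
  case (Suc k)
  have "(\<Prod>i<Suc k. \<Sum>j\<in>B. f i j) = (\<Sum>j\<in>B. f 0 j) * (\<Sum>p\<in>tuples B k. \<Prod>i<k. f (Suc i) (p ! i))"
    unfolding prod.lessThan_Suc_shift Suc.IH ..
  also have "\<dots> = (\<Sum>p\<in>tuples B (Suc k). \<Prod>i<Suc k. f i (p ! i))"
    by (simp add: sum_product sum_tuples_Suc prod.lessThan_Suc_shift del: prod.lessThan_Suc)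
  finally show ?case .
qed

definition forward_difference :: "nat \<Rightarrow> (nat \<Rightarrow> 'a) \<Rightarrow> 'a::comm_ring_1" where
  "forward_difference p g = (\<Sum>j\<le>p. (-1) ^ (p + j) * of_nat (p choose j) * g j)"

lemma forward_difference_0: "forward_difference 0 g = g 0"
  by (simp add: forward_difference_def)

lemma forward_difference_eq_sum:
  assumes "p \<le> n"
  shows "forward_difference p g = (\<Sum>j\<le>n. (-1) ^ (p + j) * of_nat (p choose j) * g j)"
  unfolding forward_difference_def
  by (rule sum.mono_neutral_left) (use assms in \<open>auto simp: binomial_eq_0\<close>)

lemma forward_difference_Suc:
  "forward_difference (Suc p) g = forward_difference p (\<lambda>j. g (Suc j)) - forward_difference p g"
proof -
  have "forward_difference (Suc p) g = (-1) ^ Suc p * g 0 +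
      (\<Sum>j\<le>p. (-1) ^ (p + j) * of_nat (Suc p choose Suc j) * g (Suc j))"
    unfolding forward_difference_def by (subst sum.atMost_Suc_shift) simp
  also have "\<dots> = forward_difference p (\<lambda>j. g (Suc j)) +
      ((-1) ^ Suc p * g 0 + (\<Sum>j\<le>p. (-1) ^ (p + j) * of_nat (p choose Suc j) * g (Suc j)))"
    by (simp add: forward_difference_def algebra_simps sum.distrib)
  also have "(-1) ^ Suc p * g 0 + (\<Sum>j\<le>p. (-1) ^ (p + j) * of_nat (p choose Suc j) * g (Suc j))
      = - (\<Sum>j\<le>Suc p. (-1) ^ (p + j) * of_nat (p choose j) * g j)"
    by (subst sum.atMost_Suc_shift) (simp add: sum_negf)
  also have "(\<Sum>j\<le>Suc p. (-1) ^ (p + j) * of_nat (p choose j) * g j) = forward_difference p g"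
    by (rule forward_difference_eq_sum[symmetric]) simp
  finally show ?thesis by simp
qed

lemma forward_difference_add:
  "forward_difference p (\<lambda>j. g j + h j) = forward_difference p g + forward_difference p h"
  by (simp add: forward_difference_def distrib_left sum.distrib)

lemma forward_difference_scale: "forward_difference p (\<lambda>j. a * g j) = a * forward_difference p g"
  by (simp add: forward_difference_def sum_distrib_left mult.left_commute)

lemma forward_difference_index_mult:
  "forward_difference p (\<lambda>j. of_nat j * g j) =
     of_nat p * (forward_difference p g + forward_difference (p - 1) g)"
proof (cases p)
  case (Suc q)
  have "forward_difference (Suc q) (\<lambda>j. of_nat j * g j) =
      of_nat (Suc q) * (forward_difference (Suc q) g + forward_difference q g)" for g :: "nat \<Rightarrow> 'a"
  proof (induction q arbitrary: g)
    case 0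
    show ?case by (simp add: forward_difference_Suc forward_difference_0)
  next
    case (Suc q)
    have "forward_difference (Suc (Suc q)) (\<lambda>j. of_nat j * g j) =
        forward_difference (Suc q) (\<lambda>j. g (Suc j) + of_nat j * g (Suc j)) -
        forward_difference (Suc q) (\<lambda>j. of_nat j * g j)"
      by (subst forward_difference_Suc) (simp add: distrib_right)
    also have "\<dots> = forward_difference (Suc q) (\<lambda>j. g (Suc j)) +
        of_nat (Suc q) * (forward_difference (Suc (Suc q)) g + forward_difference (Suc q) g)"
      unfolding forward_difference_add Suc.IH
      by (simp add: forward_difference_Suc algebra_simps)
    also have "forward_difference (Suc q) (\<lambda>j. g (Suc j)) =
        forward_difference (Suc (Suc q)) g + forward_difference (Suc q) g"
      by (subst (2) forward_difference_Suc) simp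
    finally show ?case by (simp add: algebra_simps)
  qed
  then show ?thesis using Suc by simp
qed (simp add: forward_difference_0)

lemma forward_difference_affine_mult:
  "forward_difference p (\<lambda>j. (1 + of_nat (d * j)) * g j) =
     (1 + of_nat (d * p)) * forward_difference p g + of_nat (d * p) * forward_difference (p - 1) g"
proof -
  have "forward_difference p (\<lambda>j. (1 + of_nat (d * j)) * g j) =
      forward_difference p (\<lambda>j. g j + of_nat d * (of_nat j * g j))"
    by (simp add: algebra_simps)
  also have "\<dots> = forward_difference p g +
      of_nat d * (of_nat p * (forward_difference p g + forward_difference (p - 1) g))"
    unfolding forward_difference_add forward_difference_scale forward_difference_index_mult ..
  finally show ?thesis by (simp add: algebra_simps)
qed

lemma forward_difference_affine_power_eq_0:
  "r < p \<Longrightarrow> forward_difference p (\<lambda>j. (1 + of_nat (d * j)) ^ r) = (0 :: 'a::comm_ring_1)"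
proof (induction r arbitrary: p)
  case 0
  then obtain q where "p = Suc q" by (cases p) auto
  then show ?case by (simp add: forward_difference_Suc)
next
  case (Suc r)
  then show ?case
    using forward_difference_affine_mult[of p d "\<lambda>j. (1 + of_nat (d * j)) ^ r :: 'a"] by simp
qed

lemma forward_difference_binomial:
  "p \<le> n \<Longrightarrow> forward_difference p (\<lambda>j. of_nat ((j + b) choose n)) =
     (of_nat (b choose (n - p)) :: 'a::comm_ring_1)"
proof (induction p arbitrary: b)
  case 0
  then show ?case by (simp add: forward_difference_0)
next
  case (Suc p)
  have "n - p = Suc (n - Suc p)" using Suc.prems by simp
  then have "Suc b choose (n - p) = (b choose (n - p)) + (b choose (n - Suc p))" by simp
  moreover have "forward_difference p (\<lambda>j. of_nat ((Suc j + b) choose n)) =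
      (of_nat (Suc b choose (n - p)) :: 'a)"
    using Suc.IH[of "Suc b"] Suc.prems by simp
  ultimately show ?case
    using Suc.IH[of b] Suc.prems by (simp add: forward_difference_Suc)
qed

definition mixed_difference :: "nat \<Rightarrow> nat list \<Rightarrow> (nat list \<Rightarrow> 'a) \<Rightarrow> 'a::comm_ring_1" where
  "mixed_difference n p \<phi> = (\<Sum>q\<in>tuples {..n} (length p).
     (\<Prod>i<length p. (-1) ^ (p ! i + q ! i) * of_nat (p ! i choose q ! i)) * \<phi> q)"

lemma mixed_difference_cong:
  assumes "\<And>q. q \<in> tuples {..n} (length p) \<Longrightarrow> \<phi> q = \<psi> q"
  shows "mixed_difference n p \<phi> = mixed_difference n p \<psi>"
  unfolding mixed_difference_def by (intro sum.cong refl) (simp add: assms)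

lemma mixed_difference_sum:
  "mixed_difference n p (\<lambda>q. \<Sum>a\<in>A. c a * \<phi> a q) =
     (\<Sum>a\<in>A. c a * mixed_difference n p (\<phi> a))"
  unfolding mixed_difference_def sum_distrib_left
  by (subst sum.swap) (simp only: mult.left_commute)

lemma mixed_difference_scale: "mixed_difference n p (\<lambda>q. c * \<phi> q) = c * mixed_difference n p \<phi>"
  using mixed_difference_sum[of n p "\<lambda>_. c" "\<lambda>_. \<phi>" "{()}"] by simp

lemma mixed_difference_prod:
  assumes "p \<in> tuples {..n} k"
  shows "mixed_difference n p (\<lambda>q. \<Prod>i<k. g i (q ! i)) = (\<Prod>i<k. forward_difference (p ! i) (g i))"
proof -
  have "length p = k" and "p ! i \<le> n" if "i < k" for i
    using assms that by (auto simp: tuples_def subset_iff)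
  then have "(\<Prod>i<k. forward_difference (p ! i) (g i)) =
      (\<Prod>i<k. \<Sum>j\<le>n. (-1) ^ (p ! i + j) * of_nat (p ! i choose j) * g i j)"
    by (intro prod.cong refl forward_difference_eq_sum) simp
  also have "\<dots> = mixed_difference n p (\<lambda>q. \<Prod>i<k. g i (q ! i))"
    using assms by (simp add: mixed_difference_def prod_sum_tuples prod.distrib tuples_def)
  finally show ?thesis by (rule sym)
qed

lemma Cst_add: "Cst (a + b) = Cst a + Cst b"
  by (simp add: Cst_def single_add)

lemma Cst_mult: "Cst (a * b) = Cst a * Cst b"
  for a b :: "'a::comm_semiring_1"
  by (simp add: Cst_def mult_single)

lemma Cst_of_nat: "of_nat m = Cst (of_nat m)"
  by (simp add: Cst_def)

lemma Cst_of_int: "of_int m = Cst (of_int m)"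
  by (simp add: Cst_def)

lemma Cst_0 [simp]: "Cst 0 = 0"
  by (simp add: Cst_def)

lemma Cst_1 [simp]: "Cst 1 = 1"
  by (simp add: Cst_def)

lemma Cst_sum: "Cst (sum f A) = (\<Sum>a\<in>A. Cst (f a))"
  by (induction A rule: infinite_finite_induct) (simp_all add: Cst_add)

lemma Cst_prod: "Cst (prod f A) = (\<Prod>a\<in>A. Cst (f a))"
  for f :: "_ \<Rightarrow> 'a::comm_semiring_1"
  by (induction A rule: infinite_finite_induct) (simp_all add: Cst_mult)

definition newton_basis :: "nat \<Rightarrow> nat \<Rightarrow> rat multipoly \<Rightarrow> rat multipoly" where
  "newton_basis d p x = Cst (1 / (of_nat d ^ p * fact p)) * falling d p x"

lemma newton_basis_0: "newton_basis d 0 x = 1"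
  by (simp add: newton_basis_def falling_def)

lemma mult_newton_basis:
  assumes "d > 0"
  shows "x * newton_basis d p x =
    Cst (1 + of_nat (d * p)) * newton_basis d p x + Cst (of_nat (d * Suc p)) * newton_basis d (Suc p) x"
proof -
  have coefficient: "of_nat (d * Suc p) * (1 / (of_nat d ^ Suc p * fact (Suc p))) =
      (1 / (of_nat d ^ p * fact p) :: rat)"
    using assms by (simp add: divide_simps del: of_nat_Suc) (simp add: algebra_simps)
  have "Cst (of_nat (d * Suc p)) * newton_basis d (Suc p) x =
      Cst (1 / (of_nat d ^ p * fact p)) * (falling d p x * (x - 1 - of_nat (p * d)))"
    unfolding newton_basis_def mult.assoc[symmetric] Cst_mult[symmetric] coefficient
    by (simp add: falling_def mult.assoc)
  also have "\<dots> = (x - Cst (1 + of_nat (d * p))) * newton_basis d p x"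
    by (simp add: newton_basis_def Cst_add Cst_of_nat[symmetric] algebra_simps del: of_nat_mult)
  finally show ?thesis by (simp add: algebra_simps)
qed

lemma power_eq_newton_sum:
  assumes d: "d > 0" and "r \<le> m"
  shows "x ^ r =
    (\<Sum>p\<le>m. Cst (forward_difference p (\<lambda>j. (1 + of_nat (d * j)) ^ r)) * newton_basis d p x)"
  using \<open>r \<le> m\<close>
proof (induction r)
  case 0
  have "forward_difference p (\<lambda>j. (1 + of_nat (d * j)) ^ 0) = (of_bool (p = 0) :: rat)" for p
    by (cases p) (simp_all add: forward_difference_Suc forward_difference_0)
  then have "(\<Sum>p\<le>m.
        Cst (forward_difference p (\<lambda>j. (1 + of_nat (d * j)) ^ 0)) * newton_basis d p x) =
      (\<Sum>p\<le>m. if p = 0 then newton_basis d p x else 0)"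
    by (intro sum.cong) simp_all
  then show ?case by (simp add: newton_basis_0)
next
  case (Suc r)
  define c :: "nat \<Rightarrow> rat" where "c p = forward_difference p (\<lambda>j. (1 + of_nat (d * j)) ^ r)" for p
  define B where "B p = newton_basis d p x" for p
  obtain l where m: "m = Suc l" using Suc.prems by (cases m) auto
  have c_m: "c m = 0"
    unfolding c_def using Suc.prems by (intro forward_difference_affine_power_eq_0) simp
  have c_Suc: "forward_difference p (\<lambda>j. (1 + of_nat (d * j)) ^ Suc r) =
      (1 + of_nat (d * p)) * c p + of_nat (d * p) * c (p - 1)" for p
    using forward_difference_affine_mult[of p d "\<lambda>j. (1 + of_nat (d * j)) ^ r :: rat"]
    by (simp add: c_def)
  have "x ^ Suc r = (\<Sum>p\<le>m. Cst (c p) * (x * B p))"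
    using Suc by (simp add: c_def B_def sum_distrib_left algebra_simps)
  also have "\<dots> = (\<Sum>p\<le>m. Cst ((1 + of_nat (d * p)) * c p) * B p) +
      (\<Sum>p\<le>m. Cst (of_nat (d * Suc p) * c p) * B (Suc p))"
    unfolding B_def mult_newton_basis[OF d] Cst_mult distrib_left sum.distrib
    by (simp only: mult_ac)
  also have "(\<Sum>p\<le>m. Cst (of_nat (d * Suc p) * c p) * B (Suc p)) =
      (\<Sum>p\<le>l. Cst (of_nat (d * Suc p) * c p) * B (Suc p))"
    using c_m by (simp add: m)
  also have "\<dots> = (\<Sum>p\<le>m. Cst (of_nat (d * p) * c (p - 1)) * B p)"
    unfolding m by (subst sum.atMost_Suc_shift) simp
  finally show ?case
    unfolding c_Suc B_def[symmetric] by (simp only: Cst_add distrib_right sum.distrib)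
qed

theorem newton_interpolation:
  fixes a :: "nat list \<Rightarrow> rat"
  assumes d: "d > 0"
  shows "(\<Sum>r\<in>tuples {..n} k. Cst (a r) * (\<Prod>i<k. X i ^ (r ! i))) =
    (\<Sum>p\<in>tuples {..n} k.
      Cst (mixed_difference n p
        (\<lambda>q. \<Sum>r\<in>tuples {..n} k. a r * (\<Prod>i<k. (1 + of_nat (d * q ! i)) ^ (r ! i)))) *
      (\<Prod>i<k. newton_basis d (p ! i) (X i)))"
proof -
  define c :: "nat \<Rightarrow> nat \<Rightarrow> rat"
    where "c r p = forward_difference p (\<lambda>j. (1 + of_nat (d * j)) ^ r)" for r p
  have monomial: "(\<Prod>i<k. X i ^ (r ! i)) =
      (\<Sum>p\<in>tuples {..n} k. Cst (\<Prod>i<k. c (r ! i) (p ! i)) * (\<Prod>i<k. newton_basis d (p ! i) (X i)))"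
    if "r \<in> tuples {..n} k" for r
  proof -
    have "(\<Prod>i<k. X i ^ (r ! i)) = (\<Prod>i<k. \<Sum>p\<le>n. Cst (c (r ! i) p) * newton_basis d p (X i))"
      unfolding c_def using that
      by (intro prod.cong refl power_eq_newton_sum[OF d]) (auto simp: tuples_def subset_iff)
    then show ?thesis by (simp only: prod_sum_tuples prod.distrib Cst_prod)
  qed
  have coefficient: "(\<Sum>r\<in>tuples {..n} k. a r * (\<Prod>i<k. c (r ! i) (p ! i))) =
      mixed_difference n p (\<lambda>q. \<Sum>r\<in>tuples {..n} k. a r * (\<Prod>i<k. (1 + of_nat (d * q ! i)) ^ (r ! i)))"
    if "p \<in> tuples {..n} k" for p
    unfolding mixed_difference_sum c_def
      mixed_difference_prod[OF that, of "\<lambda>i j. (1 + of_nat (d * j)) ^ (r ! i)" for r] ..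
  have "(\<Sum>r\<in>tuples {..n} k. Cst (a r) * (\<Prod>i<k. X i ^ (r ! i))) =
      (\<Sum>r\<in>tuples {..n} k. \<Sum>p\<in>tuples {..n} k.
        Cst (a r * (\<Prod>i<k. c (r ! i) (p ! i))) * (\<Prod>i<k. newton_basis d (p ! i) (X i)))"
    by (intro sum.cong refl) (simp only: monomial sum_distrib_left Cst_mult mult.assoc)
  also have "\<dots> = (\<Sum>p\<in>tuples {..n} k. Cst (\<Sum>r\<in>tuples {..n} k. a r * (\<Prod>i<k. c (r ! i) (p ! i))) *
      (\<Prod>i<k. newton_basis d (p ! i) (X i)))"
    by (subst sum.swap) (simp only: Cst_sum sum_distrib_right)
  finally show ?thesis by (simp add: coefficient cong: sum.cong)
qed

section \<open>The coefficients \<open>M\<close>\<close>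

lemma X_power: "X i ^ e = Poly_Mapping.single (Poly_Mapping.single i e) 1"
  by (induction e) (simp_all add: X_def mult_single single_add[symmetric])

lemma monomial_eq_single:
  "(\<Prod>i<length p. X i ^ (p ! i)) =
     (Poly_Mapping.single (Poly_Mapping.nth p) 1 :: 'a::comm_ring_1 multipoly)"
proof -
  have "(\<Prod>i<m. X i ^ (p ! i) :: 'a multipoly) =
      Poly_Mapping.single (\<Sum>i<m. Poly_Mapping.single i (p ! i)) 1" for m
    by (induction m) (simp_all add: X_power mult_single)
  moreover have "(\<Sum>i<length p. Poly_Mapping.single i (p ! i)) = Poly_Mapping.nth p"
    by (rule poly_mapping_eqI) (auto simp: lookup_sum lookup_single when_def nth_default_def)
  ultimately show ?thesis by simp
qed

lemma poly_mapping_nth_inject: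
  assumes "length p = length q" and nth_eq: "Poly_Mapping.nth p = Poly_Mapping.nth q"
  shows "p = q"
proof (rule nth_equalityI)
  fix i assume "i < length p"
  then show "p ! i = q ! i"
    using arg_cong[OF nth_eq, of "\<lambda>m. Poly_Mapping.lookup m i"] assms(1)
    by (simp add: nth_default_def)
qed fact

lemma lookup_monomial:
  assumes "length p = k" "length q = k"
  shows "Poly_Mapping.lookup (\<Prod>i<k. X i ^ (p ! i)) (Poly_Mapping.nth q) =
    (of_bool (p = q) :: 'a::comm_ring_1)"
  using poly_mapping_nth_inject[of p q] monomial_eq_single[of p, where 'a = 'a] assms
  by (auto simp: lookup_single when_def)

lemma lookup_Cst_mult:
  "Poly_Mapping.lookup (Cst a * f) m = a * Poly_Mapping.lookup f m"
  for a :: "'a::comm_semiring_1"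
  by (simp add: Cst_def map.rep_eq when_def flip: mult_map_scale_conv_mult)

lemma binomial_power_shift:
  fixes x :: "'a::comm_ring_1"
  assumes "t \<le> n"
  shows "(1 + x) ^ (n - t) * x ^ t = (\<Sum>j\<le>n. of_nat ((n - t) choose (n - j)) * x ^ j)"
proof -
  have "(1 + x) ^ (n - t) * x ^ t = (\<Sum>j\<le>n - t. of_nat ((n - t) choose j) * x ^ (j + t))"
    using binomial_ring[of x 1 "n - t"]
    by (simp add: add.commute sum_distrib_right power_add mult.assoc)
  also have "\<dots> = (\<Sum>j\<in>{t..n}. of_nat ((n - t) choose (n - j)) * x ^ j)"
  proof (rule sum.reindex_bij_witness[where i = "\<lambda>j. j - t" and j = "\<lambda>j. j + t"])
    fix j assume "j \<in> {..n - t}"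
    then have "(n - t) choose (n - (j + t)) = (n - t) choose j"
      using binomial_symmetric[of j "n - t"] assms by (simp add: add.commute)
    then show "of_nat ((n - t) choose (n - (j + t))) * x ^ (j + t) =
        of_nat ((n - t) choose j) * x ^ (j + t)" by simp
  qed (use assms in auto)
  also have "\<dots> = (\<Sum>j\<le>n. of_nat ((n - t) choose (n - j)) * x ^ j)"
    by (rule sum.mono_neutral_left) (use assms in \<open>auto simp: binomial_eq_0\<close>)
  finally show ?thesis .
qed

lemma M_polynomial_expansion:
  "((\<Prod>i<k. 1 + X i) - (\<Prod>i<k. X i)) ^ n = (\<Sum>q\<in>tuples {..n} k.
     Cst (\<Sum>t\<le>n. (-1) ^ t * int (n choose t) * (\<Prod>i<k. int ((n - t) choose (n - q ! i)))) *
     (\<Prod>i<k. X i ^ (q ! i)))"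
proof -
  have "((\<Prod>i<k. 1 + X i) - (\<Prod>i<k. X i)) ^ n =
      (\<Sum>t\<le>n. of_nat (n choose t) * (- (\<Prod>i<k. X i)) ^ t * (\<Prod>i<k. 1 + X i) ^ (n - t)
        :: int multipoly)"
    using binomial_ring[of "- (\<Prod>i<k. X i)" "\<Prod>i<k. 1 + X i" n] by simp
  also have "\<dots> = (\<Sum>t\<le>n. Cst ((-1) ^ t * int (n choose t)) * (\<Prod>i<k. (1 + X i) ^ (n - t) * X i ^ t))"
  proof (intro sum.cong refl)
    fix t
    have "Cst ((-1) ^ t * int (n choose t)) = (-1) ^ t * of_nat (n choose t)"
      using Cst_of_int[of "(-1) ^ t * int (n choose t)", where 'a = int] by simp
    then show "of_nat (n choose t) * (- (\<Prod>i<k. X i)) ^ t * (\<Prod>i<k. 1 + X i) ^ (n - t) =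
        Cst ((-1) ^ t * int (n choose t)) * (\<Prod>i<k. (1 + X i) ^ (n - t) * X i ^ t)"
      by (simp add: power_minus[of "\<Prod>i<k. X i"] prod.distrib prod_power_distrib mult_ac)
  qed
  also have "\<dots> = (\<Sum>t\<le>n. Cst ((-1) ^ t * int (n choose t)) * (\<Sum>q\<in>tuples {..n} k.
      Cst (\<Prod>i<k. int ((n - t) choose (n - q ! i))) * (\<Prod>i<k. X i ^ (q ! i))))"
    by (intro sum.cong refl)
      (simp add: binomial_power_shift prod_sum_tuples prod.distrib Cst_prod Cst_of_nat)
  also have "\<dots> = (\<Sum>q\<in>tuples {..n} k. \<Sum>t\<le>n. Cst ((-1) ^ t * int (n choose t) *
      (\<Prod>i<k. int ((n - t) choose (n - q ! i)))) * (\<Prod>i<k. X i ^ (q ! i)))"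
    unfolding sum_distrib_left by (subst sum.swap) (simp add: Cst_mult mult.assoc)
  finally show ?thesis by (simp only: Cst_sum sum_distrib_right)
qed

lemma M_coeff_eq:
  "M_coeff n p = (if set p \<subseteq> {..n} then
    (\<Sum>t\<le>n. (-1) ^ t * int (n choose t) * (\<Prod>i<length p. int ((n - t) choose (n - p ! i)))) else 0)"
proof -
  define c where "c q = (\<Sum>t\<le>n. (-1) ^ t * int (n choose t) *
    (\<Prod>i<length p. int ((n - t) choose (n - q ! i))))" for q
  have "M_coeff n p = (\<Sum>q\<in>tuples {..n} (length p). c q *
      Poly_Mapping.lookup (\<Prod>i<length p. X i ^ (q ! i)) (Poly_Mapping.nth p))"
    by (simp add: M_coeff_def M_polynomial_expansion lookup_sum lookup_Cst_mult c_def)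
  also have "\<dots> = (\<Sum>q\<in>tuples {..n} (length p). if q = p then c q else 0)"
    by (intro sum.cong refl) (simp add: lookup_monomial tuples_def)
  also have "\<dots> = (if set p \<subseteq> {..n} then c p else 0)"
    by (simp add: sum.delta finite_tuples) (simp add: tuples_def)
  finally show ?thesis unfolding c_def .
qed

lemma M_coeff_support: "M_coeff n p \<noteq> 0 \<Longrightarrow> set p \<subseteq> {..n}"
  by (metis M_coeff_eq)

lemma mixed_difference_eq_M_coeff:
  assumes p: "p \<in> tuples {..n} k"
  shows "mixed_difference n p (\<lambda>q. \<Sum>t\<le>n. (-1) ^ t * of_nat (n choose t) *
      (\<Prod>i<k. of_nat ((q ! i + (n - t)) choose n))) = (of_int (M_coeff n p) :: 'a::comm_ring_1)"
proof -
  have summand: "mixed_difference n p (\<lambda>q. \<Prod>i<k. of_nat ((q ! i + (n - t)) choose n)) =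
      (\<Prod>i<k. of_nat ((n - t) choose (n - p ! i)) :: 'a)" for t
    unfolding mixed_difference_prod[OF p, of "\<lambda>_ j. of_nat ((j + (n - t)) choose n)"]
    using p by (intro prod.cong refl forward_difference_binomial) (auto simp: tuples_def subset_iff)
  show ?thesis
    unfolding mixed_difference_sum summand using p by (simp add: M_coeff_eq tuples_def)
qed

section \<open>Weighted sums over words in a group\<close>

text \<open>The sum of \<open>w j\<^sub>1 u\<^sub>1 * \<dots> * w j\<^sub>k u\<^sub>k * F (u\<^sub>1 \<dots> u\<^sub>k)\<close> over all words of length \<open>k\<close>. The
  recursion is arranged so that eigenvalues of the one-letter operators can be split off.\<close>

fun word_sum :: "('a, 'm) monoid_scheme \<Rightarrow> ('b \<Rightarrow> 'a \<Rightarrow> 'c) \<Rightarrow> 'b list \<Rightarrow> ('a \<Rightarrow> 'c) \<Rightarrow> 'c::comm_semiring_1"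
where
  "word_sum G w [] F = F \<one>\<^bsub>G\<^esub>"
| "word_sum G w (j # js) F = (\<Sum>u\<in>carrier G. w j u * word_sum G w js (\<lambda>g. F (u \<otimes>\<^bsub>G\<^esub> g)))"

lemma word_sum_cong:
  assumes "monoid G" and "\<And>g. g \<in> carrier G \<Longrightarrow> F g = F' g"
  shows "word_sum G w js F = word_sum G w js F'"
  using assms(2)
proof (induction js arbitrary: F F')
  case Nil
  then show ?case using monoid.one_closed[OF assms(1)] by simp
next
  case (Cons j js)
  have "word_sum G w js (\<lambda>g. F (u \<otimes>\<^bsub>G\<^esub> g)) = word_sum G w js (\<lambda>g. F' (u \<otimes>\<^bsub>G\<^esub> g))"
    if "u \<in> carrier G" for u
    using that monoid.m_closed[OF assms(1)] by (intro Cons.IH Cons.prems) auto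
  then show ?case by simp
qed

lemma word_sum_linear:
  "word_sum G w js (\<lambda>g. \<Sum>i\<in>I. c i * F i g) = (\<Sum>i\<in>I. c i * word_sum G w js (F i))"
proof (induction js arbitrary: F)
  case (Cons j js)
  then show ?case
    by (simp add: sum_distrib_left sum.swap[of _ I] mult.left_commute)
qed simp

lemma word_sum_scale: "word_sum G w js (\<lambda>g. c * F g) = c * word_sum G w js F"
  using word_sum_linear[of G w js "\<lambda>_. c" "\<lambda>_. F" "{()}"] by simp

lemma word_sum_add: "word_sum G w js (\<lambda>g. F g + H g) = word_sum G w js F + word_sum G w js H"
  using word_sum_linear[of G w js "\<lambda>_. 1" "\<lambda>b. if b then F else H" UNIV]
  by (simp add: UNIV_bool add.commute)

lemma word_sum_eigenfunction:
  assumes "monoid G"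
    and eigen: "\<And>j h. h \<in> carrier G \<Longrightarrow> (\<Sum>u\<in>carrier G. w j u * F (u \<otimes>\<^bsub>G\<^esub> h)) = ev j * F h"
  shows "word_sum G w js F = (\<Prod>j\<leftarrow>js. ev j) * F \<one>\<^bsub>G\<^esub>"
proof (induction js)
  case (Cons j js)
  have "word_sum G w (j # js) F = word_sum G w js (\<lambda>g. \<Sum>u\<in>carrier G. w j u * F (u \<otimes>\<^bsub>G\<^esub> g))"
    by (simp add: word_sum_linear)
  also have "\<dots> = word_sum G w js (\<lambda>g. ev j * F g)"
    by (rule word_sum_cong[OF assms(1)]) (rule eigen)
  finally show ?case using Cons.IH by (simp add: word_sum_scale mult.assoc)
qed simp

lemma word_sum_eq_sum_tuples:
  "word_sum G w js F = (\<Sum>us\<in>tuples (carrier G) (length js).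
     (\<Prod>i<length js. w (js ! i) (us ! i)) * F (foldr (\<otimes>\<^bsub>G\<^esub>) us \<one>\<^bsub>G\<^esub>))"
proof (induction js arbitrary: F)
  case Nil
  show ?case by (simp add: tuples_0)
next
  case (Cons j js)
  show ?case
    unfolding word_sum.simps Cons.IH length_Cons sum_tuples_Suc sum_distrib_left
    by (simp add: prod.lessThan_Suc_shift mult.assoc del: prod.lessThan_Suc)
qed

lemma word_sum_conjugate:
  fixes G (structure)
  assumes "group G" and h: "h \<in> carrier G"
    and invariant: "\<And>j u. u \<in> carrier G \<Longrightarrow> w j (h \<otimes> u \<otimes> inv h) = w j u"
  shows "word_sum G w js (\<lambda>g. F (h \<otimes> g \<otimes> inv h)) = word_sum G w js F"
proof -
  interpret group G by fact
  have cancel: "inv h \<otimes> (h \<otimes> x) = x" "h \<otimes> (inv h \<otimes> x) = x" if "x \<in> carrier G" for x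
    using h that by (simp_all flip: m_assoc)
  have bij: "bij_betw (\<lambda>u. h \<otimes> u \<otimes> inv h) (carrier G) (carrier G)"
    by (rule bij_betwI[where g = "\<lambda>u. inv h \<otimes> u \<otimes> h"]) (use h in \<open>auto simp: m_assoc cancel\<close>)
  show ?thesis
  proof (induction js arbitrary: F)
    case Nil
    then show ?case using h by simp
  next
    case (Cons j js)
    have "word_sum G w js (\<lambda>g. F (h \<otimes> (u \<otimes> g) \<otimes> inv h)) =
        word_sum G w js (\<lambda>g. F (h \<otimes> u \<otimes> inv h \<otimes> g))" if u: "u \<in> carrier G" for u
    proof -
      have "word_sum G w js (\<lambda>g. F (h \<otimes> (u \<otimes> g) \<otimes> inv h)) =
          word_sum G w js (\<lambda>g. F (h \<otimes> u \<otimes> inv h \<otimes> (h \<otimes> g \<otimes> inv h)))"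
        using h u by (intro word_sum_cong is_monoid) (simp add: m_assoc cancel)
      then show ?thesis using Cons.IH[of "\<lambda>x. F (h \<otimes> u \<otimes> inv h \<otimes> x)"] by simp
    qed
    then have "word_sum G w (j # js) (\<lambda>g. F (h \<otimes> g \<otimes> inv h)) =
        (\<Sum>u\<in>carrier G. w j (h \<otimes> u \<otimes> inv h) * word_sum G w js (\<lambda>g. F (h \<otimes> u \<otimes> inv h \<otimes> g)))"
      by (simp add: invariant)
    also have "\<dots> = (\<Sum>u\<in>carrier G. w j u * word_sum G w js (\<lambda>g. F (u \<otimes> g)))"
      by (rule sum.reindex_bij_betw[OF bij])
    finally show ?case by simp
  qed
qed

section \<open>Hook-shaped Young symmetrizers\<close>

lemma permutes_UNIV: "p permutes S \<Longrightarrow> p permutes UNIV"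
  by (rule permutes_subset) auto

lemma permutes_iff_permutes_UNIV:
  "p permutes S \<longleftrightarrow> p permutes UNIV \<and> (\<forall>x. x \<notin> S \<longrightarrow> p x = x)"
  by (metis Diff_iff UNIV_I permutes_UNIV permutes_not_in permutes_superset)

lemma comp_permutes_cancel:
  assumes p: "p permutes A" and q: "q permutes B"
  shows "p \<circ> x \<circ> q = p \<circ> y \<circ> q \<longleftrightarrow> x = y"
proof
  assume products: "p \<circ> x \<circ> q = p \<circ> y \<circ> q"
  show "x = y"
  proof
    fix b
    obtain a where "b = q a" using permutes_surj[OF q] by (metis surjD)
    then have "p (x b) = p (y b)" using fun_cong[OF products, of a] by simp
    then show "x b = y b" using permutes_inj[OF p] by (simp add: inj_eq)
  qed
qed simp

lemma sign_compose_permutes: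
  fixes p q :: "'n::finite \<Rightarrow> 'n"
  assumes "p permutes S" "q permutes T"
  shows "sign (p \<circ> q) = sign p * sign q"
  using permutes_imp_permutation[OF finite assms(1)] permutes_imp_permutation[OF finite assms(2)]
  by (rule sign_compose)

definition perm_group :: "('n \<Rightarrow> 'n) monoid" where
  "perm_group = \<lparr>carrier = {p. p permutes UNIV}, monoid.mult = (\<circ>), one = id\<rparr>"

lemma perm_group_simps [simp]:
  "carrier perm_group = {p. p permutes UNIV}" "monoid.mult perm_group = (\<circ>)" "one perm_group = id"
  by (simp_all add: perm_group_def)

lemma monoid_perm_group: "monoid perm_group"
  by (rule monoidI) (auto intro: permutes_compose permutes_id simp: comp_assoc)

definition class_function :: "(('n \<Rightarrow> 'n) \<Rightarrow> 'a) \<Rightarrow> bool" where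
  "class_function w \<longleftrightarrow> (\<forall>a b. a permutes UNIV \<longrightarrow> b permutes UNIV \<longrightarrow> w (a \<circ> b) = w (b \<circ> a))"

lemma class_function_compose: "class_function w \<Longrightarrow> class_function (\<lambda>\<tau>. f (w \<tau>))"
  unfolding class_function_def by metis

text \<open>The Young symmetrizer of a hook whose column is \<open>insert r S\<close> and whose row is \<open>- S\<close>, as a
  function on permutations.\<close>

definition hook_kernel :: "'n::finite \<Rightarrow> 'n set \<Rightarrow> ('n \<Rightarrow> 'n) \<Rightarrow> rat" where
  "hook_kernel r S h =
     (\<Sum>p | p permutes insert r S. \<Sum>q | q permutes - S. if h = p \<circ> q then of_int (sign p) else 0)"

definition hook_equivariant :: "'n::finite \<Rightarrow> 'n set \<Rightarrow> (('n \<Rightarrow> 'n) \<Rightarrow> rat) \<Rightarrow> bool" where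
  "hook_equivariant r S f \<longleftrightarrow>
     (\<forall>p h q. p permutes insert r S \<longrightarrow> h permutes UNIV \<longrightarrow> q permutes - S \<longrightarrow>
        f (p \<circ> h \<circ> q) = of_int (sign p) * f h)"

lemma hook_equivariantD:
  "hook_equivariant r S f \<Longrightarrow> p permutes insert r S \<Longrightarrow> h permutes UNIV \<Longrightarrow> q permutes - S \<Longrightarrow>
     f (p \<circ> h \<circ> q) = of_int (sign p) * f h"
  unfolding hook_equivariant_def by blast

lemma hook_equivariant_hook_kernel: "hook_equivariant r S (hook_kernel r S)"
  unfolding hook_equivariant_def
proof (intro allI impI)
  fix p h q :: "'a \<Rightarrow> 'a"
  assume p: "p permutes insert r S" and h: "h permutes UNIV" and q: "q permutes - S"
  have cancel: "p \<circ> h \<circ> q = p \<circ> p' \<circ> (q' \<circ> q) \<longleftrightarrow> h = p' \<circ> q'" for p' q'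
    using comp_permutes_cancel[OF p q, of h "p' \<circ> q'"] by (simp only: comp_assoc)
  have "hook_kernel r S (p \<circ> h \<circ> q) = (\<Sum>p' | p' permutes insert r S. \<Sum>q' | q' permutes - S.
      if p \<circ> h \<circ> q = p \<circ> p' \<circ> (q' \<circ> q) then of_int (sign (p \<circ> p')) else 0)"
    unfolding hook_kernel_def
    by (subst setum_permutations_compose_left[OF p], subst sum_permutations_compose_right[OF q]) simp
  also have "\<dots> = (\<Sum>p' | p' permutes insert r S. \<Sum>q' | q' permutes - S.
      of_int (sign p) * (if h = p' \<circ> q' then of_int (sign p') else 0))"
    unfolding cancel by (intro sum.cong refl) (simp add: sign_compose_permutes[OF p])
  also have "\<dots> = of_int (sign p) * hook_kernel r S h"
    by (simp only: hook_kernel_def sum_distrib_left)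
  finally show "hook_kernel r S (p \<circ> h \<circ> q) = of_int (sign p) * hook_kernel r S h" .
qed

lemma hook_kernel_eq:
  fixes \<sigma> :: "'n::finite \<Rightarrow> 'n"
  assumes \<sigma>: "\<sigma> permutes UNIV"
  shows "hook_kernel r S \<sigma> =
    (\<Sum>p | p permutes insert r S. if \<forall>x\<in>S. p x = \<sigma> x then of_int (sign p) else 0)"
  unfolding hook_kernel_def
proof (intro sum.cong refl)
  fix p assume "p \<in> {p. p permutes insert r S}"
  then have p: "p permutes UNIV" by (auto intro: permutes_UNIV)
  let ?p' = "inv_into UNIV p"
  have "\<sigma> = p \<circ> q \<longleftrightarrow> q = ?p' \<circ> \<sigma>" for q
    using permutes_inv_o[OF p] by (metis comp_assoc id_comp)
  then have "(\<Sum>q | q permutes - S. if \<sigma> = p \<circ> q then of_int (sign p) else 0) =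
      (if ?p' \<circ> \<sigma> permutes - S then rat_of_int (sign p) else 0)"
    by (simp add: finite_permutations)
  also have "?p' \<circ> \<sigma> permutes - S \<longleftrightarrow> (\<forall>x\<in>S. p x = \<sigma> x)"
    using permutes_compose[OF \<sigma> permutes_inv[OF p]] permutes_inv_eq[OF p]
    by (subst permutes_iff_permutes_UNIV) auto
  finally show "(\<Sum>q | q permutes - S. if \<sigma> = p \<circ> q then of_int (sign p) else 0) =
      (if \<forall>x\<in>S. p x = \<sigma> x then rat_of_int (sign p) else 0)" .
qed

lemma hook_kernel_id:
  assumes "r \<notin> S"
  shows "hook_kernel r S id = 1"
proof -
  have "(\<forall>x\<in>S. p x = x) \<longleftrightarrow> p = id" if "p permutes insert r S" for p
  proof
    assume "\<forall>x\<in>S. p x = x"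
    then have "p permutes {r}" using permutes_superset[OF that, of "{r}"] by auto
    then show "p = id" by simp
  qed simp
  then have "hook_kernel r S id = (\<Sum>p | p permutes insert r S. if p = id then 1 else 0)"
    unfolding hook_kernel_eq[OF permutes_id] by (intro sum.cong refl) auto
  then show ?thesis by (simp add: finite_permutations permutes_id)
qed

lemma hook_factorization_exists:
  fixes h :: "'n::finite \<Rightarrow> 'n"
  assumes r: "r \<notin> S" and h: "h permutes UNIV" and hS: "h ` S \<subseteq> insert r S"
  obtains p q where "p permutes insert r S" "q permutes - S" "h = p \<circ> q"
proof -
  have inj: "inj h" using h by (rule permutes_inj)
  have "card (h ` S) < card (insert r S)"
    using r inj by (simp add: card_image inj_on_subset)
  then have "h ` S \<noteq> insert r S" by auto
  then obtain i where i: "i \<in> insert r S" "i \<notin> h ` S" using hS by blast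
  define p where "p x = (if x \<in> S then h x else if x = r then i else x)" for x
  have "inj_on p (insert r S)"
    using i(2) by (auto simp: inj_on_def p_def inj_eq[OF inj])
  then have p: "p permutes insert r S"
    by (rule inj_imp_permutes) (use hS i in \<open>auto simp: p_def\<close>)
  let ?q = "inv_into UNIV p \<circ> h"
  have "?q permutes UNIV"
    using p h by (intro permutes_compose permutes_inv) (auto intro: permutes_UNIV)
  moreover have "?q x = x" if "x \<in> S" for x
    using that permutes_inv_eq[OF p] by (simp add: p_def)
  ultimately have "?q permutes - S"
    by (subst permutes_iff_permutes_UNIV) auto
  moreover have "h = p \<circ> ?q"
    using permutes_inv_o[OF p] by (simp add: o_assoc)
  ultimately show ?thesis using p that by blast
qed

lemma hook_transposition_exists:
  fixes h :: "'n::finite \<Rightarrow> 'n"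
  assumes r: "r \<notin> S" and h: "h permutes UNIV" and hS: "\<not> h ` S \<subseteq> insert r S"
  obtains a b where "a \<noteq> b" "a \<notin> S" "b \<notin> S" "h a \<in> insert r S" "h b \<in> insert r S"
proof -
  have "card (h ` S \<inter> insert r S) < card (h ` S)"
    using hS by (intro psubset_card_mono) auto
  also have "\<dots> = card S"
    using permutes_inj[OF h] by (simp add: card_image inj_on_subset)
  finally have "Suc 0 < card (insert r S - h ` S)"
    using r by (simp add: card_Diff_subset_Int Int_commute)
  then obtain i j where ij: "i \<in> insert r S - h ` S" "j \<in> insert r S - h ` S" "i \<noteq> j"
    using card_le_Suc0_iff_eq[of "insert r S - h ` S"] by (auto simp: not_less[symmetric])
  obtain a b where "i = h a" "j = h b" using permutes_surj[OF h] by (metis surjD)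
  then show ?thesis using ij that[of a b] by blast
qed

lemma hook_equivariant_eq_0:
  fixes h :: "'n::finite \<Rightarrow> 'n"
  assumes f: "hook_equivariant r S f" and h: "h permutes UNIV"
    and ab: "a \<noteq> b" "a \<notin> S" "b \<notin> S" "h a \<in> insert r S" "h b \<in> insert r S"
  shows "f h = 0"
proof -
  have inj: "inj h" using h by (rule permutes_inj)
  let ?t = "Transposition.transpose (h a) (h b)" and ?s = "Transposition.transpose a b"
  have "?t \<circ> h \<circ> ?s = h"
    using inj by (auto simp: fun_eq_iff Transposition.transpose_def inj_eq)
  moreover have "sign ?t = - 1"
    using ab(1) inj by (simp add: sign_swap_id inj_eq)
  moreover have "f (?t \<circ> h \<circ> ?s) = of_int (sign ?t) * f h"
    using ab by (intro hook_equivariantD[OF f] h permutes_swap_id) auto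
  ultimately show ?thesis by simp
qed

lemma hook_equivariant_unique:
  fixes h :: "'n::finite \<Rightarrow> 'n"
  assumes r: "r \<notin> S" and f: "hook_equivariant r S f" and h: "h permutes UNIV"
  shows "f h = f id * hook_kernel r S h"
proof (cases "h ` S \<subseteq> insert r S")
  case True
  then obtain p q where pq: "p permutes insert r S" "q permutes - S" "h = p \<circ> q"
    using hook_factorization_exists[OF r h] by blast
  have "F h = of_int (sign p) * F id" if "hook_equivariant r S F" for F
    using hook_equivariantD[OF that pq(1) permutes_id pq(2)] by (simp add: pq(3))
  from this[OF f] this[OF hook_equivariant_hook_kernel] show ?thesis
    using hook_kernel_id[OF r] by simp
next
  case False
  then obtain a b where ab: "a \<noteq> b" "a \<notin> S" "b \<notin> S" "h a \<in> insert r S" "h b \<in> insert r S"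
    using hook_transposition_exists[OF r h] by blast
  show ?thesis
    using hook_equivariant_eq_0[OF f h ab] hook_equivariant_eq_0[OF hook_equivariant_hook_kernel h ab]
    by simp
qed

definition hook_eigenvalue :: "'n::finite \<Rightarrow> 'n set \<Rightarrow> (('n \<Rightarrow> 'n) \<Rightarrow> rat) \<Rightarrow> rat" where
  "hook_eigenvalue r S w =
     (\<Sum>p | p permutes insert r S. \<Sum>q | q permutes - S. of_int (sign p) * w (p \<circ> q))"

lemma sum_mult_hook_kernel:
  "(\<Sum>u | u permutes UNIV. w u * hook_kernel r S u) = hook_eigenvalue r S w"
proof -
  have "(\<Sum>u | u permutes UNIV. w u * hook_kernel r S u) =
      (\<Sum>u | u permutes UNIV. \<Sum>p | p permutes insert r S. \<Sum>q | q permutes - S.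
        if u = p \<circ> q then of_int (sign p) * w u else 0)"
    unfolding hook_kernel_def sum_distrib_left by (intro sum.cong refl) auto
  also have "\<dots> = (\<Sum>p | p permutes insert r S. \<Sum>q | q permutes - S. \<Sum>u | u permutes UNIV.
        if u = p \<circ> q then of_int (sign p) * w u else 0)"
    by (rule trans[OF sum.swap sum.cong[OF refl sum.swap]])
  also have "\<dots> = hook_eigenvalue r S w"
    unfolding hook_eigenvalue_def
  proof (intro sum.cong refl)
    fix p q assume "p \<in> {p. p permutes insert r S}" "q \<in> {q. q permutes - S}"
    then have "p \<circ> q permutes UNIV" by (auto intro: permutes_compose permutes_UNIV)
    then show "(\<Sum>u | u permutes UNIV. if u = p \<circ> q then of_int (sign p) * w u else 0) =
        of_int (sign p) * w (p \<circ> q)"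
      by (simp add: finite_permutations)
  qed
  finally show ?thesis .
qed

lemma sum_permutations_conjugate:
  assumes p: "p permutes A"
  shows "(\<Sum>u | u permutes A. f u) = (\<Sum>u | u permutes A. f (p \<circ> u \<circ> inv_into UNIV p))"
  using setum_permutations_compose_left[OF p, of f]
    sum_permutations_compose_right[OF permutes_inv[OF p], of "\<lambda>u. f (p \<circ> u)"]
  by (simp add: comp_assoc)

lemma hook_equivariant_convolution:
  assumes w: "class_function w"
  shows "hook_equivariant r S (\<lambda>h. \<Sum>u | u permutes UNIV. w u * hook_kernel r S (u \<circ> h))"
  unfolding hook_equivariant_def
proof (intro allI impI)
  fix p h q :: "'a \<Rightarrow> 'a"
  assume p: "p permutes insert r S" and h: "h permutes UNIV" and q: "q permutes - S"
  have pU: "p permutes UNIV" using p by (rule permutes_UNIV)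
  let ?p' = "inv_into UNIV p"
  have "w (p \<circ> u \<circ> ?p') * hook_kernel r S (p \<circ> u \<circ> ?p' \<circ> (p \<circ> h \<circ> q)) =
      of_int (sign p) * (w u * hook_kernel r S (u \<circ> h))" if u: "u permutes UNIV" for u
  proof -
    have cancel: "?p' \<circ> p = id" using permutes_inv_o(2)[OF p] .
    have "w (p \<circ> u \<circ> ?p') = w (?p' \<circ> (p \<circ> u))"
      using w pU u unfolding class_function_def by (blast intro: permutes_compose permutes_inv)
    also have "?p' \<circ> (p \<circ> u) = u" unfolding comp_assoc[symmetric] cancel by simp
    finally have "w (p \<circ> u \<circ> ?p') = w u" .
    moreover have "p \<circ> u \<circ> ?p' \<circ> (p \<circ> h \<circ> q) = p \<circ> u \<circ> (?p' \<circ> p) \<circ> h \<circ> q"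
      by (simp only: comp_assoc)
    then have "p \<circ> u \<circ> ?p' \<circ> (p \<circ> h \<circ> q) = p \<circ> (u \<circ> h) \<circ> q"
      unfolding cancel by (simp add: comp_assoc)
    ultimately show ?thesis
      using hook_equivariantD[OF hook_equivariant_hook_kernel p permutes_compose[OF h u] q] by simp
  qed
  then show "(\<Sum>u | u permutes UNIV. w u * hook_kernel r S (u \<circ> (p \<circ> h \<circ> q))) =
      of_int (sign p) * (\<Sum>u | u permutes UNIV. w u * hook_kernel r S (u \<circ> h))"
    unfolding sum_distrib_left by (subst sum_permutations_conjugate[OF pU]) (intro sum.cong, auto)
qed

lemma hook_kernel_eigenfunction:
  assumes r: "r \<notin> S" and h: "h permutes UNIV" and w: "class_function w"
  shows "(\<Sum>u | u permutes UNIV. w u * hook_kernel r S (u \<circ> h)) =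
    hook_eigenvalue r S w * hook_kernel r S h"
  using hook_equivariant_unique[OF r hook_equivariant_convolution[OF w] h] sum_mult_hook_kernel[of w]
  by simp

section \<open>The eigenvalues of the invariant coloring count\<close>

definition invariant_colorings :: "nat \<Rightarrow> ('n \<Rightarrow> 'n) \<Rightarrow> nat" where
  "invariant_colorings y \<tau> = card {f. (\<forall>x. f x < y) \<and> f \<circ> \<tau> = f}"

lemma class_function_invariant_colorings:
  "class_function (invariant_colorings y)"
  unfolding class_function_def
proof (intro allI impI)
  fix a b :: "'n \<Rightarrow> 'n" assume "a permutes UNIV" "b permutes UNIV"
  then show "invariant_colorings y (a \<circ> b) = invariant_colorings y (b \<circ> a)"
    unfolding invariant_colorings_def
    by (intro bij_betw_same_card[OF bij_betwI[where f = "\<lambda>f. f \<circ> a" and g = "\<lambda>f. f \<circ> b"]])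
      (auto simp: fun_eq_iff)
qed

lemma invariant_under_hook_product_iff:
  fixes f :: "'n::finite \<Rightarrow> nat"
  assumes r: "r \<notin> S" and p: "p permutes insert r S" and q: "q permutes - S"
  shows "f \<circ> (p \<circ> q) = f \<longleftrightarrow> f \<circ> p = f \<and> f \<circ> q = f"
proof
  assume "f \<circ> (p \<circ> q) = f"
  then have f: "f (p (q x)) = f x" for x by (metis comp_apply)
  have invariant_on_S: "f (p x) = f x" if "x \<in> S" for x
    using f[of x] that permutes_not_in[OF q] by simp
  have "(\<Sum>x\<in>insert r S. f (p x)) = (\<Sum>x\<in>insert r S. f x)"
    using sum.permute[OF p, of f] by (simp add: o_def)
  then have "f (p r) = f r" using r invariant_on_S by simp
  then have p_invariant: "f (p x) = f x" for x
    using invariant_on_S permutes_not_in[OF p] by (cases "x \<in> insert r S") auto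
  moreover have "f (q x) = f x" for x using f[of x] p_invariant[of "q x"] by simp
  ultimately show "f \<circ> p = f \<and> f \<circ> q = f" by auto
qed (auto simp: fun_eq_iff)

lemma sum_sign_stabilizer:
  fixes f :: "'n::finite \<Rightarrow> 'b"
  shows "(\<Sum>p | p permutes A. of_bool (f \<circ> p = f) * of_int (sign p)) = (of_bool (inj_on f A) :: rat)"
proof (cases "inj_on f A")
  case True
  have "p = id" if p: "p permutes A" and "f \<circ> p = f" for p
  proof
    fix x
    have "f (p x) = f x" using that by (metis comp_apply)
    then show "p x = id x"
      using True p by (cases "x \<in> A") (auto simp: permutes_in_image permutes_not_in dest: inj_onD)
  qed
  then have "(\<Sum>p | p permutes A. of_bool (f \<circ> p = f) * of_int (sign p)) =
      (\<Sum>p | p permutes A. if p = id then 1 else 0 :: rat)"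
    by (intro sum.cong refl) auto
  then show ?thesis using True by (simp add: finite_permutations permutes_id)
next
  case False
  then obtain i j where ij: "i \<in> A" "j \<in> A" "i \<noteq> j" "f i = f j" by (auto simp: inj_on_def)
  let ?t = "Transposition.transpose i j"
  let ?L = "\<Sum>p | p permutes A. of_bool (f \<circ> p = f) * rat_of_int (sign p)"
  have t: "?t permutes A" using ij by (intro permutes_swap_id)
  have ft: "f \<circ> ?t = f" using ij by (auto simp: Transposition.transpose_def)
  have "?L = (\<Sum>p | p permutes A. of_bool (f \<circ> (?t \<circ> p) = f) * of_int (sign (?t \<circ> p)))"
    by (rule setum_permutations_compose_left[OF t])
  also have "\<dots> = (\<Sum>p | p permutes A. - (of_bool (f \<circ> p = f) * of_int (sign p)))"
    by (intro sum.cong refl)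
      (simp add: sign_compose_permutes[OF t] sign_swap_id ij(3) o_assoc ft)
  also have "\<dots> = - ?L" by (simp add: sum_negf)
  finally show ?thesis using False by simp
qed

definition coloring_stabilizer :: "'a set \<Rightarrow> ('a \<Rightarrow> 'b) \<Rightarrow> ('a \<Rightarrow> 'a) set" where
  "coloring_stabilizer T f = {q. q permutes T \<and> f \<circ> q = f}"

lemma coloring_stabilizer_cong:
  assumes "\<And>x. x \<in> T \<Longrightarrow> f x = g x"
  shows "coloring_stabilizer T f = coloring_stabilizer T g"
proof -
  have "f \<circ> q = f \<longleftrightarrow> g \<circ> q = g" if q: "q permutes T" for q
  proof -
    have "f (q x) = f x \<longleftrightarrow> g (q x) = g x" for x
      using assms permutes_in_image[OF q, of x] permutes_not_in[OF q, of x] by (cases "x \<in> T") auto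
    then show ?thesis by (simp add: fun_eq_iff)
  qed
  then show ?thesis unfolding coloring_stabilizer_def by blast
qed

lemma card_coloring_stabilizer:
  assumes "finite T"
  shows "card (coloring_stabilizer T f) = (\<Sum>q | q permutes T. of_bool (f \<circ> q = f))"
  using finite_permutations[OF assms] by (simp add: coloring_stabilizer_def Collect_conj_eq)

lemma card_coloring_stabilizer_insert:
  assumes T: "finite T" "t \<notin> T"
  shows "card (coloring_stabilizer (insert t T) f) =
    card {b \<in> insert t T. f b = f t} * card (coloring_stabilizer T f)"
proof -
  have split: "f \<circ> (Transposition.transpose t b \<circ> q) = f \<longleftrightarrow> f b = f t \<and> f \<circ> q = f"
    if q: "q permutes T" for b q
  proof
    assume invariant: "f \<circ> (Transposition.transpose t b \<circ> q) = f"
    have "f ((Transposition.transpose t b \<circ> q) t) = f t"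
      using invariant by (metis comp_apply)
    then have fb: "f b = f t" using T(2) permutes_not_in[OF q] by simp
    then have "f \<circ> Transposition.transpose t b = f" by (auto simp: Transposition.transpose_def)
    then show "f b = f t \<and> f \<circ> q = f" using invariant fb by (simp add: o_assoc)
  next
    assume invariant: "f b = f t \<and> f \<circ> q = f"
    then have "f \<circ> Transposition.transpose t b = f" by (auto simp: Transposition.transpose_def)
    then show "f \<circ> (Transposition.transpose t b \<circ> q) = f" using invariant by (simp add: o_assoc)
  qed
  have "card (coloring_stabilizer (insert t T) f) =
      (\<Sum>b\<in>insert t T. \<Sum>q | q permutes T. of_bool (f b = f t) * of_bool (f \<circ> q = f))"
    unfolding card_coloring_stabilizer[OF finite.insertI[OF T(1)]] sum_over_permutations_insert[OF T]
    by (intro sum.cong refl) (simp only: split mem_Collect_eq of_bool_conj)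
  also have "\<dots> = (\<Sum>b\<in>insert t T. of_bool (f b = f t)) * card (coloring_stabilizer T f)"
    unfolding card_coloring_stabilizer[OF T(1)] sum_product ..
  also have "(\<Sum>b\<in>insert t T. of_bool (f b = f t)) = card {b \<in> insert t T. f b = f t}"
    using T(1) by (simp add: Int_def)
  finally show ?thesis .
qed

lemma sum_PiE_insert:
  assumes "x \<notin> A" "finite A" "finite B"
  shows "(\<Sum>f\<in>PiE (insert x A) (\<lambda>_. B). F f) = (\<Sum>g\<in>PiE A (\<lambda>_. B). \<Sum>a\<in>B. F (g(x := a)))"
proof -
  have "(\<Sum>f\<in>PiE (insert x A) (\<lambda>_. B). F f) = (\<Sum>(a, g)\<in>B \<times> PiE A (\<lambda>_. B). F (g(x := a)))"
    unfolding PiE_insert_eq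
    by (subst sum.reindex[OF inj_combinator[OF assms(1)]]) (simp add: case_prod_unfold o_def)
  then show ?thesis
    by (simp add: sum.cartesian_product[symmetric] sum.swap[of _ B])
qed

lemma sum_card_color_class_insert:
  assumes T: "finite T" "t \<notin> T" and g: "g ` T \<subseteq> {..<y}"
  shows "(\<Sum>a<y. card {b \<in> insert t T. (g(t := a)) b = a}) = y + card T"
proof -
  have "{b \<in> insert t T. (g(t := a)) b = a} = insert t {b \<in> T. g b = a}" for a
    using T(2) by auto
  then have "(\<Sum>a<y. card {b \<in> insert t T. (g(t := a)) b = a}) = y + (\<Sum>a<y. card {b \<in> T. g b = a})"
    using T by (simp add: sum_Suc)
  also have "(\<Sum>a<y. card {b \<in> T. g b = a}) = (\<Sum>b\<in>T. 1)"
  proof (rule sum_multicount_gen)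
    have "{a \<in> {..<y}. g b = a} = {g b}" if "b \<in> T" for b using g that by auto
    then show "\<forall>b\<in>T. card {a \<in> {..<y}. g b = a} = 1" by simp
  qed (use T in simp_all)
  finally show ?thesis by simp
qed

lemma sum_card_coloring_stabilizer:
  assumes "finite T"
  shows "(\<Sum>f\<in>PiE T (\<lambda>_. {..<y}). card (coloring_stabilizer T f)) =
    fact (card T) * ((y + card T - 1) choose card T)"
  using assms
proof (induction T rule: finite_induct)
  case empty
  show ?case by (simp add: coloring_stabilizer_def)
next
  case (insert t T)
  let ?m = "card T"
  have "(\<Sum>f\<in>PiE (insert t T) (\<lambda>_. {..<y}). card (coloring_stabilizer (insert t T) f)) =
      (\<Sum>g\<in>PiE T (\<lambda>_. {..<y}). \<Sum>a<y. card (coloring_stabilizer (insert t T) (g(t := a))))"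
    by (rule sum_PiE_insert) (use insert.hyps in auto)
  also have "\<dots> = (\<Sum>g\<in>PiE T (\<lambda>_. {..<y}). (y + ?m) * card (coloring_stabilizer T g))"
  proof (intro sum.cong refl)
    fix g :: "'a \<Rightarrow> nat" assume g: "g \<in> PiE T (\<lambda>_. {..<y})"
    have color_classes: "(\<Sum>a<y. card {b \<in> insert t T. (g(t := a)) b = a}) = y + ?m"
      by (rule sum_card_color_class_insert) (use g insert.hyps in auto)
    have "coloring_stabilizer T (g(t := a)) = coloring_stabilizer T g" for a
      by (rule coloring_stabilizer_cong) (use insert.hyps in auto)
    then show "(\<Sum>a<y. card (coloring_stabilizer (insert t T) (g(t := a)))) =
        (y + ?m) * card (coloring_stabilizer T g)"
      unfolding card_coloring_stabilizer_insert[OF insert.hyps] color_classes[symmetric]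
      by (simp only: fun_upd_same sum_distrib_right)
  qed
  also have "\<dots> = fact ?m * ((y + ?m) * ((y + ?m - 1) choose ?m))"
    unfolding sum_distrib_left[symmetric] insert.IH by (simp only: mult.left_commute)
  also have "(y + ?m) * ((y + ?m - 1) choose ?m) = Suc ?m * ((y + ?m) choose Suc ?m)"
    by (cases "y + ?m") (simp_all add: binomial_absorption del: binomial_Suc_Suc mult_Suc)
  finally show ?case
    using insert.hyps by (simp add: mult_ac del: mult_Suc)
qed

lemma card_injective_extensions:
  assumes A: "finite A" "s \<notin> A" and g: "g ` A \<subseteq> {..<y}"
  shows "(\<Sum>a<y. of_bool (inj_on (g(s := a)) (insert s A))) = of_bool (inj_on g A) * (y - card A)"
proof -
  have "inj_on (g(s := a)) (insert s A) \<longleftrightarrow> inj_on g A \<and> a \<notin> g ` A" for a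
  proof -
    have "inj_on (g(s := a)) A \<longleftrightarrow> inj_on g A" using A(2) by (intro inj_on_cong) auto
    moreover have "(g(s := a)) ` A = g ` A" using A(2) by (intro image_cong) auto
    ultimately show ?thesis using A(2) by (subst inj_on_insert) auto
  qed
  then have "(\<Sum>a<y. of_bool (inj_on (g(s := a)) (insert s A))) =
      of_bool (inj_on g A) * (\<Sum>a<y. of_bool (a \<notin> g ` A) :: nat)"
    by (simp only: of_bool_conj sum_distrib_left)
  also have "(\<Sum>a<y. of_bool (a \<notin> g ` A)) = card ({..<y} - g ` A)"
    by (simp add: Diff_eq Collect_neg_eq)
  also have "\<dots> = y - card (g ` A)"
    using A(1) g by (subst card_Diff_subset) auto
  also have "of_bool (inj_on g A) * (y - card (g ` A)) = of_bool (inj_on g A) * (y - card A)"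
    by (cases "inj_on g A") (simp_all add: card_image)
  finally show ?thesis .
qed

lemma sum_card_hook_coloring_stabilizer:
  assumes "finite S" "finite T" "r \<in> T" "S \<inter> T = {}"
  shows "(\<Sum>f\<in>PiE (S \<union> T) (\<lambda>_. {..<y}).
      of_bool (inj_on f (insert r S)) * card (coloring_stabilizer T f)) =
    fact (card S + card T) * ((y + card T - 1) choose (card S + card T))"
  using assms(1,4)
proof (induction S rule: finite_induct)
  case empty
  then show ?case using sum_card_coloring_stabilizer[OF assms(2)] by simp
next
  case (insert s S)
  let ?N = "y + card T - 1" and ?k = "card S + card T"
  have s: "s \<notin> S \<union> T" "s \<notin> insert r S" "r \<notin> S" using insert assms(3) by auto
  have "(\<Sum>f\<in>PiE (insert s (S \<union> T)) (\<lambda>_. {..<y}). of_bool (inj_on f (insert s (insert r S))) *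
        card (coloring_stabilizer T f)) =
      (\<Sum>g\<in>PiE (S \<union> T) (\<lambda>_. {..<y}). \<Sum>a<y. of_bool (inj_on (g(s := a)) (insert s (insert r S))) *
        card (coloring_stabilizer T (g(s := a))))"
    by (rule sum_PiE_insert) (use s insert.hyps assms(2) in auto)
  also have "\<dots> = (\<Sum>g\<in>PiE (S \<union> T) (\<lambda>_. {..<y}). (y - Suc (card S)) *
      (of_bool (inj_on g (insert r S)) * card (coloring_stabilizer T g)))"
  proof (intro sum.cong refl)
    fix g assume g: "g \<in> PiE (S \<union> T) (\<lambda>_. {..<y})"
    have stabilizer: "coloring_stabilizer T (g(s := a)) = coloring_stabilizer T g" for a
      by (rule coloring_stabilizer_cong) (use s in auto)
    have extensions: "(\<Sum>a<y. of_bool (inj_on (g(s := a)) (insert s (insert r S)))) =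
        of_bool (inj_on g (insert r S)) * (y - Suc (card S))"
      using card_injective_extensions[of "insert r S" s g y] g s insert.hyps assms(3) by fastforce
    show "(\<Sum>a<y. of_bool (inj_on (g(s := a)) (insert s (insert r S))) *
        card (coloring_stabilizer T (g(s := a)))) =
      (y - Suc (card S)) * (of_bool (inj_on g (insert r S)) * card (coloring_stabilizer T g))"
      unfolding stabilizer sum_distrib_right[symmetric] extensions by (simp only: mult_ac)
  qed
  also have "\<dots> = fact ?k * ((?N - ?k) * (?N choose ?k))"
  proof -
    have "y - Suc (card S) = ?N - ?k" using assms(2,3) by (cases "card T") auto
    then show ?thesis
      using insert.IH insert.prems unfolding sum_distrib_left[symmetric] by simp
  qed
  also have "(?N - ?k) * (?N choose ?k) = Suc ?k * (?N choose Suc ?k)"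
    using binomial_absorb_comp[of ?N ?k] binomial_absorption[of ?k ?N] by (simp only:)
  finally show ?case
    using insert.hyps by (simp add: insert_commute[of r s] mult_ac del: mult_Suc)
qed

lemma invariant_colorings_hook_product:
  fixes p q :: "'n::finite \<Rightarrow> 'n"
  assumes "r \<notin> S" "p permutes insert r S" "q permutes - S"
  shows "rat_of_nat (invariant_colorings y (p \<circ> q)) =
    (\<Sum>f\<in>PiE UNIV (\<lambda>_. {..<y}). of_bool (f \<circ> p = f) * of_bool (f \<circ> q = f))"
proof -
  let ?F = "PiE UNIV (\<lambda>_. {..<y}) :: ('n \<Rightarrow> nat) set"
  have "?F \<inter> {f. f \<circ> (p \<circ> q) = f} = {f. (\<forall>x. f x < y) \<and> f \<circ> (p \<circ> q) = f}" by auto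
  then have "rat_of_nat (invariant_colorings y (p \<circ> q)) = (\<Sum>f\<in>?F. of_bool (f \<circ> (p \<circ> q) = f))"
    by (subst sum_of_bool_eq) (simp_all add: finite_PiE invariant_colorings_def)
  also have "\<dots> = (\<Sum>f\<in>?F. of_bool (f \<circ> p = f) * of_bool (f \<circ> q = f))"
    using invariant_under_hook_product_iff[OF assms] by (intro sum.cong refl) simp
  finally show ?thesis .
qed

lemma hook_eigenvalue_invariant_colorings:
  fixes S :: "'n::finite set"
  assumes r: "r \<notin> S"
  shows "hook_eigenvalue r S (\<lambda>\<tau>. of_nat (invariant_colorings y \<tau>)) =
    fact CARD('n) * of_nat ((y + CARD('n) - 1 - card S) choose CARD('n))"
proof -
  let ?F = "PiE UNIV (\<lambda>_. {..<y}) :: ('n \<Rightarrow> nat) set"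
  have "hook_eigenvalue r S (\<lambda>\<tau>. of_nat (invariant_colorings y \<tau>)) =
    (\<Sum>p | p permutes insert r S. \<Sum>q | q permutes - S. \<Sum>f\<in>?F.
      (of_bool (f \<circ> p = f) * of_int (sign p)) * of_bool (f \<circ> q = f))"
    unfolding hook_eigenvalue_def
    by (intro sum.cong refl)
      (simp add: invariant_colorings_hook_product[OF r] sum_distrib_left mult_ac)
  also have "\<dots> = (\<Sum>f\<in>?F. (\<Sum>p | p permutes insert r S. of_bool (f \<circ> p = f) * of_int (sign p)) *
      (\<Sum>q | q permutes - S. of_bool (f \<circ> q = f)))"
    unfolding sum_product
    by (rule trans[OF sum.cong[OF refl sum.swap] sum.swap])
  also have "\<dots> = of_nat (\<Sum>f\<in>PiE (S \<union> - S) (\<lambda>_. {..<y}).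
      of_bool (inj_on f (insert r S)) * card (coloring_stabilizer (- S) f))"
    unfolding sum_sign_stabilizer by (simp add: card_coloring_stabilizer)
  also have "\<dots> = of_nat (fact (card S + card (- S)) *
      ((y + card (- S) - 1) choose (card S + card (- S))))"
    using r by (subst sum_card_hook_coloring_stabilizer) auto
  also have "card (- S) = CARD('n) - card S"
    by (simp add: Compl_eq_Diff_UNIV card_Diff_subset)
  finally show ?thesis by (simp add: card_mono)
qed

section \<open>Cyclic permutations and the Frobenius formula\<close>

lemma cyclic_on_UNIV_closed:
  assumes "cyclic_on \<sigma> UNIV" and "x \<in> D" and "\<And>y. y \<in> D \<Longrightarrow> \<sigma> y \<in> D"
  shows "z \<in> D"
proof -
  have "z \<in> orbit \<sigma> x" using orbit_cyclic_eq3[OF assms(1)] by simp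
  then show ?thesis by induction (use assms(2,3) in auto)
qed

definition cycle_matrix :: "('n \<Rightarrow> 'n) \<Rightarrow> 'n \<Rightarrow> rat ^ 'n \<Rightarrow> rat ^ 'n ^ 'n::finite" where
  "cycle_matrix \<sigma> r v = (\<chi> x. if x = r then v else axis x 1 - axis (\<sigma> x) 1)"

lemma cyclic_selection_eq_id:
  assumes cyclic: "cyclic_on \<sigma> UNIV" and p: "p permutes UNIV" "p r = r"
    and selection: "\<And>x. x \<noteq> r \<Longrightarrow> p x = x \<or> p x = \<sigma> x"
  shows "p = id"
proof (rule ccontr)
  assume "p \<noteq> id"
  then obtain x where "x \<in> {y. p y \<noteq> y}" by (auto simp: fun_eq_iff)
  then have "r \<in> {y. p y \<noteq> y}"
  proof (rule cyclic_on_UNIV_closed[OF cyclic])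
    fix y assume "y \<in> {y. p y \<noteq> y}"
    then have moved: "p y \<noteq> y" by simp
    then have step: "p y = \<sigma> y" using selection[of y] p(2) by auto
    then have "\<sigma> y \<noteq> y" using moved by simp
    then have "p (\<sigma> y) \<noteq> p y" by (simp add: inj_eq[OF permutes_inj[OF p(1)]])
    then show "\<sigma> y \<in> {y. p y \<noteq> y}" by (simp add: step)
  qed
  then show False using p(2) by simp
qed

lemma det_cycle_matrix_axis_root:
  fixes \<sigma> :: "'n::finite \<Rightarrow> 'n"
  assumes cyclic: "cyclic_on \<sigma> UNIV"
  shows "det (cycle_matrix \<sigma> r (axis r 1)) = 1"
proof -
  let ?C = "cycle_matrix \<sigma> r (axis r 1)"
  have "of_int (sign p) * (\<Prod>x\<in>UNIV. ?C $ x $ p x) = (if p = id then 1 else 0)"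
    if p: "p permutes UNIV" for p
  proof (cases "p = id")
    case True
    have fixpoint_free: "x \<noteq> \<sigma> x" if "x \<noteq> r" for x
    proof
      assume "x = \<sigma> x"
      then have "r \<in> {x}" using cyclic_on_UNIV_closed[OF cyclic, of x "{x}" r] by simp
      then show False using that by simp
    qed
    have "?C $ x $ x = 1" for x
      using fixpoint_free[of x]
      by (cases "x = r") (auto simp: cycle_matrix_def axis_def)
    then show ?thesis using True by simp
  next
    case False
    have "\<exists>x. ?C $ x $ p x = 0"
    proof (rule ccontr)
      assume "\<nexists>x. ?C $ x $ p x = 0"
      then have nonzero: "?C $ x $ p x \<noteq> 0" for x by blast
      have "p r = r" using nonzero[of r] by (auto simp: cycle_matrix_def axis_def split: if_splits)
      moreover have "p x = x \<or> p x = \<sigma> x" if "x \<noteq> r" for x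
        using nonzero[of x] that by (auto simp: cycle_matrix_def axis_def split: if_splits)
      ultimately show False using cyclic_selection_eq_id[OF cyclic p] False by blast
    qed
    then have "(\<Prod>x\<in>UNIV. ?C $ x $ p x) = 0" by (auto intro: prod_zero)
    then show ?thesis using False by simp
  qed
  then have "det ?C = (\<Sum>p | p permutes (UNIV :: 'n set). if p = id then 1 else 0)"
    unfolding det_def by (intro sum.cong refl) simp
  then show ?thesis by (simp add: finite_permutations permutes_id)
qed

lemma det_cycle_matrix_axis_step:
  assumes "y \<noteq> r"
  shows "det (cycle_matrix \<sigma> r (axis y 1)) = det (cycle_matrix \<sigma> r (axis (\<sigma> y) 1))"
proof -
  have "cycle_matrix \<sigma> r (axis y 1) =
      (\<chi> x. if x = r then (axis y 1 - axis (\<sigma> y) 1) + axis (\<sigma> y) 1 else axis x 1 - axis (\<sigma> x) 1)"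
    unfolding cycle_matrix_def by (simp cong: if_cong)
  also have "det \<dots> = det (cycle_matrix \<sigma> r (axis y 1 - axis (\<sigma> y) 1)) +
      det (cycle_matrix \<sigma> r (axis (\<sigma> y) 1))"
    unfolding cycle_matrix_def by (rule det_row_add)
  also have "det (cycle_matrix \<sigma> r (axis y 1 - axis (\<sigma> y) 1)) = 0"
    by (rule det_identical_rows[of y r]) (use assms in \<open>simp_all add: cycle_matrix_def row_def\<close>)
  finally show ?thesis by simp
qed

lemma det_cycle_matrix_cyclic:
  fixes \<sigma> :: "'n::finite \<Rightarrow> 'n"
  assumes cyclic: "cyclic_on \<sigma> UNIV"
  shows "det (cycle_matrix \<sigma> r (\<chi> x. 1)) = of_nat CARD('n)"
proof -
  have det_axis: "det (cycle_matrix \<sigma> r (axis y 1)) = 1" for y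
  proof (rule ccontr)
    let ?D = "{y. det (cycle_matrix \<sigma> r (axis y 1)) \<noteq> 1}"
    assume "det (cycle_matrix \<sigma> r (axis y 1)) \<noteq> 1"
    then have "y \<in> ?D" by simp
    then have "r \<in> ?D"
    proof (rule cyclic_on_UNIV_closed[OF cyclic])
      fix z assume z: "z \<in> ?D"
      then have "z \<noteq> r" using det_cycle_matrix_axis_root[OF cyclic] by auto
      then show "\<sigma> z \<in> ?D" using z det_cycle_matrix_axis_step[of z r \<sigma>] by simp
    qed
    then show False using det_cycle_matrix_axis_root[OF cyclic] by simp
  qed
  have "(\<chi> x. 1) = (\<Sum>y\<in>UNIV. axis y 1 :: rat ^ 'n)"
    by (simp add: vec_eq_iff axis_def)
  then have "cycle_matrix \<sigma> r (\<chi> x. 1) =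
      (\<chi> x. if x = r then (\<Sum>y\<in>UNIV. axis y 1) else axis x 1 - axis (\<sigma> x) 1)"
    unfolding cycle_matrix_def by (simp only:)
  also have "det \<dots> = (\<Sum>y\<in>UNIV. det (cycle_matrix \<sigma> r (axis y 1)))"
    unfolding cycle_matrix_def by (rule det_linear_row_sum) simp
  finally show ?thesis by (simp add: det_axis)
qed

lemma cycle_matrix_mult_component:
  "(cycle_matrix \<sigma> r (\<chi> x. 1) *v v) $ x = (if x = r then \<Sum>y\<in>UNIV. v $ y else v $ x - v $ \<sigma> x)"
proof (cases "x = r")
  case False
  then have "(cycle_matrix \<sigma> r (\<chi> x. 1) *v v) $ x = (\<Sum>y\<in>UNIV. (axis x 1 $ y - axis (\<sigma> x) 1 $ y) * v $ y)"
    by (simp add: matrix_vector_mult_def cycle_matrix_def)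
  also have "\<dots> = (\<Sum>y\<in>UNIV. (if y = x then v $ y else 0) - (if y = \<sigma> x then v $ y else 0))"
    by (intro sum.cong refl) (auto simp: axis_def)
  also have "\<dots> = v $ x - v $ \<sigma> x" by (simp add: sum_subtractf)
  finally show ?thesis using False by simp
qed (simp add: matrix_vector_mult_def cycle_matrix_def)

lemma det_cycle_matrix_not_cyclic:
  fixes \<sigma> :: "'n::finite \<Rightarrow> 'n"
  assumes \<sigma>: "\<sigma> permutes UNIV" and not_cyclic: "\<not> cyclic_on \<sigma> UNIV"
  shows "det (cycle_matrix \<sigma> r (\<chi> x. 1)) = 0"
proof (rule ccontr)
  let ?C = "cycle_matrix \<sigma> r (\<chi> x. 1)"
  assume "det ?C \<noteq> 0"
  then have invertible: "invertible ?C" by (simp add: invertible_det_nz)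
  let ?U = "orbit \<sigma> r"
  txt \<open>A vector in the kernel that is constant on the orbit of \<open>r\<close> and on its complement.\<close>
  define v :: "rat ^ 'n" where
    "v = (\<chi> x. if x \<in> ?U then of_nat (card (- ?U)) else - of_nat (card ?U))"
  have "permutation \<sigma>" using permutes_imp_permutation[OF finite \<sigma>] .
  then have r: "r \<in> ?U" and cyclic: "cyclic_on \<sigma> ?U"
    by (rule permutation_self_in_orbit, rule cyclic_on_orbit')
  have "\<sigma> x \<in> ?U \<longleftrightarrow> x \<in> ?U" for x
    using cyclic_on_inI[OF cyclic] cyclic_on_f_in[OF \<sigma> cyclic] by blast
  then have "v $ \<sigma> x = v $ x" for x by (simp add: v_def)
  moreover have "(\<Sum>y\<in>UNIV. v $ y) = (\<Sum>y\<in>?U. v $ y) + (\<Sum>y\<in>- ?U. v $ y)"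
    using sum.union_disjoint[of ?U "- ?U" "\<lambda>y. v $ y"] by (simp add: Compl_partition)
  then have "(\<Sum>y\<in>UNIV. v $ y) = 0" by (simp add: v_def)
  ultimately have "?C *v v = 0" by (simp add: vec_eq_iff cycle_matrix_mult_component)
  then have "v = 0"
    using invertible
    by (metis invertible_def matrix_vector_mul_assoc matrix_vector_mul_lid matrix_vector_mult_0_right)
  moreover have "- ?U \<noteq> {}"
    using not_cyclic cyclic by (metis Compl_empty_eq double_complement)
  then have "v $ r \<noteq> 0" using r by (simp add: v_def card_eq_0_iff)
  ultimately show False by simp
qed

lemma prod_of_bool:
  assumes "finite A"
  shows "(\<Prod>x\<in>A. of_bool (P x)) = (of_bool (\<forall>x\<in>A. P x) :: 'a::comm_semiring_1)"
  using assms by (induction A rule: finite_induct) auto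

lemma hook_kernel_eq_sum_all_permutations:
  fixes \<sigma> :: "'n::finite \<Rightarrow> 'n"
  assumes \<sigma>: "\<sigma> permutes UNIV"
  shows "(-1) ^ card S * hook_kernel r S \<sigma> = (\<Sum>p | p permutes UNIV. of_int (sign p) *
    ((\<Prod>x\<in>S. - of_bool (p x = \<sigma> x)) * (\<Prod>x\<in>- {r} - S. of_bool (p x = x))))"
proof -
  have column: "p permutes insert r S \<longleftrightarrow> p permutes UNIV \<and> (\<forall>x\<in>- {r} - S. p x = x)" for p
    by (subst permutes_iff_permutes_UNIV) auto
  have "hook_kernel r S \<sigma> = (\<Sum>p | p permutes UNIV. if \<forall>x\<in>- {r} - S. p x = x then
      if \<forall>x\<in>S. p x = \<sigma> x then of_int (sign p) else 0 else 0)"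
    unfolding hook_kernel_eq[OF \<sigma>] column Collect_conj_eq
    by (subst sum.inter_restrict) (simp_all add: finite_permutations)
  also have "\<dots> = (\<Sum>p | p permutes UNIV. of_int (sign p) *
      (of_bool (\<forall>x\<in>S. p x = \<sigma> x) * of_bool (\<forall>x\<in>- {r} - S. p x = x)))"
    by (intro sum.cong refl) (simp only: of_bool_def, simp)
  finally show ?thesis
    unfolding prod_uminus prod_of_bool[OF finite] by (simp only: sum_distrib_left mult_ac)
qed

lemma det_cycle_matrix_expansion:
  "det (cycle_matrix \<sigma> r (\<chi> x. 1)) = (\<Sum>p | p permutes UNIV. of_int (sign p) *
     (\<Prod>x\<in>- {r}. - of_bool (p x = \<sigma> x) + of_bool (p x = x)))"
  unfolding det_def
proof (intro sum.cong refl arg_cong2[where f = "(*)"])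
  fix p
  let ?C = "cycle_matrix \<sigma> r (\<chi> x. 1)"
  have "(\<Prod>x\<in>UNIV. ?C $ x $ p x) = ?C $ r $ p r * (\<Prod>x\<in>- {r}. ?C $ x $ p x)"
    by (subst prod.remove[of _ r]) (auto simp: Compl_eq_Diff_UNIV)
  also have "?C $ r $ p r = 1" by (simp add: cycle_matrix_def)
  also have "(\<Prod>x\<in>- {r}. ?C $ x $ p x) = (\<Prod>x\<in>- {r}. - of_bool (p x = \<sigma> x) + of_bool (p x = x))"
    by (intro prod.cong refl) (auto simp: cycle_matrix_def axis_def)
  finally show "(\<Prod>x\<in>UNIV. ?C $ x $ p x) = (\<Prod>x\<in>- {r}. - of_bool (p x = \<sigma> x) + of_bool (p x = x))"
    by simp
qed

text \<open>Expanding each row \<open>axis x 1 - axis (\<sigma> x) 1\<close> of the determinant of the cycle matrix selects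
  the set \<open>S\<close> of rows in which the second term is taken.\<close>

lemma sum_hook_kernel:
  fixes \<sigma> :: "'n::finite \<Rightarrow> 'n"
  assumes \<sigma>: "\<sigma> permutes UNIV"
  shows "(\<Sum>S\<in>Pow (- {r}). (-1) ^ card S * hook_kernel r S \<sigma>) =
    of_nat CARD('n) * of_bool (cyclic_on \<sigma> UNIV)"
proof -
  have "(\<Sum>S\<in>Pow (- {r}). (-1) ^ card S * hook_kernel r S \<sigma>) =
      (\<Sum>p | p permutes UNIV. of_int (sign p) *
        (\<Sum>S\<in>Pow (- {r}). (\<Prod>x\<in>S. - of_bool (p x = \<sigma> x)) * (\<Prod>x\<in>- {r} - S. of_bool (p x = x))))"
    unfolding hook_kernel_eq_sum_all_permutations[OF \<sigma>] sum_distrib_left by (rule sum.swap)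
  also have "\<dots> = det (cycle_matrix \<sigma> r (\<chi> x. 1))"
    unfolding det_cycle_matrix_expansion prod_add[OF finite] ..
  also have "\<dots> = of_nat CARD('n) * of_bool (cyclic_on \<sigma> UNIV)"
    using det_cycle_matrix_cyclic det_cycle_matrix_not_cyclic[OF \<sigma>] by (cases "cyclic_on \<sigma> UNIV") auto
  finally show ?thesis .
qed

theorem word_sum_cyclic:
  fixes r :: "'n::finite"
  assumes w: "\<And>j. class_function (w j)"
  shows "of_nat CARD('n) * word_sum perm_group w js (\<lambda>\<sigma>. of_bool (cyclic_on \<sigma> UNIV)) =
    (\<Sum>S\<in>Pow (- {r}). (-1) ^ card S * (\<Prod>j\<leftarrow>js. hook_eigenvalue r S (w j)))"
proof -
  have kernel: "word_sum perm_group w js (hook_kernel r S) = (\<Prod>j\<leftarrow>js. hook_eigenvalue r S (w j))"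
    if r: "r \<notin> S" for S
  proof -
    have "word_sum perm_group w js (hook_kernel r S) =
        (\<Prod>j\<leftarrow>js. hook_eigenvalue r S (w j)) * hook_kernel r S \<one>\<^bsub>perm_group\<^esub>"
      using hook_kernel_eigenfunction[OF r _ w]
      by (intro word_sum_eigenfunction monoid_perm_group) simp
    then show ?thesis using hook_kernel_id[OF r] by simp
  qed
  have "of_nat CARD('n) * word_sum perm_group w js (\<lambda>\<sigma>. of_bool (cyclic_on \<sigma> UNIV)) =
      word_sum perm_group w js (\<lambda>\<sigma>. \<Sum>S\<in>Pow (- {r}). (-1) ^ card S * hook_kernel r S \<sigma>)"
    unfolding word_sum_scale[symmetric]
    by (rule word_sum_cong[OF monoid_perm_group]) (simp add: sum_hook_kernel)
  also have "\<dots> = (\<Sum>S\<in>Pow (- {r}). (-1) ^ card S * word_sum perm_group w js (hook_kernel r S))"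
    by (rule word_sum_linear)
  also have "\<dots> = (\<Sum>S\<in>Pow (- {r}). (-1) ^ card S * (\<Prod>j\<leftarrow>js. hook_eigenvalue r S (w j)))"
    by (intro sum.cong refl) (auto simp: kernel)
  finally show ?thesis .
qed

lemma sum_Pow_card:
  fixes F :: "nat \<Rightarrow> 'b::comm_semiring_1"
  assumes "finite A"
  shows "(\<Sum>S\<in>Pow A. F (card S)) = (\<Sum>l\<le>card A. of_nat (card A choose l) * F l)"
proof -
  have "(\<Sum>S\<in>Pow A. F (card S)) = (\<Sum>l\<le>card A. \<Sum>S | S \<in> Pow A \<and> card S = l. F (card S))"
    by (rule sum.group[symmetric]) (use assms in \<open>auto intro: card_mono\<close>)
  then show ?thesis using n_subsets[OF assms] by simp
qed

lemma hook_eigenvalue_scale: "hook_eigenvalue r S (\<lambda>\<tau>. a * w \<tau>) = a * hook_eigenvalue r S w"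
  unfolding hook_eigenvalue_def by (simp add: sum_distrib_left mult.left_commute)

theorem word_sum_cyclic_invariant_colorings:
  fixes y :: "'b \<Rightarrow> nat" and a :: rat
  defines "n \<equiv> CARD('n::finite)"
  shows "of_nat n * word_sum (perm_group :: ('n \<Rightarrow> 'n) monoid)
      (\<lambda>j \<tau>. a * of_nat (invariant_colorings (y j) \<tau>)) js (\<lambda>\<sigma>. of_bool (cyclic_on \<sigma> UNIV)) =
    (\<Sum>l\<le>n - 1. (-1) ^ l * of_nat ((n - 1) choose l) *
      (\<Prod>j\<leftarrow>js. a * (fact n * of_nat ((y j + n - 1 - l) choose n))))"
proof -
  define r :: 'n where "r = undefined"
  have card_r: "card (- {r}) = n - 1" by (simp add: n_def Compl_eq_Diff_UNIV card_Diff_subset)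
  have class_function: "class_function (\<lambda>\<tau>. a * of_nat (invariant_colorings (y j) \<tau>))" for j
    by (rule class_function_compose[OF class_function_invariant_colorings])
  have "of_nat n * word_sum (perm_group :: ('n \<Rightarrow> 'n) monoid)
      (\<lambda>j \<tau>. a * of_nat (invariant_colorings (y j) \<tau>)) js (\<lambda>\<sigma>. of_bool (cyclic_on \<sigma> UNIV)) =
    (\<Sum>S\<in>Pow (- {r}). (-1) ^ card S *
      (\<Prod>j\<leftarrow>js. a * hook_eigenvalue r S (\<lambda>\<tau>. of_nat (invariant_colorings (y j) \<tau>))))"
    unfolding n_def word_sum_cyclic[of "\<lambda>j \<tau>. a * of_nat (invariant_colorings (y j) \<tau>)",
        OF class_function, where r = r]
    by (simp only: hook_eigenvalue_scale)
  also have "\<dots> = (\<Sum>S\<in>Pow (- {r}). (-1) ^ card S *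
      (\<Prod>j\<leftarrow>js. a * (fact n * of_nat ((y j + n - 1 - card S) choose n))))"
    unfolding n_def by (intro sum.cong refl) (auto simp: hook_eigenvalue_invariant_colorings)
  finally show ?thesis
    using sum_Pow_card[of "- {r}"
        "\<lambda>l. (-1) ^ l * (\<Prod>j\<leftarrow>js. a * (fact n * of_nat ((y j + n - 1 - l) choose n)))"]
    by (simp add: card_r mult_ac)
qed

section \<open>Monomial matrices\<close>

definition mono_mat :: "('n \<Rightarrow> 'n) \<Rightarrow> ('n \<Rightarrow> 'a) \<Rightarrow> 'a::zero ^ 'n ^ 'n::finite" where
  "mono_mat \<sigma> t = (\<chi> i j. if i = \<sigma> j then t j else 0)"

lemma mono_mat_mult:
  fixes t s :: "'n::finite \<Rightarrow> 'a::semiring_1"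
  shows "mono_mat \<sigma> t ** mono_mat \<tau> s = mono_mat (\<sigma> \<circ> \<tau>) (\<lambda>j. t (\<tau> j) * s j)"
proof -
  have "(\<Sum>k\<in>UNIV. (if i = \<sigma> k then t k else 0) * (if k = \<tau> j then s j else 0)) =
      (\<Sum>k\<in>UNIV. if k = \<tau> j then (if i = \<sigma> k then t k else 0) * s j else 0)" for i j
    by (intro sum.cong refl) simp
  then show ?thesis by (simp add: vec_eq_iff mono_mat_def matrix_matrix_mult_def)
qed

lemma mono_mat_id: "mono_mat id (\<lambda>_. 1) = mat 1"
  by (simp add: mono_mat_def mat_def vec_eq_iff)

lemma mono_mat_vector:
  fixes t :: "'n::finite \<Rightarrow> 'a::semiring_1"
  assumes "\<sigma> permutes UNIV"
  shows "(mono_mat \<sigma> t *v v) $ \<sigma> j = t j * v $ j"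
proof -
  have "(mono_mat \<sigma> t *v v) $ \<sigma> j = (\<Sum>k\<in>UNIV. (if j = k then t k else 0) * v $ k)"
    by (simp add: matrix_vector_mult_def mono_mat_def inj_eq[OF permutes_inj[OF assms]])
  also have "\<dots> = (\<Sum>k\<in>UNIV. if k = j then t k * v $ k else 0)"
    by (intro sum.cong refl) simp
  finally show ?thesis by simp
qed

lemma mono_mat_eigenvector_iff:
  fixes t :: "'n::finite \<Rightarrow> 'a::semiring_1"
  assumes "\<sigma> permutes UNIV"
  shows "mono_mat \<sigma> t *v v = l *s v \<longleftrightarrow> (\<forall>j. t j * v $ j = l * v $ \<sigma> j)"
proof -
  have "mono_mat \<sigma> t *v v = l *s v \<longleftrightarrow> (\<forall>j. (mono_mat \<sigma> t *v v) $ \<sigma> j = (l *s v) $ \<sigma> j)"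
    unfolding vec_eq_iff using permutes_surj[OF assms] by (metis surjD)
  then show ?thesis by (simp add: mono_mat_vector[OF assms])
qed

lemma fix_space_mono_mat:
  assumes "\<sigma> permutes UNIV"
  shows "v \<in> fix_space (mono_mat \<sigma> t) \<longleftrightarrow> (\<forall>j. v $ \<sigma> j = t j * v $ j)"
  using mono_mat_eigenvector_iff[OF assms, of t v 1] by (auto simp: fix_space_def)

lemma mono_mat_inject:
  assumes "mono_mat \<sigma> t = mono_mat \<tau> s" "\<And>j. t j \<noteq> 0" "\<And>j. s j \<noteq> 0"
  shows "\<sigma> = \<tau> \<and> t = s"
proof -
  have "(if i = \<sigma> j then t j else 0) = (if i = \<tau> j then s j else 0)" for i j
    using arg_cong[OF assms(1), of "\<lambda>A. A $ i $ j"] by (simp add: mono_mat_def)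
  then have "\<sigma> j = \<tau> j \<and> t j = s j" for j
    using assms(2,3) by metis
  then show ?thesis by auto
qed

abbreviation root_vectors :: "nat \<Rightarrow> ('n \<Rightarrow> complex) set" where
  "root_vectors d \<equiv> {t. \<forall>j. t j ^ d = 1}"

lemma root_of_unity_nonzero: "(z::complex) ^ d = 1 \<Longrightarrow> d > 0 \<Longrightarrow> z \<noteq> 0"
  by (auto simp: zero_power)

lemma root_vectors_PiE: "root_vectors d = PiE (UNIV :: 'n::finite set) (\<lambda>_. {z. z ^ d = 1})"
  by auto

lemma finite_root_vectors: "d > 0 \<Longrightarrow> finite (root_vectors d :: ('n::finite \<Rightarrow> complex) set)"
  unfolding root_vectors_PiE by (intro finite_PiE) (auto intro: finite_nth_roots)

lemma card_root_vectors: "d > 0 \<Longrightarrow> card (root_vectors d :: ('n::finite \<Rightarrow> complex) set) = d ^ CARD('n)"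
  unfolding root_vectors_PiE by (subst card_PiE) (simp_all add: card_roots_unity_eq)

definition perm_of :: "complex ^ 'n ^ 'n::finite \<Rightarrow> 'n \<Rightarrow> 'n" where
  "perm_of A j = (THE i. A $ i $ j \<noteq> 0)"

definition color_of :: "complex ^ 'n ^ 'n::finite \<Rightarrow> complex" where
  "color_of A = (\<Prod>j\<in>UNIV. A $ perm_of A j $ j)"

lemma perm_of_mono_mat:
  assumes "\<And>j. t j \<noteq> 0"
  shows "perm_of (mono_mat \<sigma> t) = \<sigma>"
proof
  fix j
  have "mono_mat \<sigma> t $ i $ j \<noteq> 0 \<longleftrightarrow> i = \<sigma> j" for i
    using assms by (simp add: mono_mat_def)
  then show "perm_of (mono_mat \<sigma> t) j = \<sigma> j" unfolding perm_of_def by simp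
qed

lemma color_of_mono_mat:
  assumes "\<And>j. t j \<noteq> 0"
  shows "color_of (mono_mat \<sigma> t) = (\<Prod>j\<in>UNIV. t j)"
  unfolding color_of_def perm_of_mono_mat[of t, OF assms] by (simp add: mono_mat_def)

section \<open>The group \<open>G(d, 1, n)\<close>\<close>

lemma Gd1n_simps [simp]: "monoid.mult (Gd1n d) = (**)" "one (Gd1n d) = mat 1"
  by (simp_all add: Gd1n_def)

lemma mono_mat_in_carrier:
  assumes d: "d > 0" and \<sigma>: "\<sigma> permutes UNIV" and t: "t \<in> root_vectors d"
  shows "mono_mat \<sigma> t \<in> carrier (Gd1n d)"
proof -
  have nonzero: "mono_mat \<sigma> t $ i $ j \<noteq> 0 \<longleftrightarrow> \<sigma> j = i" for i j
    using t root_of_unity_nonzero[OF _ d] by (auto simp: mono_mat_def)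
  have "\<exists>!j. \<sigma> j = i" for i using \<sigma> by (simp add: permutes_univ)
  moreover have "(mono_mat \<sigma> t $ i $ j) ^ d = 1" if "\<sigma> j = i" for i j
    using that t by (auto simp: mono_mat_def)
  ultimately show ?thesis by (simp add: Gd1n_def nonzero)
qed

lemma carrier_Gd1nE:
  assumes d: "d > 0" and A: "A \<in> carrier (Gd1n d)"
  obtains \<sigma> t where "A = mono_mat \<sigma> t" "\<sigma> permutes UNIV" "t \<in> root_vectors d"
    "perm_of A = \<sigma>" "color_of A = (\<Prod>j\<in>UNIV. t j)"
proof -
  have row: "\<exists>!j. A $ i $ j \<noteq> 0" and col: "\<exists>!i. A $ i $ j \<noteq> 0"
    and root: "A $ i $ j \<noteq> 0 \<Longrightarrow> (A $ i $ j) ^ d = 1" for i j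
    using A by (auto simp: Gd1n_def)
  define \<sigma> where "\<sigma> = perm_of A"
  define t where "t j = A $ \<sigma> j $ j" for j
  have \<sigma>: "A $ i $ j \<noteq> 0 \<longleftrightarrow> \<sigma> j = i" for i j
    unfolding \<sigma>_def perm_of_def using the1_equality[OF col] theI'[OF col] by blast
  have "\<sigma> permutes UNIV"
    unfolding permutes_univ using row by (simp add: \<sigma>)
  moreover have "A = mono_mat \<sigma> t"
    using \<sigma> by (simp add: mono_mat_def t_def vec_eq_iff) metis
  moreover have "t \<in> root_vectors d"
    using root \<sigma> unfolding t_def by blast
  moreover have "color_of A = (\<Prod>j\<in>UNIV. t j)"
    by (simp add: color_of_def t_def \<sigma>_def)
  moreover have "perm_of A = \<sigma>" by (simp add: \<sigma>_def)
  ultimately show ?thesis using that by metis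
qed

lemma
  assumes d: "d > 0" and A: "A \<in> carrier (Gd1n d)" and B: "B \<in> carrier (Gd1n d)"
  shows perm_of_mult: "perm_of (A ** B) = perm_of A \<circ> perm_of B"
    and color_of_mult: "color_of (A ** B) = color_of A * color_of B"
    and mult_in_carrier_Gd1n: "A ** B \<in> carrier (Gd1n d)"
proof -
  obtain \<sigma> t where A: "A = mono_mat \<sigma> t" "\<sigma> permutes UNIV" "t \<in> root_vectors d"
    and perm_A: "perm_of A = \<sigma>" and color_A: "color_of A = (\<Prod>j\<in>UNIV. t j)"
    using carrier_Gd1nE[OF d A] by blast
  obtain \<tau> s where B: "B = mono_mat \<tau> s" "\<tau> permutes UNIV" "s \<in> root_vectors d"
    and perm_B: "perm_of B = \<tau>" and color_B: "color_of B = (\<Prod>j\<in>UNIV. s j)"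
    using carrier_Gd1nE[OF d B] by blast
  have nonzero: "t j \<noteq> 0" "s j \<noteq> 0" for j using A B root_of_unity_nonzero[OF _ d] by auto
  have AB: "A ** B = mono_mat (\<sigma> \<circ> \<tau>) (\<lambda>j. t (\<tau> j) * s j)"
    unfolding A(1) B(1) by (rule mono_mat_mult)
  show "perm_of (A ** B) = perm_of A \<circ> perm_of B"
    unfolding AB perm_A perm_B by (rule perm_of_mono_mat) (simp add: nonzero)
  have "(\<Prod>j\<in>UNIV. t (\<tau> j)) = (\<Prod>j\<in>UNIV. t j)"
    using prod.permute[OF B(2), of t] by (simp add: o_def)
  then show "color_of (A ** B) = color_of A * color_of B"
    unfolding AB color_A color_B by (subst color_of_mono_mat) (simp_all add: nonzero prod.distrib)
  show "A ** B \<in> carrier (Gd1n d)"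
    unfolding AB using A B
    by (intro mono_mat_in_carrier[OF d] permutes_compose) (auto simp: power_mult_distrib)
qed

lemma one_in_carrier_Gd1n: "d > 0 \<Longrightarrow> mat 1 \<in> carrier (Gd1n d)"
  using mono_mat_in_carrier[OF _ permutes_id, of d "\<lambda>_. 1"] by (simp add: mono_mat_id)

lemma perm_of_one: "perm_of (mat 1) = id" and color_of_one: "color_of (mat 1) = 1"
  using perm_of_mono_mat[of "\<lambda>_. 1" id] color_of_mono_mat[of "\<lambda>_. 1" id] by (simp_all add: mono_mat_id)

lemma group_Gd1n:
  assumes d: "d > 0"
  shows "group (Gd1n d :: 'n::finite cmat_group)"
proof (rule groupI)
  fix A :: "complex ^ 'n ^ 'n" assume "A \<in> carrier (Gd1n d)"
  then obtain \<sigma> t where A: "A = mono_mat \<sigma> t" and \<sigma>: "\<sigma> permutes UNIV" and t: "t \<in> root_vectors d"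
    using carrier_Gd1nE[OF d] by blast
  define s where "s i = 1 / t (inv_into UNIV \<sigma> i)" for i
  have "s \<in> root_vectors d" using t by (simp add: s_def power_divide)
  then have "mono_mat (inv_into UNIV \<sigma>) s \<in> carrier (Gd1n d)"
    by (rule mono_mat_in_carrier[OF d permutes_inv[OF \<sigma>]])
  moreover have "(\<lambda>j. s (\<sigma> j) * t j) = (\<lambda>_. 1)"
    using t root_of_unity_nonzero[OF _ d] by (auto simp: s_def permutes_inverses[OF \<sigma>])
  then have "mono_mat (inv_into UNIV \<sigma>) s ** A = mat 1"
    unfolding A mono_mat_mult permutes_inv_o(2)[OF \<sigma>] by (simp only: mono_mat_id)
  ultimately show "\<exists>B\<in>carrier (Gd1n d). B \<otimes>\<^bsub>Gd1n d\<^esub> A = \<one>\<^bsub>Gd1n d\<^esub>" by auto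
qed (simp_all add: matrix_mul_assoc mult_in_carrier_Gd1n[OF d] one_in_carrier_Gd1n[OF d])

lemma monoid_Gd1n: "d > 0 \<Longrightarrow> monoid (Gd1n d :: 'n::finite cmat_group)"
  using group_Gd1n by (rule group.is_monoid)

lemma bij_betw_mono_mat:
  assumes d: "d > 0"
  shows "bij_betw (\<lambda>(\<sigma>, t). mono_mat \<sigma> t) ({\<sigma> :: 'n::finite \<Rightarrow> 'n. \<sigma> permutes UNIV} \<times> root_vectors d)
    (carrier (Gd1n d))"
proof (rule bij_betw_imageI)
  show "inj_on (\<lambda>(\<sigma>, t). mono_mat \<sigma> t) ({\<sigma> :: 'n \<Rightarrow> 'n. \<sigma> permutes UNIV} \<times> root_vectors d)"
  proof (rule inj_onI, clarify)
    fix \<sigma> \<tau> :: "'n \<Rightarrow> 'n" and t s :: "'n \<Rightarrow> complex"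
    assume "\<forall>j. t j ^ d = 1" "\<forall>j. s j ^ d = 1" "mono_mat \<sigma> t = mono_mat \<tau> s"
    then show "\<sigma> = \<tau> \<and> t = s"
      using root_of_unity_nonzero[OF _ d] by (intro mono_mat_inject) auto
  qed
  show "(\<lambda>(\<sigma>, t). mono_mat \<sigma> t) ` ({\<sigma> :: 'n \<Rightarrow> 'n. \<sigma> permutes UNIV} \<times> root_vectors d) = carrier (Gd1n d)"
  proof
    show "carrier (Gd1n d) \<subseteq>
        (\<lambda>(\<sigma>, t). mono_mat \<sigma> t) ` ({\<sigma> :: 'n \<Rightarrow> 'n. \<sigma> permutes UNIV} \<times> root_vectors d)"
      by (auto elim!: carrier_Gd1nE[OF d] intro!: image_eqI[where x = "(\<sigma>, t)" for \<sigma> t])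
  qed (auto intro: mono_mat_in_carrier[OF d])
qed

lemma sum_carrier_Gd1n:
  assumes "d > 0"
  shows "(\<Sum>A\<in>carrier (Gd1n d :: 'n::finite cmat_group). F A) =
    (\<Sum>\<sigma> | \<sigma> permutes UNIV. \<Sum>t\<in>root_vectors d. F (mono_mat \<sigma> t))"
  using sum.reindex_bij_betw[OF bij_betw_mono_mat[OF assms], of F]
  by (simp add: sum.cartesian_product case_prod_unfold)

lemma finite_carrier_Gd1n: "d > 0 \<Longrightarrow> finite (carrier (Gd1n d :: 'n::finite cmat_group))"
  using bij_betw_finite[OF bij_betw_mono_mat, of d]
  by (auto simp: finite_permutations finite_root_vectors)

lemma order_Gd1n:
  assumes "d > 0"
  shows "order (Gd1n d :: 'n::finite cmat_group) = d ^ CARD('n) * fact CARD('n)"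
proof -
  have "order (Gd1n d :: 'n cmat_group) =
      card ({\<sigma> :: 'n \<Rightarrow> 'n. \<sigma> permutes UNIV} \<times> (root_vectors d :: ('n \<Rightarrow> complex) set))"
    unfolding order_def by (rule bij_betw_same_card[OF bij_betw_mono_mat[OF assms], symmetric])
  also have "\<dots> = fact CARD('n) * d ^ CARD('n)"
    unfolding card_cartesian_product card_root_vectors[OF assms] by (simp add: card_permutations)
  finally show ?thesis by simp
qed

section \<open>Fixed spaces of monomial matrices\<close>

definition tied_space :: "('n \<Rightarrow> 'n) \<Rightarrow> ('n \<Rightarrow> 'a) \<Rightarrow> ('a::field ^ 'n::finite) set" where
  "tied_space \<rho> b = {v. \<forall>i. v $ i = b i * v $ \<rho> i}"

definition tying :: "('n \<Rightarrow> 'n) \<Rightarrow> ('n \<Rightarrow> 'a::field) \<Rightarrow> bool" where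
  "tying \<rho> b \<longleftrightarrow> (\<forall>i. b i \<noteq> 0 \<longrightarrow> \<rho> (\<rho> i) = \<rho> i \<and> b (\<rho> i) = 1)"

text \<open>Under the condition \<open>tying \<rho> b\<close> these coordinates can be chosen freely in \<open>tied_space \<rho> b\<close>, and
  they determine all others.\<close>

definition free_coordinates :: "('n \<Rightarrow> 'n) \<Rightarrow> ('n \<Rightarrow> 'a::field) \<Rightarrow> 'n set" where
  "free_coordinates \<rho> b = {x. \<rho> x = x \<and> b x = 1}"

lemma bij_betw_tied_space:
  fixes b :: "'n::finite \<Rightarrow> 'a::field"
  assumes "tying \<rho> b" and K: "0 \<in> K" "\<And>i k. k \<in> K \<Longrightarrow> b i * k \<in> K"
  shows "bij_betw (\<lambda>v. \<chi> i. b i * v $ \<rho> i)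
    {v. (\<forall>i. v $ i \<in> K) \<and> (\<forall>i. i \<notin> free_coordinates \<rho> b \<longrightarrow> v $ i = 0)}
    {v \<in> tied_space \<rho> b. \<forall>i. v $ i \<in> K}"
proof (rule bij_betwI[where g = "\<lambda>v. \<chi> i. if i \<in> free_coordinates \<rho> b then v $ i else 0"])
  have tied: "b i = 0 \<or> \<rho> (\<rho> i) = \<rho> i \<and> b (\<rho> i) = 1" for i
    using assms(1) by (auto simp: tying_def)
  then have "b (\<rho> i) * v $ \<rho> (\<rho> i) = v $ \<rho> i" if "b i \<noteq> 0" for i and v :: "'a ^ 'n"
    using that by (metis mult_1)
  then show "(\<lambda>v. \<chi> i. b i * v $ \<rho> i) \<in>
      {v. (\<forall>i. v $ i \<in> K) \<and> (\<forall>i. i \<notin> free_coordinates \<rho> b \<longrightarrow> v $ i = 0)} \<rightarrow>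
      {v \<in> tied_space \<rho> b. \<forall>i. v $ i \<in> K}"
    using K(2) by (auto simp: tied_space_def) metis
  show "(\<chi> i. b i * (\<chi> i. if i \<in> free_coordinates \<rho> b then v $ i else 0) $ \<rho> i) = v"
    if "v \<in> {v \<in> tied_space \<rho> b. \<forall>i. v $ i \<in> K}" for v
  proof -
    have v: "v $ i = b i * v $ \<rho> i" for i using that unfolding tied_space_def by blast
    show ?thesis
      unfolding vec_eq_iff
    proof
      fix i
      show "(\<chi> i. b i * (\<chi> i. if i \<in> free_coordinates \<rho> b then v $ i else 0) $ \<rho> i) $ i = v $ i"
        using tied[of i] v[of i] by (auto simp: free_coordinates_def)
    qed
  qed
qed (use K(1) in \<open>auto simp: vec_eq_iff free_coordinates_def\<close>)

lemma card_vectors_supported: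
  assumes "finite K"
  shows "card {v :: 'a::zero ^ 'n::finite. (\<forall>i. v $ i \<in> insert 0 K) \<and> (\<forall>i. i \<notin> R \<longrightarrow> v $ i = 0)} =
    card (insert 0 K) ^ card R"
proof -
  let ?K = "insert 0 K"
  have "bij_betw (\<lambda>v. restrict (($) v) R)
      {v :: 'a ^ 'n. (\<forall>i. v $ i \<in> ?K) \<and> (\<forall>i. i \<notin> R \<longrightarrow> v $ i = 0)} (PiE R (\<lambda>_. ?K))"
    by (rule bij_betwI[where g = "\<lambda>g. \<chi> i. if i \<in> R then g i else 0"])
      (auto simp: vec_eq_iff fun_eq_iff PiE_iff extensional_def)
  from bij_betw_same_card[OF this] show ?thesis by (simp add: card_PiE)
qed

lemma card_tied_space_points:
  fixes b :: "'n::finite \<Rightarrow> 'a::field"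
  assumes "tying \<rho> b" and K: "finite K" "0 \<in> K" "\<And>i k. k \<in> K \<Longrightarrow> b i * k \<in> K"
  shows "card {v \<in> tied_space \<rho> b. \<forall>i. v $ i \<in> K} = card K ^ card (free_coordinates \<rho> b)"
  using bij_betw_same_card[OF bij_betw_tied_space[OF assms(1) K(2,3)]]
    card_vectors_supported[OF K(1), of "free_coordinates \<rho> b"] insert_absorb[OF K(2)] by simp

lemma dim_tied_space:
  fixes b :: "'n::finite \<Rightarrow> 'a::field"
  assumes "tying \<rho> b"
  shows "vec.dim (tied_space \<rho> b) = card (free_coordinates \<rho> b)"
proof -
  let ?L = "\<lambda>v. \<chi> i. b i * v $ \<rho> i"
  let ?W = "{v :: 'a ^ 'n. \<forall>i. i \<notin> free_coordinates \<rho> b \<longrightarrow> v $ i = 0}"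
  have bij: "bij_betw ?L ?W (tied_space \<rho> b)"
    using bij_betw_tied_space[OF assms, of UNIV] by simp
  have "Vector_Spaces.linear (*s) (*s) ?L"
    unfolding Vector_Spaces.linear_iff
    by (auto simp: vec_eq_iff algebra_simps intro: vec.vector_space_axioms)
  moreover have "vec.span ?W = ?W"
    by (intro vec.span_eq_iff[THEN iffD2] vec.subspaceI) auto
  then have "inj_on ?L (vec.span ?W)"
    using bij by (simp only: bij_betw_def)
  ultimately have "vec.dim (?L ` ?W) = vec.dim ?W"
    by (rule vec.dim_image_eq)
  then show ?thesis
    using bij by (simp add: bij_betw_def dim_substandard_cart)
qed

lemma fix_space_mono_mat_transport:
  assumes \<sigma>: "\<sigma> permutes UNIV" and t: "t \<in> root_vectors d" and i: "i \<in> orbit \<sigma> j"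
  shows "\<exists>T. T ^ d = 1 \<and> (\<forall>v\<in>fix_space (mono_mat \<sigma> t). v $ i = T * v $ j)"
  using i
proof induction
  case base
  then show ?case using t fix_space_mono_mat[OF \<sigma>] by blast
next
  case (step i)
  then obtain T where T: "T ^ d = 1" "\<forall>v\<in>fix_space (mono_mat \<sigma> t). v $ i = T * v $ j" by blast
  then have "(t i * T) ^ d = 1" "\<forall>v\<in>fix_space (mono_mat \<sigma> t). v $ \<sigma> i = (t i * T) * v $ j"
    using t by (auto simp: power_mult_distrib fix_space_mono_mat[OF \<sigma>])
  then show ?case by blast
qed

lemma orbit_representatives:
  fixes \<sigma> :: "'n::finite \<Rightarrow> 'n"
  assumes \<sigma>: "\<sigma> permutes UNIV"
  obtains \<rho> where "\<And>x. \<rho> (\<rho> x) = \<rho> x" "\<And>x. \<rho> (\<sigma> x) = \<rho> x" "\<And>x. x \<in> orbit \<sigma> (\<rho> x)"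
proof -
  define \<rho> where "\<rho> x = (SOME y. y \<in> orbit \<sigma> x)" for x
  have perm: "permutation \<sigma>" using permutes_imp_permutation[OF finite \<sigma>] .
  have orbit_\<rho>: "orbit \<sigma> (\<rho> x) = orbit \<sigma> x" for x
    using cyclic_on_orbit'[OF perm] permutation_self_in_orbit[OF perm, of x]
    unfolding \<rho>_def by (intro orbit_cyclic_eq3) (auto intro: someI)
  show ?thesis
  proof (rule that)
    show "\<rho> (\<rho> x) = \<rho> x" for x using orbit_\<rho> by (simp add: \<rho>_def)
    show "\<rho> (\<sigma> x) = \<rho> x" for x by (simp add: \<rho>_def permutation_orbit_step[OF perm])
    show "x \<in> orbit \<sigma> (\<rho> x)" for x
      unfolding orbit_\<rho> by (rule permutation_self_in_orbit[OF perm])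
  qed
qed

definition tied_coefficient ::
    "('a ^ 'n) set \<Rightarrow> ('n \<Rightarrow> 'n) \<Rightarrow> ('n \<Rightarrow> 'a) \<Rightarrow> 'n \<Rightarrow> 'a::field" where
  "tied_coefficient V \<rho> T i = (if \<exists>v\<in>V. v $ \<rho> i \<noteq> 0 then T i else 0)"

lemma
  fixes V :: "('a::field ^ 'n::finite) set"
  assumes idempotent: "\<And>i. \<rho> (\<rho> i) = \<rho> i" and T: "\<And>i v. v \<in> V \<Longrightarrow> v $ i = T i * v $ \<rho> i"
  shows tying_tied_coefficient: "tying \<rho> (tied_coefficient V \<rho> T)"
    and subset_tied_space: "V \<subseteq> tied_space \<rho> (tied_coefficient V \<rho> T)"
proof -
  let ?b = "tied_coefficient V \<rho> T"
  show "tying \<rho> ?b"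
    unfolding tying_def
  proof (intro allI impI conjI idempotent)
    fix i assume "?b i \<noteq> 0"
    then obtain w where w: "w \<in> V" "w $ \<rho> i \<noteq> 0"
      by (auto simp: tied_coefficient_def split: if_splits)
    have "T (\<rho> i) * w $ \<rho> i = w $ \<rho> i"
      using T[OF w(1), of "\<rho> i"] unfolding idempotent by (rule sym)
    then have "T (\<rho> i) = 1" using w(2) by simp
    then show "?b (\<rho> i) = 1" using w by (auto simp: tied_coefficient_def idempotent)
  qed
  show "V \<subseteq> tied_space \<rho> ?b"
  proof
    fix v assume v: "v \<in> V"
    have "v $ i = ?b i * v $ \<rho> i" for i
    proof (cases "v $ \<rho> i = 0")
      case False
      then have "?b i = T i" using v by (auto simp: tied_coefficient_def)
      then show ?thesis using T[OF v, of i] by simp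
    qed (simp add: T[OF v, of i])
    then show "v \<in> tied_space \<rho> ?b" unfolding tied_space_def by blast
  qed
qed

text \<open>On each orbit of \<open>\<sigma>\<close> a fixed vector is determined by its value at one representative, and
  either this value is arbitrary or all fixed vectors vanish on the orbit.\<close>

lemma fix_space_mono_mat_tied:
  fixes \<sigma> :: "'n::finite \<Rightarrow> 'n"
  assumes \<sigma>: "\<sigma> permutes UNIV" and t: "t \<in> root_vectors d"
  obtains \<rho> b where "tying \<rho> b" "fix_space (mono_mat \<sigma> t) = tied_space \<rho> b"
    "\<And>i. b i = 0 \<or> b i ^ d = 1"
proof -
  let ?V = "fix_space (mono_mat \<sigma> t)"
  obtain \<rho> where \<rho>: "\<And>x. \<rho> (\<rho> x) = \<rho> x" "\<And>x. \<rho> (\<sigma> x) = \<rho> x" "\<And>x. x \<in> orbit \<sigma> (\<rho> x)"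
    using orbit_representatives[OF \<sigma>] by blast
  have "\<forall>i. \<exists>T. T ^ d = 1 \<and> (\<forall>v\<in>?V. v $ i = T * v $ \<rho> i)"
    using fix_space_mono_mat_transport[OF \<sigma> t] \<rho>(3) by blast
  then obtain T where T: "T i ^ d = 1" "v \<in> ?V \<Longrightarrow> v $ i = T i * v $ \<rho> i" for i v
    by (auto dest!: choice)
  define b where "b = tied_coefficient ?V \<rho> T"
  have b_\<sigma>: "b (\<sigma> i) = t i * b i" for i
  proof (cases "\<exists>w\<in>?V. w $ \<rho> i \<noteq> 0")
    case True
    then obtain w where w: "w \<in> ?V" "w $ \<rho> i \<noteq> 0" by blast
    then have "T (\<sigma> i) * w $ \<rho> i = t i * (T i * w $ \<rho> i)"
      using T(2)[OF w(1)] fix_space_mono_mat[OF \<sigma>, of w t] \<rho>(2) by metis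
    then show ?thesis using w by (auto simp: b_def tied_coefficient_def \<rho>(2))
  qed (simp add: b_def tied_coefficient_def \<rho>(2))
  have "tied_space \<rho> b \<subseteq> ?V"
  proof
    fix v assume "v \<in> tied_space \<rho> b"
    then have v: "v $ i = b i * v $ \<rho> i" for i unfolding tied_space_def by blast
    have "v $ \<sigma> i = t i * v $ i" for i
      unfolding v[of "\<sigma> i"] v[of i] b_\<sigma> \<rho>(2) by (rule mult.assoc)
    then show "v \<in> ?V" unfolding fix_space_mono_mat[OF \<sigma>] by blast
  qed
  then have "?V = tied_space \<rho> b"
    using subset_tied_space[where V = ?V, OF \<rho>(1) T(2)] unfolding b_def by blast
  moreover have "tying \<rho> b"
    unfolding b_def by (rule tying_tied_coefficient[OF \<rho>(1) T(2)])
  ultimately show ?thesis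
    using T(1) by (intro that[of \<rho> b]) (auto simp: b_def tied_coefficient_def)
qed

theorem card_fixed_points_mono_mat:
  fixes \<sigma> :: "'n::finite \<Rightarrow> 'n"
  assumes \<sigma>: "\<sigma> permutes UNIV" and t: "t \<in> root_vectors d"
    and K: "finite K" "0 \<in> K" "\<And>z k. z ^ d = 1 \<Longrightarrow> k \<in> K \<Longrightarrow> z * k \<in> K"
  shows "card {v \<in> fix_space (mono_mat \<sigma> t). \<forall>i. v $ i \<in> K} =
    card K ^ vec.dim (fix_space (mono_mat \<sigma> t))"
proof -
  obtain \<rho> b where b: "tying \<rho> b" "fix_space (mono_mat \<sigma> t) = tied_space \<rho> b"
    "\<And>i. b i = 0 \<or> b i ^ d = 1"
    using fix_space_mono_mat_tied[OF \<sigma> t] by blast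
  have "b i * k \<in> K" if "k \<in> K" for i k
    using b(3)[of i] K(2) K(3)[OF _ that] by auto
  from card_tied_space_points[OF b(1) K(1,2) this] show ?thesis
    unfolding b(2) dim_tied_space[OF b(1)] .
qed

section \<open>Fixed vectors with prescribed entries\<close>

definition color_set :: "nat \<Rightarrow> nat \<Rightarrow> complex set" where
  "color_set d j = insert 0 ((\<lambda>(a, z). of_nat a * z) ` ({1..j} \<times> {z. z ^ d = 1}))"

lemma norm_root_of_unity:
  assumes "(z::complex) ^ d = 1" "d > 0"
  shows "norm z = 1"
  using power_eq_1_iff[OF assms(1)] assms(2) by simp

lemma sgn_root_of_unity:
  assumes "(z::complex) ^ d = 1" "d > 0"
  shows "sgn z = z"
  using norm_root_of_unity[OF assms] by (simp add: sgn_div_norm)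

lemma color_set_iff:
  "k \<in> color_set d j \<longleftrightarrow> (\<exists>a z. k = of_nat a * z \<and> a \<le> j \<and> z ^ d = 1)"
proof
  assume "k \<in> color_set d j"
  then consider "k = of_nat 0 * 1" | a z where "k = of_nat a * z" "a \<le> j" "z ^ d = 1"
    by (auto simp: color_set_def)
  then show "\<exists>a z. k = of_nat a * z \<and> a \<le> j \<and> z ^ d = 1"
    by cases (metis le0 power_one, blast)
next
  assume "\<exists>a z. k = of_nat a * z \<and> a \<le> j \<and> z ^ d = 1"
  then obtain a z where k: "k = of_nat a * z" "a \<le> j" "z ^ d = 1" by blast
  then show "k \<in> color_set d j"
    by (cases "a = 0") (auto simp: color_set_def intro!: image_eqI[where x = "(a, z)"])
qed

lemma color_set_mult_root:
  assumes z: "z ^ d = 1" and k: "k \<in> color_set d j"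
  shows "z * k \<in> color_set d j"
proof -
  obtain a w where "k = of_nat a * w" "a \<le> j" "w ^ d = 1" using k unfolding color_set_iff by blast
  then have "z * k = of_nat a * (z * w)" "a \<le> j" "(z * w) ^ d = 1"
    using z by (simp_all add: power_mult_distrib)
  then show ?thesis unfolding color_set_iff by blast
qed

lemma color_set_polar:
  assumes d: "d > 0" and k: "k \<in> color_set d j"
  obtains a where "a \<le> j" "norm k = of_nat a" "k \<noteq> 0 \<Longrightarrow> sgn k ^ d = 1"
proof -
  obtain a z where az: "k = of_nat a * z" "a \<le> j" "z ^ d = 1" using k unfolding color_set_iff by blast
  have "norm k = of_nat a" using norm_root_of_unity[OF az(3) d] by (simp add: az(1) norm_mult)
  moreover from this have "sgn k = z" if "k \<noteq> 0"
    using that az(1) by (simp add: sgn_div_norm scaleR_conv_of_real)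
  ultimately show ?thesis using that az(2,3) by blast
qed

lemma zero_in_color_set: "0 \<in> color_set d j"
  by (simp add: color_set_def)

lemma finite_color_set: "d > 0 \<Longrightarrow> finite (color_set d j)"
  by (simp add: color_set_def finite_nth_roots)

lemma card_color_set:
  assumes d: "d > 0"
  shows "card (color_set d j) = 1 + d * j"
proof -
  let ?polar = "\<lambda>(a, z). of_nat a * z :: complex" and ?P = "{1..j} \<times> {z::complex. z ^ d = 1}"
  have "inj_on ?polar ?P"
  proof (rule inj_onI, clarify)
    fix a b :: nat and z w :: complex
    assume a: "a \<in> {1..j}" and z: "z ^ d = 1" and w: "w ^ d = 1" and polar: "of_nat a * z = of_nat b * w"
    from polar have "norm (of_nat a * z) = norm (of_nat b * w)" by simp
    then have "a = b"
      using norm_root_of_unity[OF z d] norm_root_of_unity[OF w d] by (simp add: norm_mult)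
    then show "a = b \<and> z = w" using a polar by simp
  qed
  then have "card (?polar ` ?P) = j * d"
    using d by (simp add: card_image card_cartesian_product card_roots_unity_eq)
  moreover have "0 \<notin> ?polar ` ?P" using root_of_unity_nonzero[OF _ d] by auto
  ultimately show ?thesis
    using finite_nth_roots[OF d] by (simp add: color_set_def)
qed

definition colored_fixed_vectors :: "nat \<Rightarrow> nat \<Rightarrow> complex ^ 'n ^ 'n \<Rightarrow> (complex ^ 'n::finite) set" where
  "colored_fixed_vectors d j A = {v \<in> fix_space A. \<forall>i. v $ i \<in> color_set d j}"

definition fix_weight :: "nat \<Rightarrow> nat \<Rightarrow> complex ^ 'n ^ 'n::finite \<Rightarrow> rat" where
  "fix_weight d j A = (1 + of_nat (d * j)) ^ vec.dim (fix_space A)"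

lemma card_colored_fixed_vectors:
  assumes d: "d > 0" and "\<sigma> permutes UNIV" "t \<in> root_vectors d"
  shows "card (colored_fixed_vectors d j (mono_mat \<sigma> t)) =
    (1 + d * j) ^ vec.dim (fix_space (mono_mat \<sigma> t))"
  using card_fixed_points_mono_mat[OF assms(2,3) finite_color_set[OF d] zero_in_color_set
      color_set_mult_root, of j]
  by (simp add: colored_fixed_vectors_def card_color_set[OF d])

lemma finite_colored_fixed_vectors:
  assumes "d > 0" "\<sigma> permutes UNIV" "t \<in> root_vectors d"
  shows "finite (colored_fixed_vectors d j (mono_mat \<sigma> t))"
  using card_colored_fixed_vectors[OF assms, of j] by (intro card_ge_0_finite) simp

text \<open>A fixed vector is recorded by the absolute values \<open>m\<close> and the phases \<open>s\<close> of its entries. Where it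
  vanishes it has no phase, and \<open>s\<close> records the entry of the matrix instead.\<close>

definition phase_quotient :: "('n \<Rightarrow> 'n) \<Rightarrow> ('n \<Rightarrow> nat) \<Rightarrow> ('n \<Rightarrow> complex) \<Rightarrow> 'n \<Rightarrow> complex" where
  "phase_quotient \<sigma> m s i = (if m i = 0 then s i else s (\<sigma> i) / s i)"

lemma
  assumes d: "d > 0" and \<sigma>: "\<sigma> permutes UNIV"
    and m: "\<forall>i. m i < Suc j" "m \<circ> \<sigma> = m" and s: "s \<in> root_vectors d"
  shows phase_quotient_in_root_vectors: "phase_quotient \<sigma> m s \<in> root_vectors d"
    and polar_in_colored_fixed_vectors:
      "(\<chi> i. of_nat (m i) * s i) \<in> colored_fixed_vectors d j (mono_mat \<sigma> (phase_quotient \<sigma> m s))"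
proof -
  have m_\<sigma>: "m (\<sigma> i) = m i" for i using m(2) by (metis comp_apply)
  show "phase_quotient \<sigma> m s \<in> root_vectors d"
    using s by (simp add: phase_quotient_def power_divide)
  have "of_nat (m i) * s i \<in> color_set d j" for i
    unfolding color_set_iff using m(1) s by (blast intro: less_Suc_eq_le[THEN iffD1])
  moreover have "of_nat (m (\<sigma> i)) * s (\<sigma> i) = phase_quotient \<sigma> m s i * (of_nat (m i) * s i)" for i
    using root_of_unity_nonzero[OF _ d] s by (simp add: phase_quotient_def m_\<sigma>)
  ultimately show "(\<chi> i. of_nat (m i) * s i) \<in>
      colored_fixed_vectors d j (mono_mat \<sigma> (phase_quotient \<sigma> m s))"
    by (simp add: colored_fixed_vectors_def fix_space_mono_mat[OF \<sigma>])
qed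

lemma
  assumes d: "d > 0" and \<sigma>: "\<sigma> permutes UNIV" and t: "t \<in> root_vectors d"
    and v: "v \<in> colored_fixed_vectors d j (mono_mat \<sigma> t)"
  shows colored_fixed_vector_norm_less: "nat \<lfloor>norm (v $ i)\<rfloor> < Suc j"
    and colored_fixed_vector_of_nat_norm: "complex_of_nat (nat \<lfloor>norm (v $ i)\<rfloor>) = of_real (norm (v $ i))"
    and colored_fixed_vector_sgn_power: "v $ i \<noteq> 0 \<Longrightarrow> sgn (v $ i) ^ d = 1"
    and colored_fixed_vector_norm_invariant: "norm (v $ \<sigma> i) = norm (v $ i)"
    and colored_fixed_vector_sgn_quotient: "v $ i \<noteq> 0 \<Longrightarrow> sgn (v $ \<sigma> i) / sgn (v $ i) = t i"
proof -
  have color: "v $ i \<in> color_set d j" and fixed: "v $ \<sigma> i = t i * v $ i" and t_i: "t i ^ d = 1"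
    using v t by (auto simp: colored_fixed_vectors_def fix_space_mono_mat[OF \<sigma>])
  obtain a where a: "a \<le> j" "norm (v $ i) = of_nat a" "v $ i \<noteq> 0 \<Longrightarrow> sgn (v $ i) ^ d = 1"
    using color_set_polar[OF d color] by blast
  show "nat \<lfloor>norm (v $ i)\<rfloor> < Suc j" "v $ i \<noteq> 0 \<Longrightarrow> sgn (v $ i) ^ d = 1"
    "complex_of_nat (nat \<lfloor>norm (v $ i)\<rfloor>) = of_real (norm (v $ i))"
    using a by simp_all
  show "norm (v $ \<sigma> i) = norm (v $ i)"
    by (simp add: fixed norm_mult norm_root_of_unity[OF t_i d])
  show "sgn (v $ \<sigma> i) / sgn (v $ i) = t i" if "v $ i \<noteq> 0"
    using that by (simp add: fixed Real_Vector_Spaces.sgn_mult sgn_root_of_unity[OF t_i d] sgn_zero_iff)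
qed

lemma
  assumes d: "d > 0" and \<sigma>: "\<sigma> permutes UNIV" and t: "t \<in> root_vectors d"
    and v: "v \<in> colored_fixed_vectors d j (mono_mat \<sigma> t)"
  defines "m \<equiv> \<lambda>i. nat \<lfloor>norm (v $ i)\<rfloor>" and "s \<equiv> \<lambda>i. if v $ i = 0 then t i else sgn (v $ i)"
  shows phase_quotient_of_polar: "phase_quotient \<sigma> m s = t"
    and vector_of_polar: "(\<chi> i. of_nat (m i) * s i) = v"
proof -
  have m: "complex_of_nat (m i) = of_real (norm (v $ i))" for i
    unfolding m_def by (rule colored_fixed_vector_of_nat_norm[OF d \<sigma> t v])
  then have m_0: "m i = 0 \<longleftrightarrow> v $ i = 0" for i
    by (metis norm_eq_zero of_nat_eq_0_iff of_real_eq_0_iff)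
  have v_\<sigma>: "v $ \<sigma> i = 0 \<longleftrightarrow> v $ i = 0" for i
    using colored_fixed_vector_norm_invariant[OF d \<sigma> t v, of i] by (metis norm_eq_zero)
  show "phase_quotient \<sigma> m s = t"
    using colored_fixed_vector_sgn_quotient[OF d \<sigma> t v]
    by (auto simp: phase_quotient_def m_0 s_def v_\<sigma>)
  have "of_nat (m i) * s i = v $ i" for i
    by (cases "v $ i = 0") (simp_all add: m s_def sgn_div_norm scaleR_conv_of_real)
  then show "(\<chi> i. of_nat (m i) * s i) = v" by (simp add: vec_eq_iff)
qed

lemma bij_betw_colored_fixed_vectors:
  fixes \<sigma> :: "'n::finite \<Rightarrow> 'n"
  assumes d: "d > 0" and \<sigma>: "\<sigma> permutes UNIV"
  shows "bij_betw (\<lambda>(m, s). (phase_quotient \<sigma> m s, \<chi> i. of_nat (m i) * s i))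
    ({m. (\<forall>i. m i < Suc j) \<and> m \<circ> \<sigma> = m} \<times> root_vectors d)
    (SIGMA t:root_vectors d. colored_fixed_vectors d j (mono_mat \<sigma> t))"
  (is "bij_betw ?f ?A ?B")
proof (rule bij_betwI)
  let ?g = "\<lambda>(t, v). (\<lambda>i. nat \<lfloor>norm (v $ i)\<rfloor>, \<lambda>i. if v $ i = 0 then t i else sgn (v $ i))"
  show "?f \<in> ?A \<rightarrow> ?B"
  proof
    fix x assume "x \<in> ?A"
    then obtain m s where x: "x = (m, s)" and m: "\<forall>i. m i < Suc j" "m \<circ> \<sigma> = m"
      and s: "s \<in> root_vectors d"
      by blast
    show "?f x \<in> ?B"
      using phase_quotient_in_root_vectors[OF d \<sigma> m s] polar_in_colored_fixed_vectors[OF d \<sigma> m s]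
      by (simp add: x)
  qed
  show "?g \<in> ?B \<rightarrow> ?A"
  proof
    fix y assume "y \<in> ?B"
    then obtain t v where y: "y = (t, v)" and t: "t \<in> root_vectors d"
      and v: "v \<in> colored_fixed_vectors d j (mono_mat \<sigma> t)" by blast
    have "snd (?g y) i ^ d = 1" for i
      using t colored_fixed_vector_sgn_power[OF d \<sigma> t v] by (simp add: y)
    then show "?g y \<in> ?A"
      using colored_fixed_vector_norm_less[OF d \<sigma> t v] colored_fixed_vector_norm_invariant[OF d \<sigma> t v]
      by (simp add: y fun_eq_iff)
  qed
  show "?g (?f x) = x" if "x \<in> ?A" for x
  proof -
    obtain m s where x: "x = (m, s)" by (cases x)
    have s: "s i \<noteq> 0" "norm (s i) = 1" for i
      using that root_of_unity_nonzero[OF _ d] norm_root_of_unity[OF _ d] by (auto simp: x)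
    then have "sgn (of_nat (m i) * s i) = s i" if "m i \<noteq> 0" for i
      using that by (simp add: sgn_div_norm norm_mult scaleR_conv_of_real)
    then show ?thesis using s by (auto simp: x fun_eq_iff norm_mult phase_quotient_def)
  qed
  show "?f (?g y) = y" if "y \<in> ?B" for y
  proof -
    obtain t v where y: "y = (t, v)" and t: "t \<in> root_vectors d"
      and v: "v \<in> colored_fixed_vectors d j (mono_mat \<sigma> t)"
      using \<open>y \<in> ?B\<close> by blast
    show ?thesis
      unfolding y prod.case phase_quotient_of_polar[OF d \<sigma> t v] vector_of_polar[OF d \<sigma> t v] ..
  qed
qed

section \<open>From monomial matrices to permutations\<close>

definition root_mean :: "nat \<Rightarrow> (complex \<Rightarrow> rat) \<Rightarrow> rat" where
  "root_mean d \<psi> = (\<Sum>z | z ^ d = 1. \<psi> z) / of_nat d"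

lemma root_mean_shift:
  assumes "d > 0" "(a :: complex) ^ d = 1"
  shows "root_mean d (\<lambda>z. \<psi> (a * z)) = root_mean d \<psi>"
proof -
  have "bij_betw (\<lambda>z. a * z) {z. z ^ d = 1} {z. z ^ d = 1}"
    using assms root_of_unity_nonzero[OF assms(2,1)]
    by (intro bij_betwI[where g = "\<lambda>z. z / a"]) (auto simp: power_mult_distrib power_divide)
  from sum.reindex_bij_betw[OF this, of \<psi>] show ?thesis by (simp add: root_mean_def)
qed

lemma root_mean_const: "d > 0 \<Longrightarrow> root_mean d (\<lambda>_. c) = c"
  by (simp add: root_mean_def card_roots_unity_eq)

lemma sum_root_vectors_shift:
  fixes Z :: "'n::finite set"
  assumes a: "a ^ d = 1" "a \<noteq> 0" and z: "z \<in> Z"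
  shows "(\<Sum>s\<in>root_vectors d. \<psi> ((\<Prod>i\<in>Z. s i) * a)) = (\<Sum>s\<in>root_vectors d. \<psi> (\<Prod>i\<in>Z. s i))"
proof -
  have "bij_betw (\<lambda>s. s(z := s z * a)) (root_vectors d) (root_vectors d :: ('n \<Rightarrow> complex) set)"
    using a by (intro bij_betwI[where g = "\<lambda>s. s(z := s z / a)"])
      (auto simp: power_mult_distrib power_divide fun_eq_iff)
  moreover have "(\<Prod>i\<in>Z. (s(z := s z * a)) i) = (\<Prod>i\<in>Z. s i) * a" for s :: "'n \<Rightarrow> complex"
    using z by (simp add: prod.remove[of Z z] mult_ac)
  ultimately show ?thesis
    using sum.reindex_bij_betw[of "\<lambda>s. s(z := s z * a)" "root_vectors d" "root_vectors d"
        "\<lambda>s. \<psi> (\<Prod>i\<in>Z. s i)"] by simp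
qed

lemma sum_root_vectors_prod:
  fixes Z :: "'n::finite set"
  assumes d: "d > 0"
  shows "(\<Sum>s\<in>root_vectors d. \<psi> (\<Prod>i\<in>Z. s i)) =
    of_nat (d ^ CARD('n)) * (if Z = {} then \<psi> 1 else root_mean d \<psi>)"
proof (cases "Z = {}")
  case True
  then show ?thesis using card_root_vectors[OF d, where 'n = 'n] by simp
next
  case False
  then obtain z where z: "z \<in> Z" by blast
  let ?R = "root_vectors d :: ('n \<Rightarrow> complex) set"
  have "of_nat d * (\<Sum>s\<in>?R. \<psi> (\<Prod>i\<in>Z. s i)) = (\<Sum>a | a ^ d = 1. \<Sum>s\<in>?R. \<psi> ((\<Prod>i\<in>Z. s i) * a))"
    using sum_root_vectors_shift[OF _ root_of_unity_nonzero[OF _ d] z, where \<psi> = \<psi>]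
    by (simp add: card_roots_unity_eq[OF d])
  also have "\<dots> = (\<Sum>s\<in>?R. \<Sum>a | a ^ d = 1. \<psi> ((\<Prod>i\<in>Z. s i) * a))"
    by (rule sum.swap)
  also have "\<dots> = (\<Sum>s\<in>?R. of_nat d * root_mean d \<psi>)"
  proof (intro sum.cong refl)
    fix s :: "'n \<Rightarrow> complex" assume "s \<in> ?R"
    then have "(\<Prod>i\<in>Z. s i) ^ d = 1" by (simp add: prod_power_distrib)
    from root_mean_shift[OF d this, of \<psi>]
    show "(\<Sum>a | a ^ d = 1. \<psi> ((\<Prod>i\<in>Z. s i) * a)) = of_nat d * root_mean d \<psi>"
      using d by (simp add: root_mean_def field_simps)
  qed
  also have "\<dots> = of_nat d * (of_nat (d ^ CARD('n)) * root_mean d \<psi>)"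
    using card_root_vectors[OF d, where 'n = 'n] by simp
  finally show ?thesis using d False by simp
qed

lemma prod_phase_quotient:
  fixes s :: "'n::finite \<Rightarrow> complex"
  assumes \<sigma>: "\<sigma> permutes UNIV" and m: "m \<circ> \<sigma> = m" and nonzero: "\<And>i. s i \<noteq> 0"
  shows "(\<Prod>i\<in>UNIV. phase_quotient \<sigma> m s i) = (\<Prod>i | m i = 0. s i)"
proof -
  have m_\<sigma>: "m (\<sigma> i) = m i" for i using m by (metis comp_apply)
  have "m (inv_into UNIV \<sigma> i) = m i" for i
    using m_\<sigma>[of "inv_into UNIV \<sigma> i"] by (simp add: permutes_inverses[OF \<sigma>])
  then have "bij_betw \<sigma> {i. m i \<noteq> 0} {i. m i \<noteq> 0}"
    by (intro bij_betwI[where g = "inv_into UNIV \<sigma>"]) (auto simp: m_\<sigma> permutes_inverses[OF \<sigma>])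
  from prod.reindex_bij_betw[OF this, of s]
  have "(\<Prod>i | m i \<noteq> 0. s (\<sigma> i) / s i) = 1"
    using nonzero by (simp add: prod_dividef)
  moreover have "- {i. m i = 0} = {i. m i \<noteq> 0}" by auto
  ultimately show ?thesis
    using prod.If_cases[of UNIV "\<lambda>i. m i = 0" s "\<lambda>i. s (\<sigma> i) / s i"] by (simp add: phase_quotient_def)
qed

lemma card_positive_invariant_colorings:
  "card {m. (\<forall>i. m i < Suc j) \<and> m \<circ> \<sigma> = m \<and> (\<forall>i. m i \<noteq> 0)} = invariant_colorings j \<sigma>"
  unfolding invariant_colorings_def
proof (rule bij_betw_same_card, rule bij_betwI[where f = "\<lambda>m i. m i - 1" and g = "\<lambda>m i. Suc (m i)"])
  show "(\<lambda>m i. m i - 1) \<in> {m. (\<forall>i. m i < Suc j) \<and> m \<circ> \<sigma> = m \<and> (\<forall>i. m i \<noteq> 0)} \<rightarrow>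
      {f. (\<forall>x. f x < j) \<and> f \<circ> \<sigma> = f}"
  proof (intro Pi_I CollectI conjI allI)
    fix m i assume m: "m \<in> {m. (\<forall>i. m i < Suc j) \<and> m \<circ> \<sigma> = m \<and> (\<forall>i. m i \<noteq> 0)}"
    then have "m i < Suc j" "m i \<noteq> 0" by blast+
    then show "m i - 1 < j" by linarith
    show "(\<lambda>i. m i - 1) \<circ> \<sigma> = (\<lambda>i. m i - 1)" using m by (auto simp: fun_eq_iff)
  qed
qed (auto simp: fun_eq_iff)

theorem sum_fix_weight:
  fixes \<sigma> :: "'n::finite \<Rightarrow> 'n"
  assumes d: "d > 0" and \<sigma>: "\<sigma> permutes UNIV"
  shows "(\<Sum>t\<in>root_vectors d. fix_weight d j (mono_mat \<sigma> t) * \<psi> (\<Prod>i\<in>UNIV. t i)) =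
    of_nat (d ^ CARD('n)) * (of_nat (invariant_colorings (Suc j) \<sigma>) * root_mean d \<psi> +
      of_nat (invariant_colorings j \<sigma>) * (\<psi> 1 - root_mean d \<psi>))"
proof -
  let ?R = "root_vectors d :: ('n \<Rightarrow> complex) set"
  let ?M = "{m. (\<forall>i. m i < Suc j) \<and> m \<circ> \<sigma> = m}"
  have finite_M: "finite ?M"
    by (rule finite_subset[of _ "PiE UNIV (\<lambda>_. {..<Suc j})"]) (auto intro: finite_PiE)
  have "(\<Sum>t\<in>?R. fix_weight d j (mono_mat \<sigma> t) * \<psi> (\<Prod>i\<in>UNIV. t i)) =
      (\<Sum>t\<in>?R. \<Sum>v\<in>colored_fixed_vectors d j (mono_mat \<sigma> t). \<psi> (\<Prod>i\<in>UNIV. t i))"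
    by (intro sum.cong refl) (simp add: fix_weight_def card_colored_fixed_vectors[OF d \<sigma>])
  also have "\<dots> = (\<Sum>(t, v)\<in>(SIGMA t:?R. colored_fixed_vectors d j (mono_mat \<sigma> t)). \<psi> (\<Prod>i\<in>UNIV. t i))"
    by (rule sum.Sigma) (auto intro: finite_root_vectors[OF d] finite_colored_fixed_vectors[OF d \<sigma>])
  also have "\<dots> = (\<Sum>(m, s)\<in>?M \<times> ?R. \<psi> (\<Prod>i\<in>UNIV. phase_quotient \<sigma> m s i))"
    using sum.reindex_bij_betw[OF bij_betw_colored_fixed_vectors[OF d \<sigma>, where j = j],
        of "\<lambda>(t, v). \<psi> (\<Prod>i\<in>UNIV. t i)"]
    by (simp add: case_prod_unfold)
  also have "\<dots> = (\<Sum>m\<in>?M. \<Sum>s\<in>?R. \<psi> (\<Prod>i | m i = 0. s i))"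
    unfolding sum.cartesian_product[symmetric]
    by (intro sum.cong refl arg_cong[where f = \<psi>] prod_phase_quotient[OF \<sigma>])
      (auto dest: root_of_unity_nonzero[OF _ d])
  also have "\<dots> = (\<Sum>m\<in>?M. of_nat (d ^ CARD('n)) *
      (root_mean d \<psi> + of_bool (\<forall>i. m i \<noteq> 0) * (\<psi> 1 - root_mean d \<psi>)))"
    unfolding sum_root_vectors_prod[OF d] by (intro sum.cong refl) auto
  also have "\<dots> = of_nat (d ^ CARD('n)) * (of_nat (card ?M) * root_mean d \<psi> +
      of_nat (card (?M \<inter> {m. \<forall>i. m i \<noteq> 0})) * (\<psi> 1 - root_mean d \<psi>))"
    using finite_M
    by (simp add: sum_distrib_left[symmetric] sum.distrib sum_distrib_right[symmetric] sum_of_bool_eq)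
  also have "?M \<inter> {m. \<forall>i. m i \<noteq> 0} = {m. (\<forall>i. m i < Suc j) \<and> m \<circ> \<sigma> = m \<and> (\<forall>i. m i \<noteq> 0)}" by auto
  finally show ?thesis
    unfolding card_positive_invariant_colorings by (simp only: invariant_colorings_def)
qed

lemma word_sum_Gd1n_eq_perm_group:
  fixes D :: "('n::finite \<Rightarrow> 'n) \<Rightarrow> 'c::comm_semiring_1"
  assumes d: "d > 0"
    and eigen: "\<And>j \<sigma> a. \<sigma> permutes UNIV \<Longrightarrow> a ^ d = 1 \<Longrightarrow>
      (\<Sum>t\<in>root_vectors d. w j (mono_mat \<sigma> t) * \<psi> (a * (\<Prod>i\<in>UNIV. t i))) = v j \<sigma> * \<psi> a"
  shows "word_sum (Gd1n d) w js (\<lambda>A. D (perm_of A) * \<psi> (color_of A)) =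
    word_sum perm_group v js D * \<psi> 1"
proof -
  have "word_sum (Gd1n d) w js (\<lambda>A. D (perm_of A) * \<psi> (a * color_of A)) =
      word_sum perm_group v js D * \<psi> a"
    if "a ^ d = 1" for a
    using that
  proof (induction js arbitrary: D a)
    case Nil
    show ?case by (simp add: perm_of_one color_of_one)
  next
    case (Cons j js)
    define W where "W \<sigma> = word_sum perm_group v js (\<lambda>\<tau>. D (\<sigma> \<circ> \<tau>))" for \<sigma>
    have letter: "word_sum (Gd1n d) w js
          (\<lambda>B. D (perm_of (mono_mat \<sigma> t ** B)) * \<psi> (a * color_of (mono_mat \<sigma> t ** B))) =
        W \<sigma> * \<psi> (a * (\<Prod>i\<in>UNIV. t i))"
      if \<sigma>: "\<sigma> permutes UNIV" and t: "t \<in> root_vectors d" for \<sigma> t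
    proof -
      have nonzero: "t i \<noteq> 0" for i using t root_of_unity_nonzero[OF _ d] by auto
      have "word_sum (Gd1n d) w js
            (\<lambda>B. D (perm_of (mono_mat \<sigma> t ** B)) * \<psi> (a * color_of (mono_mat \<sigma> t ** B))) =
          word_sum (Gd1n d) w js (\<lambda>B. D (\<sigma> \<circ> perm_of B) * \<psi> (a * (\<Prod>i\<in>UNIV. t i) * color_of B))"
        by (rule word_sum_cong[OF monoid_Gd1n[OF d]])
          (simp add: perm_of_mult[OF d mono_mat_in_carrier[OF d \<sigma> t]] perm_of_mono_mat[OF nonzero]
            color_of_mult[OF d mono_mat_in_carrier[OF d \<sigma> t]] color_of_mono_mat[OF nonzero] mult.assoc)
      also have "\<dots> = W \<sigma> * \<psi> (a * (\<Prod>i\<in>UNIV. t i))"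
        unfolding W_def using t Cons.prems
        by (intro Cons.IH) (simp add: power_mult_distrib prod_power_distrib)
      finally show ?thesis .
    qed
    have "word_sum (Gd1n d) w (j # js) (\<lambda>A. D (perm_of A) * \<psi> (a * color_of A)) =
        (\<Sum>\<sigma> | \<sigma> permutes UNIV. W \<sigma> *
          (\<Sum>t\<in>root_vectors d. w j (mono_mat \<sigma> t) * \<psi> (a * (\<Prod>i\<in>UNIV. t i))))"
      unfolding word_sum.simps Gd1n_simps sum_carrier_Gd1n[OF d] sum_distrib_left
      by (intro sum.cong refl) (subst letter, simp_all only: mem_Collect_eq mult.left_commute simp_thms)
    also have "\<dots> = (\<Sum>\<sigma> | \<sigma> permutes UNIV. v j \<sigma> * W \<sigma>) * \<psi> a"
      by (simp add: eigen Cons.prems sum_distrib_left mult_ac)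
    finally show ?case by (simp add: W_def)
  qed
  from this[of 1] show ?thesis by simp
qed

lemma word_sum_fix_weight:
  fixes D :: "('n::finite \<Rightarrow> 'n) \<Rightarrow> rat"
  assumes d: "d > 0"
  shows "word_sum (Gd1n d) (fix_weight d) js (\<lambda>A. D (perm_of A)) =
    word_sum perm_group (\<lambda>j \<tau>. of_nat (d ^ CARD('n)) * of_nat (invariant_colorings (Suc j) \<tau>)) js D"
proof -
  have "(\<Sum>t\<in>root_vectors d. fix_weight d j (mono_mat \<sigma> t) * 1) =
      of_nat (d ^ CARD('n)) * of_nat (invariant_colorings (Suc j) \<sigma>) * 1"
    if "\<sigma> permutes UNIV" for j and \<sigma> :: "'n \<Rightarrow> 'n"
    using sum_fix_weight[OF d that, of j "\<lambda>_. 1"] by (simp add: root_mean_const[OF d])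
  from word_sum_Gd1n_eq_perm_group[where \<psi> = "\<lambda>_. 1" and D = D, OF d this] show ?thesis by simp
qed

lemma word_sum_fix_weight_mean_0:
  fixes D :: "('n::finite \<Rightarrow> 'n) \<Rightarrow> rat"
  assumes d: "d > 0" and \<psi>: "root_mean d \<psi> = 0"
  shows "word_sum (Gd1n d) (fix_weight d) js (\<lambda>A. D (perm_of A) * \<psi> (color_of A)) =
    word_sum perm_group (\<lambda>j \<tau>. of_nat (d ^ CARD('n)) * of_nat (invariant_colorings j \<tau>)) js D * \<psi> 1"
proof (rule word_sum_Gd1n_eq_perm_group[OF d])
  fix j and a :: complex and \<sigma> :: "'n \<Rightarrow> 'n" assume \<sigma>: "\<sigma> permutes UNIV" and a: "a ^ d = 1"
  show "(\<Sum>t\<in>root_vectors d. fix_weight d j (mono_mat \<sigma> t) * \<psi> (a * (\<Prod>i\<in>UNIV. t i))) =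
      of_nat (d ^ CARD('n)) * of_nat (invariant_colorings j \<sigma>) * \<psi> a"
    using sum_fix_weight[OF d \<sigma>, of j "\<lambda>z. \<psi> (a * z)"] by (simp add: root_mean_shift[OF d a] \<psi>)
qed

lemma alternating_sum_eq_forward_difference:
  "(\<Sum>l\<le>n. (-1) ^ l * of_nat (n choose l) * F l) = (-1) ^ n * forward_difference n F"
  by (simp add: forward_difference_def sum_distrib_left power_add mult.assoc)

lemma alternating_sum_telescope:
  "(\<Sum>l\<le>m. (-1) ^ l * of_nat (m choose l) * (F l - F (Suc l))) =
   (\<Sum>t\<le>Suc m. (-1) ^ t * of_nat (Suc m choose t) * (F t :: 'a::comm_ring_1))"
proof -
  have "forward_difference m (\<lambda>l. F l - F (Suc l)) = - forward_difference (Suc m) F"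
    unfolding forward_difference_Suc
    using forward_difference_add[of m F "\<lambda>l. (-1) * F (Suc l)"]
      forward_difference_scale[of m "-1" "\<lambda>l. F (Suc l)"]
    by simp
  then show ?thesis unfolding alternating_sum_eq_forward_difference by simp
qed

lemma word_sum_color_eq_diff:
  fixes D :: "('n::finite \<Rightarrow> 'n) \<Rightarrow> rat"
  assumes d: "d > 0" and \<omega>: "\<omega> ^ d = 1" "\<omega> \<noteq> 1"
  defines "g \<equiv> of_nat (d ^ CARD('n))"
  shows "of_nat d * word_sum (Gd1n d) (fix_weight d) js (\<lambda>A. D (perm_of A) * of_bool (color_of A = \<omega>)) =
    word_sum perm_group (\<lambda>j \<tau>. g * of_nat (invariant_colorings (Suc j) \<tau>)) js D -
    word_sum perm_group (\<lambda>j \<tau>. g * of_nat (invariant_colorings j \<tau>)) js D"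
proof -
  define \<psi> :: "complex \<Rightarrow> rat" where "\<psi> z = of_bool (z = \<omega>) - 1 / of_nat d" for z
  let ?W = "word_sum (Gd1n d :: 'n cmat_group) (fix_weight d) js"
  have "(\<Sum>z | z ^ d = 1. of_bool (z = \<omega>) :: rat) = 1"
    using \<omega>(1) finite_nth_roots[OF d, of 1] by (simp add: Int_def cong: conj_cong)
  then have mean: "root_mean d \<psi> = 0"
    using d by (simp add: root_mean_def \<psi>_def sum_subtractf card_roots_unity_eq)
  have "of_nat d * ?W (\<lambda>A. D (perm_of A) * of_bool (color_of A = \<omega>)) =
      ?W (\<lambda>A. D (perm_of A) + of_nat d * (D (perm_of A) * \<psi> (color_of A)))"
    unfolding word_sum_scale[symmetric] using d
    by (intro arg_cong[where f = "word_sum _ _ _"] ext) (simp add: \<psi>_def field_simps)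
  also have "\<dots> = ?W (\<lambda>A. D (perm_of A)) + of_nat d * ?W (\<lambda>A. D (perm_of A) * \<psi> (color_of A))"
    unfolding word_sum_add word_sum_scale ..
  also have "?W (\<lambda>A. D (perm_of A)) =
      word_sum perm_group (\<lambda>j \<tau>. g * of_nat (invariant_colorings (Suc j) \<tau>)) js D"
    unfolding g_def by (rule word_sum_fix_weight[OF d])
  also have "?W (\<lambda>A. D (perm_of A) * \<psi> (color_of A)) =
      word_sum perm_group (\<lambda>j \<tau>. g * of_nat (invariant_colorings j \<tau>)) js D * \<psi> 1"
    unfolding g_def by (rule word_sum_fix_weight_mean_0[OF d mean])
  finally show ?thesis using d \<omega>(2) by (simp add: \<psi>_def)
qed

theorem word_sum_cyclic_color:
  fixes n d :: nat
  defines "n \<equiv> CARD('n::finite)"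
  assumes d: "d > 0" and \<omega>: "\<omega> ^ d = 1" "\<omega> \<noteq> 1"
  shows "of_nat (n * d) * word_sum (Gd1n d :: 'n cmat_group) (fix_weight d) js
      (\<lambda>A. of_bool (cyclic_on (perm_of A) UNIV) * of_bool (color_of A = \<omega>)) =
    of_nat (order (Gd1n d :: 'n cmat_group)) ^ length js *
    (\<Sum>t\<le>n. (-1) ^ t * of_nat (n choose t) * (\<Prod>j\<leftarrow>js. of_nat ((j + n - t) choose n)))"
    (is "of_nat (n * d) * ?W = _")
proof -
  define C :: "('n \<Rightarrow> 'n) \<Rightarrow> rat" where "C = (\<lambda>\<sigma>. of_bool (cyclic_on \<sigma> UNIV))"
  define P where "P y = word_sum (perm_group :: ('n \<Rightarrow> 'n) monoid)
    (\<lambda>j \<tau>. of_nat (d ^ n) * of_nat (invariant_colorings (y j) \<tau>)) js C" for y :: "nat \<Rightarrow> nat"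
  define g where "g = rat_of_nat (order (Gd1n d :: 'n cmat_group))"
  define F where "F t = (\<Prod>j\<leftarrow>js. g * rat_of_nat ((j + n - t) choose n))" for t
  have g: "g = of_nat (d ^ n) * fact n" by (simp add: g_def order_Gd1n[OF d] n_def)
  obtain m where m: "n = Suc m" unfolding n_def by (metis Suc_pred zero_less_card_finite)
  have P: "of_nat n * P y = (\<Sum>l\<le>m. (-1) ^ l * of_nat (m choose l) *
      (\<Prod>j\<leftarrow>js. g * of_nat ((y j + m - l) choose n)))" for y
  proof -
    have "n - 1 = m" "y j + n - 1 - l = y j + m - l" for j l by (simp_all add: m)
    then show ?thesis
      using word_sum_cyclic_invariant_colorings[where 'n = 'n, of "of_nat (d ^ n)" y js,
          folded n_def C_def]
      unfolding P_def mult.assoc[symmetric] g[symmetric] by (simp only:)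
  qed
  have "of_nat d * ?W = P Suc - P (\<lambda>j. j)"
    using word_sum_color_eq_diff[OF d \<omega>, of js C] unfolding P_def n_def C_def .
  then have "of_nat (n * d) * ?W = of_nat n * P Suc - of_nat n * P (\<lambda>j. j)"
    by (simp only: of_nat_mult mult.assoc right_diff_distrib)
  also have "\<dots> = (\<Sum>l\<le>m. (-1) ^ l * of_nat (m choose l) * (F l - F (Suc l)))"
    unfolding P F_def sum_subtractf[symmetric] right_diff_distrib by (simp add: m)
  also have "\<dots> = (\<Sum>t\<le>n. (-1) ^ t * of_nat (n choose t) * F t)"
    unfolding m by (rule alternating_sum_telescope)
  finally have evaluated: "of_nat (n * d) * ?W = (\<Sum>t\<le>n. (-1) ^ t * of_nat (n choose t) * F t)" .
  have "F t = g ^ length js * (\<Prod>j\<leftarrow>js. of_nat ((j + n - t) choose n))" for t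
    unfolding F_def by (induction js) (simp_all add: mult_ac)
  then show ?thesis
    unfolding evaluated g_def[symmetric] by (simp add: sum_distrib_left mult_ac)
qed

section \<open>Regular eigenvectors\<close>

lemma dim_linear_relation:
  fixes i j :: "'n::finite" and z :: "'a::field"
  assumes "i \<noteq> j \<or> z = 0"
  shows "vec.dim {v :: 'a ^ 'n. v $ i = z * v $ j} = CARD('n) - 1"
proof -
  let ?\<rho> = "id(i := j)" and ?b = "(\<lambda>_. 1)(i := z)"
  have "{v :: 'a ^ 'n. v $ i = z * v $ j} = tied_space ?\<rho> ?b"
    by (auto simp: tied_space_def)
  moreover have "tying ?\<rho> ?b" using assms by (auto simp: tying_def)
  moreover have "free_coordinates ?\<rho> ?b = - {i}"
    using assms by (auto simp: free_coordinates_def)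
  ultimately show ?thesis
    by (simp add: dim_tied_space Compl_eq_Diff_UNIV card_Diff_subset)
qed

lemma reflectionI:
  fixes \<sigma> :: "'n::finite \<Rightarrow> 'n"
  assumes d: "d > 0" and \<sigma>: "\<sigma> permutes UNIV" and t: "t \<in> root_vectors d"
    and hyperplane: "fix_space (mono_mat \<sigma> t) = {v. v $ i = z * v $ j}" "i \<noteq> j \<or> z = 0"
  shows "mono_mat \<sigma> t \<in> reflections (Gd1n d)"
  unfolding reflections_def
  using mono_mat_in_carrier[OF d \<sigma> t] dim_linear_relation[OF hyperplane(2)] by (simp add: hyperplane(1))

lemma coordinate_reflection_exists:
  fixes i :: "'n::finite"
  assumes d: "d \<ge> 2"
  obtains A where "A \<in> reflections (Gd1n d)" "fix_space A = {v. v $ i = 0}"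
proof -
  have "card {z::complex. z ^ d = 1} \<noteq> card {1::complex}"
    using card_roots_unity_eq[of d] d by simp
  then obtain w :: complex where w: "w ^ d = 1" "w \<noteq> 1"
    by (metis (mono_tags, lifting) Collect_cong power_one singleton_conv)
  let ?t = "(\<lambda>_. 1)(i := w)"
  have "fix_space (mono_mat id ?t) = {v. v $ i = 0 * v $ i}"
    using w(2) by (auto simp: fix_space_mono_mat[OF permutes_id]) metis
  moreover from this have "mono_mat id ?t \<in> reflections (Gd1n d)"
    using d w(1) by (intro reflectionI[where i = i and j = i and z = 0] permutes_id) auto
  ultimately show ?thesis using that by simp
qed

lemma transposition_reflection_exists:
  fixes i j :: "'n::finite"
  assumes d: "d > 0" and z: "z ^ d = 1" and ij: "i \<noteq> j"
  obtains A where "A \<in> reflections (Gd1n d)" "fix_space A = {v. v $ i = z * v $ j}"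
proof -
  have z0: "z \<noteq> 0" using root_of_unity_nonzero[OF z d] .
  let ?\<sigma> = "Transposition.transpose i j" and ?t = "(\<lambda>_. 1)(i := 1 / z, j := z)"
  have \<sigma>: "?\<sigma> permutes UNIV" by (intro permutes_swap_id) auto
  have "(\<forall>k. v $ ?\<sigma> k = ?t k * v $ k) \<longleftrightarrow> v $ i = z * v $ j" for v
  proof
    assume "\<forall>k. v $ ?\<sigma> k = ?t k * v $ k"
    then have "v $ ?\<sigma> j = ?t j * v $ j" by blast
    then show "v $ i = z * v $ j" using ij by simp
  next
    assume "v $ i = z * v $ j"
    then show "\<forall>k. v $ ?\<sigma> k = ?t k * v $ k"
      using ij z0 by (auto simp: Transposition.transpose_def)
  qed
  then have "fix_space (mono_mat ?\<sigma> ?t) = {v. v $ i = z * v $ j}"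
    by (simp add: set_eq_iff fix_space_mono_mat[OF \<sigma>])
  moreover from this have "mono_mat ?\<sigma> ?t \<in> reflections (Gd1n d)"
    using z ij by (intro reflectionI[OF d \<sigma>, where i = i and j = j and z = z]) (auto simp: power_divide)
  ultimately show ?thesis using that by blast
qed

lemma stabilizer_trivial:
  fixes v :: "complex ^ 'n::finite"
  assumes d: "d > 0" and v: "\<And>i. v $ i \<noteq> 0" "inj (\<lambda>i. (v $ i) ^ d)"
    and A: "A \<in> carrier (Gd1n d)" "v \<in> fix_space A"
  shows "A = mat 1"
proof -
  obtain \<sigma> t where At: "A = mono_mat \<sigma> t" and \<sigma>: "\<sigma> permutes UNIV" and t: "t \<in> root_vectors d"
    using carrier_Gd1nE[OF d A(1)] by blast
  have fixed: "v $ \<sigma> j = t j * v $ j" for j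
    using A(2) unfolding At fix_space_mono_mat[OF \<sigma>] by blast
  have \<sigma>_id: "\<sigma> j = j" for j
    by (rule injD[OF v(2)]) (use t in \<open>simp add: fixed power_mult_distrib\<close>)
  then have "t j = 1" for j using fixed[of j] v(1)[of j] by simp
  then have "\<sigma> = id" "t = (\<lambda>_. 1)" using \<sigma>_id by auto
  then show ?thesis unfolding At by (simp only: mono_mat_id)
qed

theorem avoids_reflections_iff:
  fixes v :: "complex ^ 'n::finite"
  assumes d: "d \<ge> 2"
  shows "(\<forall>t\<in>reflections (Gd1n d). v \<notin> fix_space t) \<longleftrightarrow>
    (\<forall>i. v $ i \<noteq> 0) \<and> inj (\<lambda>i. (v $ i) ^ d)"
    (is "?avoids \<longleftrightarrow> ?nonzero \<and> ?inj")
proof (intro iffI conjI)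
  have d0: "d > 0" using d by simp
  assume avoids: ?avoids
  show nonzero: ?nonzero
  proof
    fix i :: 'n
    obtain A where "A \<in> reflections (Gd1n d)" "fix_space A = {v. v $ i = 0}"
      using coordinate_reflection_exists[OF d] by blast
    then show "v $ i \<noteq> 0" using avoids by auto
  qed
  show ?inj
  proof (rule injI, rule ccontr)
    fix i j :: 'n assume powers: "(v $ i) ^ d = (v $ j) ^ d" and "i \<noteq> j"
    have "(v $ i / v $ j) ^ d = 1" using powers nonzero by (simp add: power_divide)
    then obtain A where "A \<in> reflections (Gd1n d)" "fix_space A = {u. u $ i = (v $ i / v $ j) * u $ j}"
      using transposition_reflection_exists[OF d0 _ \<open>i \<noteq> j\<close>] by metis
    then show False using avoids nonzero by auto
  qed
next
  assume coordinates: "?nonzero \<and> ?inj"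
  show ?avoids
  proof (intro ballI notI)
    fix A :: "complex ^ 'n ^ 'n"
    assume A: "A \<in> reflections (Gd1n d)" and "v \<in> fix_space A"
    then have "A = mat 1"
      using coordinates d by (intro stabilizer_trivial[of d v]) (auto simp: reflections_def)
    then have "fix_space A = UNIV" by (simp add: fix_space_def)
    then have "vec.dim (fix_space A) = CARD('n)" by (simp only: vec_dim_card)
    then show False using A unfolding reflections_def by simp
  qed
qed

lemma mono_mat_eigenvalue_power:
  fixes v :: "'a::field ^ 'n::finite"
  assumes \<sigma>: "\<sigma> permutes UNIV" and eigen: "mono_mat \<sigma> t *v v = l *s v"
    and nonzero: "\<And>i. v $ i \<noteq> 0" and B: "bij_betw \<sigma> B B"
  shows "l ^ card B = (\<Prod>i\<in>B. t i)"
proof -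
  have relation: "t i * v $ i = l * v $ \<sigma> i" for i
    using eigen unfolding mono_mat_eigenvector_iff[OF \<sigma>] by blast
  have "(\<Prod>i\<in>B. t i) * (\<Prod>i\<in>B. v $ i) = l ^ card B * (\<Prod>i\<in>B. v $ \<sigma> i)"
    unfolding prod.distrib[symmetric] relation by (simp add: prod.distrib)
  also have "(\<Prod>i\<in>B. v $ \<sigma> i) = (\<Prod>i\<in>B. v $ i)"
    by (rule prod.reindex_bij_betw[OF B])
  finally show ?thesis using nonzero by simp
qed

lemma
  fixes v :: "complex ^ 'n::finite"
  assumes d: "d \<ge> 2" and A: "A \<in> carrier (Gd1n d)" and regular: "regular_eigenpair (Gd1n d) A l v"
  shows regular_eigenvalue_power_card: "l ^ CARD('n) = color_of A"
    and regular_eigenvalue_power_orbit: "l ^ (d * card (orbit (perm_of A) i)) = 1"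
proof -
  have d0: "d > 0" using d by simp
  obtain \<sigma> t where At: "A = mono_mat \<sigma> t" and \<sigma>: "\<sigma> permutes UNIV" and t: "t \<in> root_vectors d"
    and perm: "perm_of A = \<sigma>" and color: "color_of A = (\<Prod>j\<in>UNIV. t j)"
    using carrier_Gd1nE[OF d0 A] by blast
  have eigen: "mono_mat \<sigma> t *v v = l *s v" and nonzero: "v $ j \<noteq> 0" for j
    using regular avoids_reflections_iff[OF d, of v] by (auto simp: regular_eigenpair_def At)
  show "l ^ CARD('n) = color_of A"
    unfolding color using permutes_bij[OF \<sigma>] by (intro mono_mat_eigenvalue_power[OF \<sigma> eigen nonzero])
  let ?O = "orbit \<sigma> i"
  have "cyclic_on \<sigma> ?O" using cyclic_on_orbit[OF \<sigma> finite] .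
  then have "\<sigma> ` ?O \<subseteq> ?O" by (auto dest: cyclic_on_inI)
  then have "bij_betw \<sigma> ?O ?O"
    using permutes_inj_on[OF \<sigma>] by (simp add: bij_betw_def endo_inj_surj)
  then have "l ^ card ?O = (\<Prod>j\<in>?O. t j)" by (rule mono_mat_eigenvalue_power[OF \<sigma> eigen nonzero])
  then have "l ^ (d * card ?O) = (\<Prod>j\<in>?O. t j ^ d)"
    by (simp add: power_mult[of l "card ?O" d] mult.commute[of d] prod_power_distrib)
  then show "l ^ (d * card (orbit (perm_of A) i)) = 1" using t by (simp add: perm)
qed

lemma color_of_power:
  assumes "d > 0" "A \<in> carrier (Gd1n d)"
  shows "color_of A ^ d = 1"
proof (rule carrier_Gd1nE[OF assms])
  fix t assume "t \<in> root_vectors d" "color_of A = (\<Prod>j\<in>UNIV. t j)"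
  then show "color_of A ^ d = 1" by (simp add: prod_power_distrib)
qed

section \<open>Coxeter elements\<close>

lemma primitive_root_of_unity_dvd:
  assumes "primitive_root_of_unity m z"
  shows "z ^ k = 1 \<longleftrightarrow> m dvd k"
proof -
  have m: "m > 0" "z ^ m = 1" "\<And>j. 0 < j \<Longrightarrow> j < m \<Longrightarrow> z ^ j \<noteq> 1"
    using assms by (auto simp: primitive_root_of_unity_def)
  have "z ^ k = z ^ (m * (k div m) + k mod m)" by simp
  also have "\<dots> = z ^ (k mod m)" unfolding power_add power_mult m(2) by simp
  finally have "z ^ k = 1 \<longleftrightarrow> z ^ (k mod m) = 1" by simp
  also have "\<dots> \<longleftrightarrow> k mod m = 0" using m(1) m(3)[of "k mod m"] by (cases "k mod m = 0") auto
  finally show ?thesis by (simp add: dvd_eq_mod_eq_0)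
qed

lemma primitive_root_of_unity_power_inject:
  assumes z: "primitive_root_of_unity m z" and ab: "a < m" "b < m" "z ^ a = z ^ b"
  shows "a = b"
proof -
  have z0: "z \<noteq> 0" using z by (auto simp: primitive_root_of_unity_def power_0_left split: if_splits)
  have "a = b" if "a \<le> b" "b < m" "z ^ a = z ^ b" for a b
  proof -
    have "z ^ a * z ^ (b - a) = z ^ b" using that(1) by (simp flip: power_add)
    then have "z ^ (b - a) = 1" using that(3) z0 by simp
    then have "m dvd b - a" by (simp add: primitive_root_of_unity_dvd[OF z])
    then show ?thesis using that by (auto dest: dvd_imp_le)
  qed
  then show ?thesis using ab by (metis nat_le_linear)
qed

lemma primitive_root_of_unity_exists:
  assumes "m > 0"
  shows "\<exists>z. primitive_root_of_unity m z"
proof -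
  let ?z = "exp (2 * of_real pi * \<i> / of_nat m)"
  have "?z ^ k = 1 \<longleftrightarrow> m dvd k" for k
    using complex_root_unity_eq_1[of m k] assms
    by (simp add: exp_of_nat_mult[symmetric] mult_ac)
  then have "primitive_root_of_unity m ?z"
    using assms by (auto simp: primitive_root_of_unity_def dest: dvd_imp_le)
  then show ?thesis by blast
qed

definition cyclic_enumeration :: "('n::finite \<Rightarrow> 'n) \<Rightarrow> ('n \<Rightarrow> nat) \<Rightarrow> bool" where
  "cyclic_enumeration \<sigma> e \<longleftrightarrow>
     bij_betw e UNIV {..<CARD('n)} \<and> (\<forall>x. e (\<sigma> x) = Suc (e x) mod CARD('n))"

lemma cyclic_enumeration_exists:
  obtains \<sigma> :: "'n::finite \<Rightarrow> 'n" and e where "\<sigma> permutes UNIV" "cyclic_enumeration \<sigma> e"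
proof -
  let ?n = "CARD('n)"
  obtain e :: "'n \<Rightarrow> nat" where e: "bij_betw e UNIV {..<?n}"
    using ex_bij_betw_finite_nat[of "UNIV :: 'n set"] by (auto simp: atLeast0LessThan)
  define \<sigma> where "\<sigma> x = inv_into UNIV e (Suc (e x) mod ?n)" for x
  have e_\<sigma>: "e (\<sigma> x) = Suc (e x) mod ?n" for x
    unfolding \<sigma>_def using bij_betw_inv_into_right[OF e] by simp
  have inj_e: "inj e" and e_less: "e x < ?n" for x using e by (auto simp: bij_betw_def)
  have "inj \<sigma>"
  proof
    fix x y assume "\<sigma> x = \<sigma> y"
    then have "Suc (e x) mod ?n = Suc (e y) mod ?n" using e_\<sigma> by metis
    then have "e x = e y"
      using e_less[of x] e_less[of y] by (auto simp: mod_Suc split: if_splits)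
    then show "x = y" using inj_e by (simp add: inj_eq)
  qed
  then have "\<sigma> permutes UNIV" using inj_imp_permutes[of \<sigma> UNIV] by auto
  then show ?thesis using that e e_\<sigma> by (auto simp: cyclic_enumeration_def)
qed

lemma inj_primitive_root_powers:
  assumes d: "d > 0" and l: "primitive_root_of_unity (d * n) l"
    and e: "inj e" "\<And>i. e i < n"
  shows "inj (\<lambda>i. (1 / l ^ e i) ^ d)"
proof
  fix i j assume "(1 / l ^ e i) ^ d = (1 / l ^ e j) ^ d"
  then have "l ^ (d * e i) = l ^ (d * e j)"
    by (simp add: power_divide power_mult[symmetric] mult.commute)
  then have "d * e i = d * e j"
    using e(2) d by (intro primitive_root_of_unity_power_inject[OF l]) simp_all
  then show "i = j" using d e(1) by (simp add: inj_eq)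
qed

lemma regular_integer_exists:
  assumes d: "d \<ge> 2"
  shows "regular_integer (Gd1n d :: 'n::finite cmat_group) (d * CARD('n))"
proof -
  let ?n = "CARD('n)"
  have d0: "d > 0" using d by simp
  obtain l where l: "primitive_root_of_unity (d * ?n) l"
    using primitive_root_of_unity_exists[of "d * ?n"] d by auto
  have l_n: "l ^ (d * ?n) = 1" and l0: "l \<noteq> 0"
    using l d by (auto simp: primitive_root_of_unity_def power_0_left split: if_splits)
  obtain \<sigma> :: "'n \<Rightarrow> 'n" and e where \<sigma>: "\<sigma> permutes UNIV" and e: "cyclic_enumeration \<sigma> e"
    by (rule cyclic_enumeration_exists)
  have e_less: "e j < ?n" and inj_e: "inj e" and e_\<sigma>: "e (\<sigma> j) = Suc (e j) mod ?n" for j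
    using e by (auto simp: cyclic_enumeration_def bij_betw_def)
  define v :: "complex ^ 'n" where "v = (\<chi> j. 1 / l ^ e j)"
  define t where "t j = l * v $ \<sigma> j / v $ j" for j
  have v0: "v $ j \<noteq> 0" for j by (simp add: v_def l0)
  have "t j ^ d = 1" for j
  proof (cases "Suc (e j) < ?n")
    case True
    then show ?thesis by (simp add: t_def v_def e_\<sigma> l0)
  next
    case False
    then have last: "Suc (e j) = ?n" using e_less[of j] by simp
    then have "t j = l ^ ?n" by (simp add: t_def v_def e_\<sigma> flip: last)
    then show ?thesis using l_n by (simp add: power_mult[symmetric] mult.commute)
  qed
  then have t: "t \<in> root_vectors d" by simp
  have "inj (\<lambda>i. (v $ i) ^ d)"
    using inj_primitive_root_powers[OF d0 l inj_e e_less] by (simp add: v_def)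
  moreover have "mono_mat \<sigma> t *v v = l *s v"
    unfolding mono_mat_eigenvector_iff[OF \<sigma>] using v0 by (simp add: t_def)
  ultimately have "regular_eigenpair (Gd1n d) (mono_mat \<sigma> t) l v"
    using v0 by (auto simp: regular_eigenpair_def avoids_reflections_iff[OF d])
  then show ?thesis
    unfolding regular_integer_def using l mono_mat_in_carrier[OF d0 \<sigma> t] by blast
qed

lemma regular_integer_le:
  assumes d: "d \<ge> 2" and m: "regular_integer (Gd1n d :: 'n::finite cmat_group) m"
  shows "m \<le> d * CARD('n)"
proof -
  obtain A l and v :: "complex ^ 'n" where A: "A \<in> carrier (Gd1n d)"
    and regular: "regular_eigenpair (Gd1n d) A l v" and l: "primitive_root_of_unity m l"
    using m unfolding regular_integer_def by blast
  have "l ^ (d * CARD('n)) = color_of A ^ d"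
    using regular_eigenvalue_power_card[OF d A regular] by (simp add: mult.commute[of d] power_mult)
  also have "\<dots> = 1" using color_of_power[OF _ A] d by simp
  finally have "m dvd d * CARD('n)" by (simp add: primitive_root_of_unity_dvd[OF l])
  then show ?thesis using d by (intro dvd_imp_le) auto
qed

lemma coxeter_number_Gd1n:
  "d \<ge> 2 \<Longrightarrow> coxeter_number (Gd1n d :: 'n::finite cmat_group) = d * CARD('n)"
  unfolding coxeter_number_def
  by (rule Greatest_equality) (simp_all add: regular_integer_exists regular_integer_le)

lemma ord_dvd_of_regular_eigenvalue:
  fixes v :: "complex ^ 'n::finite"
  assumes d: "d \<ge> 2" and A: "A \<in> carrier (Gd1n d)" and regular: "regular_eigenpair (Gd1n d) A l v"
    and l: "l ^ k = 1"
  shows "group.ord (Gd1n d) A dvd k"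
proof -
  have d0: "d > 0" using d by simp
  interpret group "Gd1n d :: 'n cmat_group" by (rule group_Gd1n[OF d0])
  have eigen: "A *v v = l *s v" and v: "v $ j \<noteq> 0" "inj (\<lambda>i. (v $ i) ^ d)" for j
    using regular by (auto simp: regular_eigenpair_def avoids_reflections_iff[OF d])
  have "(A [^]\<^bsub>Gd1n d\<^esub> m) *v v = l ^ m *s v" for m :: nat
  proof (induction m)
    case (Suc m)
    have "(A [^]\<^bsub>Gd1n d\<^esub> Suc m) *v v = (A [^]\<^bsub>Gd1n d\<^esub> m) *v (A *v v)"
      by (simp add: matrix_vector_mul_assoc)
    also have "\<dots> = l *s ((A [^]\<^bsub>Gd1n d\<^esub> m) *v v)" unfolding eigen by (rule vec.scale)
    finally show ?case by (simp add: Suc.IH)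
  qed simp
  then have "v \<in> fix_space (A [^]\<^bsub>Gd1n d\<^esub> k)" using l by (simp add: fix_space_def)
  then have "A [^]\<^bsub>Gd1n d\<^esub> k = mat 1"
    using A by (intro stabilizer_trivial[OF d0 v]) auto
  then show ?thesis using pow_eq_id[OF A, of k] by simp
qed

theorem coxeter_element_Gd1n:
  fixes c :: "complex ^ 'n ^ 'n::finite"
  assumes d: "d \<ge> 2" and c: "coxeter_element (Gd1n d) c"
  shows "c \<in> carrier (Gd1n d)" "cyclic_on (perm_of c) UNIV" "color_of c \<noteq> 1"
proof -
  let ?n = "CARD('n)"
  obtain l v where regular: "regular_eigenpair (Gd1n d) c l v" and carrier: "c \<in> carrier (Gd1n d)"
    using c unfolding coxeter_element_def regular_element_def by blast
  show "c \<in> carrier (Gd1n d)" by (rule carrier)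
  have dvd: "d * ?n dvd k" if "l ^ k = 1" for k
    using ord_dvd_of_regular_eigenvalue[OF d carrier regular that] c
      coxeter_number_Gd1n[OF d, where 'n = 'n]
    by (simp add: coxeter_element_def)
  fix x :: 'n
  let ?O = "orbit (perm_of c) x"
  have "d * ?n dvd d * card ?O"
    using regular_eigenvalue_power_orbit[OF d carrier regular] by (rule dvd)
  then have "?n dvd card ?O" using d by simp
  moreover have "card ?O > 0" using orbit_nonempty[of "perm_of c" x] by (simp add: card_gt_0_iff)
  ultimately have "card ?O = ?n" by (intro antisym card_mono dvd_imp_le) auto
  then have "?O = UNIV" by (intro card_subset_eq) auto
  then show "cyclic_on (perm_of c) UNIV" by (intro cyclic_on_singleI[of x]) auto
  show "color_of c \<noteq> 1"
  proof
    assume "color_of c = 1"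
    then have "l ^ ?n = 1" using regular_eigenvalue_power_card[OF d carrier regular] by simp
    then have "d * ?n dvd ?n" by (rule dvd)
    then show False using d by (auto dest!: dvd_imp_le)
  qed
qed

section \<open>Conjugacy of elements with a cyclic permutation\<close>

lemma cyclic_enumeration_of_cyclic:
  fixes \<sigma> :: "'n::finite \<Rightarrow> 'n"
  assumes cyclic: "cyclic_on \<sigma> UNIV"
  obtains e where "cyclic_enumeration \<sigma> e"
proof -
  let ?n = "CARD('n)"
  define r :: 'n where "r = undefined"
  define f where "f k = (\<sigma> ^^ k) r" for k
  have orbit: "orbit \<sigma> r = UNIV" using orbit_cyclic_eq3[OF cyclic] by simp
  have r: "r \<in> orbit \<sigma> r" by (simp add: orbit)
  have bij_dist: "bij_betw f {..<funpow_dist1 \<sigma> r r} UNIV"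
    unfolding bij_betw_def f_def lessThan_atLeast0
    using inj_on_funpow_dist1[OF r] orbit_conv_funpow_dist1[OF r] orbit by simp
  then have n: "funpow_dist1 \<sigma> r r = ?n" using bij_betw_same_card by fastforce
  have bij: "bij_betw f {..<?n} UNIV" using bij_dist unfolding n .
  have "f ?n = f 0" using funpow_dist1_prop[OF r] unfolding n f_def by simp
  then have \<sigma>_f: "\<sigma> (f k) = f (Suc k mod ?n)" if "k < ?n" for k
    using that by (cases "Suc k = ?n") (auto simp: f_def dest: sym)
  define e where "e = inv_into {..<?n} f"
  have e_f: "e (f k) = k" if "k < ?n" for k
    unfolding e_def using bij_betw_inv_into_left[OF bij] that by simp
  have "e (\<sigma> x) = Suc (e x) mod ?n" for x
  proof -
    obtain k where "k < ?n" "x = f k" using bij by (auto simp: bij_betw_def)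
    then show ?thesis by (simp add: \<sigma>_f e_f)
  qed
  moreover have "bij_betw e UNIV {..<?n}" unfolding e_def by (rule bij_betw_inv_into[OF bij])
  ultimately show ?thesis using that[of e] by (simp add: cyclic_enumeration_def)
qed

lemma cyclic_permutations_conjugate:
  fixes \<sigma> \<tau> :: "'n::finite \<Rightarrow> 'n"
  assumes "cyclic_on \<sigma> UNIV" "cyclic_on \<tau> UNIV"
  obtains \<pi> where "\<pi> permutes UNIV" "\<pi> \<circ> \<sigma> = \<tau> \<circ> \<pi>"
proof -
  obtain e where e: "bij_betw e UNIV {..<CARD('n)}" "\<And>x. e (\<sigma> x) = Suc (e x) mod CARD('n)"
    using cyclic_enumeration_of_cyclic[OF assms(1)] by (auto simp: cyclic_enumeration_def)
  obtain e' where e': "bij_betw e' UNIV {..<CARD('n)}" "\<And>x. e' (\<tau> x) = Suc (e' x) mod CARD('n)"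
    using cyclic_enumeration_of_cyclic[OF assms(2)] by (auto simp: cyclic_enumeration_def)
  define \<pi> where "\<pi> = inv_into UNIV e' \<circ> e"
  have "bij \<pi>" unfolding \<pi>_def using e(1) bij_betw_inv_into[OF e'(1)] by (rule bij_betw_trans)
  then have "\<pi> permutes UNIV" by (rule bij_imp_permutes) simp
  moreover have e'_\<pi>: "e' (\<pi> x) = e x" for x
  proof -
    have "e x \<in> {..<CARD('n)}" using e(1) by (auto simp: bij_betw_def)
    then show ?thesis unfolding \<pi>_def using bij_betw_inv_into_right[OF e'(1)] by simp
  qed
  have "e' (\<pi> (\<sigma> x)) = e' (\<tau> (\<pi> x))" for x by (simp add: e'_\<pi> e(2) e'(2))
  then have "\<pi> \<circ> \<sigma> = \<tau> \<circ> \<pi>"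
    using bij_betw_imp_inj_on[OF e'(1)] by (auto simp: fun_eq_iff inj_eq)
  ultimately show ?thesis by (rule that)
qed

lemma cyclic_coboundary:
  fixes a :: "'n::finite \<Rightarrow> 'a::comm_monoid_mult"
  assumes cyclic: "cyclic_on \<sigma> UNIV" and a: "(\<Prod>x\<in>UNIV. a x) = 1"
  obtains u where "\<And>x. u (\<sigma> x) = a x * u x" "\<And>x. u x \<in> range (\<lambda>B. \<Prod>y\<in>B. a y)"
proof -
  obtain e where e: "bij_betw e UNIV {..<CARD('n)}" "\<And>x. e (\<sigma> x) = Suc (e x) mod CARD('n)"
    using cyclic_enumeration_of_cyclic[OF cyclic] by (auto simp: cyclic_enumeration_def)
  have e_less: "e x < CARD('n)" and inj_e: "inj e" for x using e(1) by (auto simp: bij_betw_def)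
  define u where "u x = (\<Prod>y | e y < e x. a y)" for x
  have "u (\<sigma> x) = a x * u x" for x
  proof -
    have "{y. e y < Suc (e x)} = insert x {y. e y < e x}"
      using inj_e by (auto simp: less_Suc_eq inj_eq)
    then have step: "(\<Prod>y | e y < Suc (e x). a y) = a x * u x" by (simp add: u_def)
    show ?thesis
    proof (cases "Suc (e x) < CARD('n)")
      case True
      then show ?thesis using step by (simp add: u_def e(2))
    next
      case False
      then have "Suc (e x) = CARD('n)" using e_less[of x] by simp
      then show ?thesis using step a e_less by (simp add: u_def e(2))
    qed
  qed
  then show ?thesis by (rule that) (simp add: u_def)
qed

lemma conjugate_of_same_color:
  fixes A B :: "complex ^ 'n ^ 'n::finite"
  assumes d: "d > 0" and A: "A \<in> carrier (Gd1n d)" "cyclic_on (perm_of A) UNIV"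
    and B: "B \<in> carrier (Gd1n d)" "cyclic_on (perm_of B) UNIV"
    and color: "color_of A = color_of B"
  obtains h where "h \<in> carrier (Gd1n d)" "h ** A = B ** h"
proof -
  obtain \<sigma> t where A_mono: "A = mono_mat \<sigma> t" "t \<in> root_vectors d"
    "perm_of A = \<sigma>" "color_of A = (\<Prod>j\<in>UNIV. t j)"
    using carrier_Gd1nE[OF d A(1)] by blast
  obtain \<tau> s where B_mono: "B = mono_mat \<tau> s" "s \<in> root_vectors d"
    "perm_of B = \<tau>" "color_of B = (\<Prod>j\<in>UNIV. s j)"
    using carrier_Gd1nE[OF d B(1)] by blast
  have nonzero: "t j \<noteq> 0" "s j \<noteq> 0" for j using A_mono(2) B_mono(2) root_of_unity_nonzero[OF _ d] by auto
  obtain \<pi> where \<pi>: "\<pi> permutes UNIV" "\<pi> \<circ> \<sigma> = \<tau> \<circ> \<pi>"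
    using cyclic_permutations_conjugate A(2) B(2) A_mono(3) B_mono(3) by metis
  define a where "a x = s (\<pi> x) / t x" for x
  have "(\<Prod>x\<in>UNIV. s (\<pi> x)) = (\<Prod>x\<in>UNIV. s x)"
    using prod.permute[OF \<pi>(1), of s] by (simp add: o_def)
  then have "(\<Prod>x\<in>UNIV. a x) = 1"
    using color nonzero by (simp add: a_def prod_dividef A_mono(4) B_mono(4))
  then obtain u where u: "\<And>x. u (\<sigma> x) = a x * u x" "\<And>x. u x \<in> range (\<lambda>B. \<Prod>y\<in>B. a y)"
    using cyclic_coboundary A(2) A_mono(3) by metis
  have a_root: "a x ^ d = 1" for x using A_mono(2) B_mono(2) by (simp add: a_def power_divide)
  have "u x ^ d = 1" for x
  proof -
    obtain B where "u x = (\<Prod>y\<in>B. a y)" using u(2)[of x] by blast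
    then show ?thesis by (simp add: prod_power_distrib a_root)
  qed
  then have "u \<in> root_vectors d" by simp
  then have "mono_mat \<pi> u \<in> carrier (Gd1n d)" by (rule mono_mat_in_carrier[OF d \<pi>(1)])
  moreover have "(\<lambda>j. u (\<sigma> j) * t j) = (\<lambda>j. s (\<pi> j) * u j)"
    using nonzero by (simp add: u(1) a_def fun_eq_iff)
  then have "mono_mat \<pi> u ** A = B ** mono_mat \<pi> u"
    unfolding A_mono(1) B_mono(1) mono_mat_mult \<pi>(2) by simp
  ultimately show ?thesis by (rule that)
qed

lemma dim_fix_space_conjugate:
  fixes A h :: "complex ^ 'n ^ 'n::finite"
  assumes "h ** k = mat 1" "k ** h = mat 1"
  shows "vec.dim (fix_space (h ** A ** k)) = vec.dim (fix_space A)"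
proof -
  have inv: "h *v (k *v v) = v" "k *v (h *v v) = v" for v :: "complex ^ 'n"
    using assms by (simp_all add: matrix_vector_mul_assoc)
  have conjugate: "(h ** A ** k) *v v = h *v (A *v (k *v v))" for v
    by (simp add: matrix_vector_mul_assoc matrix_mul_assoc)
  have "fix_space (h ** A ** k) = (*v) h ` fix_space A"
  proof (intro equalityI subsetI)
    fix v assume "v \<in> fix_space (h ** A ** k)"
    then have "h *v (A *v (k *v v)) = v" by (simp add: fix_space_def conjugate)
    then have "A *v (k *v v) = k *v v" by (metis inv(2))
    then have "k *v v \<in> fix_space A" by (simp add: fix_space_def)
    then show "v \<in> (*v) h ` fix_space A" by (metis image_eqI inv(1))
  qed (auto simp: fix_space_def conjugate inv)
  moreover have "inj_on ((*v) h) (vec.span (fix_space A))" by (metis inj_onI inv(2))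
  ultimately show ?thesis using vec.dim_image_eq[OF matrix_vector_mul_linear_gen] by metis
qed

section \<open>Counting factorizations\<close>

lemma word_sum_indicator_conjugate:
  fixes A B h :: "complex ^ 'n ^ 'n::finite"
  assumes d: "d > 0" and h: "h \<in> carrier (Gd1n d)" "h ** A = B ** h"
  shows "word_sum (Gd1n d) (fix_weight d) js (\<lambda>g. of_bool (g = A)) =
    word_sum (Gd1n d) (fix_weight d) js (\<lambda>g. of_bool (g = B))"
proof -
  interpret group "Gd1n d :: 'n cmat_group" by (rule group_Gd1n[OF d])
  define k where "k = inv\<^bsub>Gd1n d\<^esub> h"
  have k: "h ** k = mat 1" "k ** h = mat 1"
    using r_inv[OF h(1)] l_inv[OF h(1)] by (simp_all add: k_def)
  have "h ** g ** k = B \<longleftrightarrow> g = A" for g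
  proof -
    have "h ** g ** k = B \<longleftrightarrow> h ** g ** k ** h = B ** h"
      by (metis k(1) matrix_mul_assoc matrix_mul_rid)
    also have "\<dots> \<longleftrightarrow> h ** g = h ** A" by (simp add: h(2) k(2) flip: matrix_mul_assoc)
    also have "\<dots> \<longleftrightarrow> g = A" by (metis k(2) matrix_mul_assoc matrix_mul_lid)
    finally show ?thesis .
  qed
  moreover have "word_sum (Gd1n d) (fix_weight d) js
      (\<lambda>g. of_bool (h \<otimes>\<^bsub>Gd1n d\<^esub> g \<otimes>\<^bsub>Gd1n d\<^esub> inv\<^bsub>Gd1n d\<^esub> h = B)) =
    word_sum (Gd1n d) (fix_weight d) js (\<lambda>g. of_bool (g = B))"
    by (rule word_sum_conjugate[OF is_group h(1), where F = "\<lambda>g. of_bool (g = B)"])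
       (simp add: fix_weight_def dim_fix_space_conjugate k flip: k_def)
  ultimately show ?thesis by (simp flip: k_def)
qed

definition cyclic_elements :: "nat \<Rightarrow> complex \<Rightarrow> (complex ^ 'n ^ 'n::finite) set" where
  "cyclic_elements d \<omega> = {A \<in> carrier (Gd1n d). cyclic_on (perm_of A) UNIV \<and> color_of A = \<omega>}"

lemma card_cyclic_elements_mult_word_sum:
  fixes c :: "complex ^ 'n ^ 'n::finite"
  assumes d: "d > 0" and c: "c \<in> cyclic_elements d \<omega>"
  shows "of_nat (card (cyclic_elements d \<omega> :: (complex ^ 'n ^ 'n) set)) *
      word_sum (Gd1n d) (fix_weight d) js (\<lambda>A. of_bool (A = c)) =
    word_sum (Gd1n d :: 'n cmat_group) (fix_weight d) js
      (\<lambda>A. of_bool (cyclic_on (perm_of A) UNIV) * of_bool (color_of A = \<omega>))"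
proof -
  let ?Y = "cyclic_elements d \<omega> :: (complex ^ 'n ^ 'n) set"
  let ?W = "word_sum (Gd1n d :: 'n cmat_group) (fix_weight d) js"
  have finite_Y: "finite ?Y"
    unfolding cyclic_elements_def by (rule finite_subset[OF _ finite_carrier_Gd1n[OF d]]) auto
  have "?W (\<lambda>A. of_bool (A = B)) = ?W (\<lambda>A. of_bool (A = c))" if B: "B \<in> ?Y" for B
  proof -
    have "B \<in> carrier (Gd1n d)" "cyclic_on (perm_of B) UNIV" "c \<in> carrier (Gd1n d)"
      "cyclic_on (perm_of c) UNIV" "color_of B = color_of c"
      using B c by (simp_all add: cyclic_elements_def)
    then show ?thesis
      by (rule conjugate_of_same_color[OF d]) (rule word_sum_indicator_conjugate[OF d])
  qed
  then have "of_nat (card ?Y) * ?W (\<lambda>A. of_bool (A = c)) = (\<Sum>B\<in>?Y. 1 * ?W (\<lambda>A. of_bool (A = B)))"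
    by simp
  also have "\<dots> = ?W (\<lambda>A. \<Sum>B\<in>?Y. 1 * of_bool (A = B))"
    by (rule word_sum_linear[symmetric])
  also have "\<dots> = ?W (\<lambda>A. of_bool (cyclic_on (perm_of A) UNIV) * of_bool (color_of A = \<omega>))"
  proof (rule word_sum_cong[OF monoid_Gd1n[OF d]])
    fix A :: "complex ^ 'n ^ 'n" assume "A \<in> carrier (Gd1n d)"
    moreover have "(\<Sum>B\<in>?Y. 1 * of_bool (A = B)) = (of_bool (A \<in> ?Y) :: rat)"
      using finite_Y by (simp add: of_bool_def)
    ultimately show "(\<Sum>B\<in>?Y. 1 * of_bool (A = B)) =
        (of_bool (cyclic_on (perm_of A) UNIV) * of_bool (color_of A = \<omega>) :: rat)"
      by (simp add: cyclic_elements_def)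
  qed
  finally show ?thesis .
qed

lemma card_cyclic_elements:
  fixes c :: "complex ^ 'n ^ 'n::finite"
  assumes d: "d > 0" and c: "c \<in> cyclic_elements d \<omega>" and \<omega>: "\<omega> \<noteq> 1"
  shows "CARD('n) * d * card (cyclic_elements d \<omega> :: (complex ^ 'n ^ 'n) set) =
    order (Gd1n d :: 'n cmat_group)"
proof -
  let ?n = "CARD('n)" and ?Y = "cyclic_elements d \<omega> :: (complex ^ 'n ^ 'n) set"
  have c_carrier: "c \<in> carrier (Gd1n d)" and "\<omega> ^ d = 1"
    using c color_of_power[OF d, of c] by (auto simp: cyclic_elements_def)
  txt \<open>The number of conjugates of \<open>c\<close> is read off from the case of a single factor of weight \<open>1\<close>.\<close>
  have "word_sum (Gd1n d) (fix_weight d) [0] (\<lambda>A. of_bool (A = c)) = 1"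
    using c_carrier finite_carrier_Gd1n[OF d, where 'n = 'n] by (simp add: fix_weight_def of_bool_def)
  then have "of_nat (?n * d) * of_nat (card ?Y) =
      of_nat (?n * d) * word_sum (Gd1n d :: 'n cmat_group) (fix_weight d) [0]
        (\<lambda>A. of_bool (cyclic_on (perm_of A) UNIV) * of_bool (color_of A = \<omega>))"
    using card_cyclic_elements_mult_word_sum[OF d c, of "[0]"] by (simp only: mult_1_right)
  also have "\<dots> = of_nat (order (Gd1n d :: 'n cmat_group)) ^ length [0::nat] *
      (\<Sum>t\<le>?n. (-1) ^ t * of_nat (?n choose t) * (\<Prod>j\<leftarrow>[0]. of_nat ((j + ?n - t) choose ?n)))"
    by (rule word_sum_cyclic_color[OF d \<open>\<omega> ^ d = 1\<close> \<omega>])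
  also have "(\<Sum>t\<le>?n. (-1) ^ t * of_nat (?n choose t) * (\<Prod>j\<leftarrow>[0]. of_nat ((j + ?n - t) choose ?n))) =
      (\<Sum>t\<le>?n. if t = 0 then 1 else 0 :: rat)"
    by (intro sum.cong refl) (auto simp: binomial_eq_0)
  finally have "rat_of_nat (?n * d * card ?Y) = of_nat (order (Gd1n d :: 'n cmat_group))" by simp
  then show ?thesis by (simp only: of_nat_eq_iff)
qed

theorem coxeter_word_sum:
  fixes c :: "complex ^ 'n ^ 'n::finite"
  assumes d: "d \<ge> 2" and c: "coxeter_element (Gd1n d) c" and js: "js \<noteq> []"
  defines "n \<equiv> CARD('n)" and "G \<equiv> Gd1n d :: 'n cmat_group"
  shows "word_sum G (fix_weight d) js (\<lambda>A. of_bool (A = c)) =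
    of_nat (order G ^ (length js - 1)) *
    (\<Sum>t\<le>n. (-1) ^ t * of_nat (n choose t) * (\<Prod>j\<leftarrow>js. of_nat ((j + n - t) choose n)))"
proof -
  have d0: "d > 0" using d by simp
  note coxeter = coxeter_element_Gd1n[OF d c]
  let ?\<omega> = "color_of c"
  let ?S = "\<Sum>t\<le>n. (-1) ^ t * of_nat (n choose t) * (\<Prod>j\<leftarrow>js. of_nat ((j + n - t) choose n)) :: rat"
  have c_cyclic: "c \<in> cyclic_elements d ?\<omega>" using coxeter by (simp add: cyclic_elements_def)
  have "of_nat (order G) * word_sum G (fix_weight d) js (\<lambda>A. of_bool (A = c)) = of_nat (n * d) *
      word_sum G (fix_weight d) js
        (\<lambda>A. of_bool (cyclic_on (perm_of A) UNIV) * of_bool (color_of A = ?\<omega>))"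
    unfolding G_def card_cyclic_elements[OF d0 c_cyclic coxeter(3), symmetric]
      card_cyclic_elements_mult_word_sum[OF d0 c_cyclic, symmetric] n_def
    by (simp only: of_nat_mult mult.assoc)
  also have "\<dots> = of_nat (order G) ^ length js * ?S"
    unfolding G_def n_def
    by (rule word_sum_cyclic_color[OF d0 color_of_power[OF d0 coxeter(1)] coxeter(3)])
  also have "\<dots> = of_nat (order G) * (of_nat (order G ^ (length js - 1)) * ?S)"
    using js by (cases js) simp_all
  finally show ?thesis
    using d0 by (simp add: G_def order_Gd1n)
qed

lemma factorization_count_support:
  fixes G :: "'n::finite cmat_group"
  assumes "factorization_count G c r \<noteq> 0"
  shows "set r \<subseteq> {..CARD('n)}"
proof
  fix x assume "x \<in> set r"
  then obtain i where i: "i < length r" "x = r ! i" by (auto simp: in_set_conv_nth)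
  have "{u. length u = length r \<and> set u \<subseteq> carrier G \<and> foldr (monoid.mult G) u (one G) = c \<and>
      (\<forall>i < length r. vec.dim (fix_space (u ! i)) = r ! i)} \<noteq> {}"
    using assms unfolding factorization_count_def by (metis card.empty)
  then obtain u where "\<forall>i < length r. vec.dim (fix_space (u ! i) :: (complex ^ 'n) set) = r ! i" by blast
  then have "x = vec.dim (fix_space (u ! i) :: (complex ^ 'n) set)" using i by simp
  then show "x \<in> {..CARD('n)}" by (simp add: dim_subset_UNIV_cart_gen)
qed

lemma factorization_count_eq_card:
  "factorization_count G c r = card {us \<in> tuples (carrier G) (length r).
     foldr (monoid.mult G) us (one G) = c \<and> map (\<lambda>A. vec.dim (fix_space A)) us = r}"
  unfolding factorization_count_def tuples_def
  by (intro arg_cong[where f = card]) (auto simp: list_eq_iff_nth_eq)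

theorem sum_factorization_count:
  fixes c :: "complex ^ 'n ^ 'n::finite"
  assumes d: "d > 0"
  defines "G \<equiv> Gd1n d :: 'n cmat_group"
  shows "(\<Sum>r\<in>tuples {..CARD('n)} (length js).
      of_nat (factorization_count G c r) * (\<Prod>i<length js. (1 + of_nat (d * js ! i)) ^ (r ! i))) =
    word_sum G (fix_weight d) js (\<lambda>A. of_bool (A = c))"
proof -
  let ?k = "length js" and ?product = "\<lambda>us. foldr (monoid.mult G) us (one G)"
  let ?U = "tuples (carrier G) ?k"
  let ?dims = "map (\<lambda>A :: complex ^ 'n ^ 'n. vec.dim (fix_space A))"
  let ?weight = "\<lambda>r. \<Prod>i<?k. (1 + rat_of_nat (d * js ! i)) ^ (r ! i)"
  have finite_U: "finite ?U" unfolding G_def by (rule finite_tuples[OF finite_carrier_Gd1n[OF d]])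
  have "word_sum G (fix_weight d) js (\<lambda>A. of_bool (A = c)) =
      (\<Sum>us\<in>?U. ?weight (?dims us) * of_bool (?product us = c))"
    unfolding word_sum_eq_sum_tuples
    by (intro sum.cong refl arg_cong2[where f = "(*)"] prod.cong) (auto simp: fix_weight_def tuples_def)
  also have "\<dots> = (\<Sum>us\<in>{us \<in> ?U. ?product us = c}. ?weight (?dims us))"
    using finite_U by (simp add: sum.inter_filter of_bool_def if_distrib cong: if_cong)
  also have "\<dots> = (\<Sum>r\<in>tuples {..CARD('n)} ?k.
      \<Sum>us | us \<in> {us \<in> ?U. ?product us = c} \<and> ?dims us = r. ?weight (?dims us))"
  proof (rule sum.group[symmetric])
    show "finite {us \<in> ?U. ?product us = c}" using finite_U by simp
    show "?dims ` {us \<in> ?U. ?product us = c} \<subseteq> tuples {..CARD('n)} ?k"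
      by (auto simp: tuples_def dim_subset_UNIV_cart_gen)
  qed (simp add: finite_tuples)
  also have "\<dots> = (\<Sum>r\<in>tuples {..CARD('n)} ?k. of_nat (factorization_count G c r) * ?weight r)"
  proof (intro sum.cong refl)
    fix r assume "r \<in> tuples {..CARD('n)} ?k"
    then have "factorization_count G c r = card {us. us \<in> {us \<in> ?U. ?product us = c} \<and> ?dims us = r}"
      unfolding factorization_count_eq_card by (simp add: tuples_def conj_assoc)
    then show "(\<Sum>us | us \<in> {us \<in> ?U. ?product us = c} \<and> ?dims us = r. ?weight (?dims us)) =
        of_nat (factorization_count G c r) * ?weight r" by simp
  qed
  finally show ?thesis by (rule sym)
qed

theorem mixed_difference_factorization_count:
  fixes c :: "complex ^ 'n ^ 'n::finite"
  assumes d: "d \<ge> 2" and c: "coxeter_element (Gd1n d) c" and k: "k \<ge> 1"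
    and p: "p \<in> tuples {..CARD('n)} k"
  shows "mixed_difference CARD('n) p (\<lambda>q. \<Sum>r\<in>tuples {..CARD('n)} k.
      of_nat (factorization_count (Gd1n d) c r) * (\<Prod>i<k. (1 + of_nat (d * q ! i)) ^ (r ! i))) =
    of_nat (order (Gd1n d :: 'n cmat_group) ^ (k - 1)) * (of_int (M_coeff CARD('n) p) :: rat)"
proof -
  let ?n = "CARD('n)" and ?g = "rat_of_nat (order (Gd1n d :: 'n cmat_group) ^ (k - 1))"
  have "(\<Sum>r\<in>tuples {..?n} k.
      of_nat (factorization_count (Gd1n d) c r) * (\<Prod>i<k. (1 + of_nat (d * q ! i)) ^ (r ! i))) =
    ?g * (\<Sum>t\<le>?n. (-1) ^ t * of_nat (?n choose t) * (\<Prod>i<k. of_nat ((q ! i + (?n - t)) choose ?n)))"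
    if "q \<in> tuples {..?n} (length p)" for q
  proof -
    have len: "length q = k" using that p by (simp add: tuples_def)
    then have "q \<noteq> []" using k by auto
    moreover have "(\<Prod>j\<leftarrow>q. rat_of_nat ((j + ?n - t) choose ?n)) =
        (\<Prod>i<k. of_nat ((q ! i + (?n - t)) choose ?n))"
      if "t \<le> ?n" for t
      using that len by (simp add: prod.list_conv_set_nth atLeast0LessThan)
    ultimately show ?thesis
      using sum_factorization_count[where js = q and c = c and d = d] coxeter_word_sum[OF d c] d
      by (simp add: len)
  qed
  then have "mixed_difference ?n p (\<lambda>q. \<Sum>r\<in>tuples {..?n} k.
      of_nat (factorization_count (Gd1n d) c r) * (\<Prod>i<k. (1 + of_nat (d * q ! i)) ^ (r ! i))) =
    mixed_difference ?n p (\<lambda>q. ?g *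
      (\<Sum>t\<le>?n. (-1) ^ t * of_nat (?n choose t) * (\<Prod>i<k. of_nat ((q ! i + (?n - t)) choose ?n))))"
    by (rule mixed_difference_cong)
  then show ?thesis unfolding mixed_difference_scale mixed_difference_eq_M_coeff[OF p] .
qed

theorem theorem3p1:
  fixes d k :: nat and c :: "complex^'n^'n"
  assumes "d \<ge> 2" and "k \<ge> 1"
    and "coxeter_element (Gd1n d) c"
  shows "(\<Sum>r | length r = k \<and> factorization_count (Gd1n d) c r \<noteq> 0.
            of_nat (factorization_count (Gd1n d) c r) * (\<Prod>i<k. X i ^ (r ! i)))
       = (of_nat (order (Gd1n d :: 'n cmat_group) ^ (k - 1)) *
          (\<Sum>p | length p = k \<and> M_coeff CARD('n) p \<noteq> 0.
             of_int (M_coeff CARD('n) p) *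
             (\<Prod>i<k. Cst (1 / (of_nat d ^ (p ! i) * fact (p ! i))) * falling d (p ! i) (X i)))
          :: rat multipoly)"
proof -
  let ?T = "tuples {..CARD('n)} k" and ?count = "factorization_count (Gd1n d :: 'n cmat_group) c"
  let ?g = "order (Gd1n d :: 'n cmat_group) ^ (k - 1)" and ?M = "M_coeff CARD('n)"
  let ?N = "\<lambda>p. \<Prod>i<k. newton_basis d (p ! i) (X i)"
  have "(\<Sum>r | length r = k \<and> ?count r \<noteq> 0. of_nat (?count r) * (\<Prod>i<k. X i ^ (r ! i))) =
      (\<Sum>r\<in>?T. Cst (of_nat (?count r)) * (\<Prod>i<k. X i ^ (r ! i)) :: rat multipoly)"
    unfolding Cst_of_nat[symmetric] using factorization_count_support
    by (intro sum.mono_neutral_left finite_tuples) (auto simp: tuples_def)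
  also have "\<dots> = (\<Sum>p\<in>?T. Cst (of_nat ?g * of_int (?M p)) * ?N p)"
    using mixed_difference_factorization_count[OF assms(1,3,2)] assms(1)
    by (subst newton_interpolation[where d = d]) (simp_all cong: sum.cong)
  also have "\<dots> = of_nat ?g * (\<Sum>p\<in>?T. of_int (?M p) * ?N p)"
    unfolding sum_distrib_left by (simp only: Cst_mult Cst_of_nat Cst_of_int mult.assoc)
  also have "(\<Sum>p\<in>?T. of_int (?M p) * ?N p) = (\<Sum>p | length p = k \<and> ?M p \<noteq> 0. of_int (?M p) * ?N p)"
    using M_coeff_support by (intro sum.mono_neutral_right finite_tuples) (auto simp: tuples_def)
  finally show ?thesis unfolding newton_basis_def .
qed

end
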